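(* Let $\alpha,\beta,\gamma,a_1,\dots,a_n,b,c,d,x_1,\dots,x_n$ be complex parameters such that either $$\max\{|\alpha c|,|\alpha d|,|\alpha\beta a_{1}\cdots a_{n}/q^{n}|,|\alpha\gamma a_{1}\cdots a_{n}/q^{n}|\}<1\quad\text{and}\quad \max\{|\alpha a_rx_{r}|,|\alpha bx_{r}|:1\leq r\leq n\}<1,$$ or $a_r=q^{N_r}$ with $N_r$ a positive integer for $r=1,\dots,n$ (so that the series terminates). Suppose that none of the denominators in the following identity vanishes. Then $$\begin{aligned} & \frac{(\alpha\beta,\ \alpha\gamma,\ \alpha a_{1}\cdots a_{n}cq^{-n},\ \alpha a_{1}\cdots a_{n}dq^{-n})_{\infty}}{(\alpha c,\ \alpha d,\ \alpha\beta a_{1}\cdots a_{n}q^{-n},\ \alpha\gamma a_{1}\cdots a_{n}q^{-n})_{\infty}}\prod_{r=1}^{n}\frac{(\alpha qx_{r},\alpha a_{r}bx_{r}/q)_{\infty}}{(\alpha bx_{r},\alpha a_{r}x_{r})_{\infty}}\\ &=\sum_{k_1,\dots,k_n\ge0}\ \prod_{1\leq r<s\leq n}\frac{1-q^{k_{r}-k_{s}}x_{r}/x_{s}}{1-x_{r}/x_{s}}\prod_{r,s=1}^{n}\frac{(qx_{r}/(x_{s}a_{s}))_{k_{r}}}{(qx_{r}/x_{s})_{k_{r}}}\\ &\quad\times\prod_{r=1}^{n}\frac{1-\alpha x_{r}q^{k_{r}+|\boldsymbol{k}|}}{1-\alpha x_{r}}\prod_{r=1}^{n}\frac{(\alpha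 x_{r})_{|\boldsymbol{k}|}}{(\alpha x_{r}a_{r})_{|\boldsymbol{k}|}}(a_{1}\cdots a_{n})^{|\boldsymbol{k}|}q^{\sum_{r=1}^{n}(r-1)k_{r}-n|\boldsymbol{k}|}\\ &\quad\times\sum_{\substack{0\leq m_{r}\leq k_{r}\\ r=1,\dots,n}}\ \prod_{1\leq r<s\leq n}\frac{1-q^{m_{r}-m_{s}}x_{r}/x_{s}}{1-x_{r}/x_{s}}\prod_{r,s=1}^{n}\frac{(q^{-k_{s}}x_{r}/x_{s})_{m_{r}}}{(qx_{r}/x_{s})_{m_{r}}}\prod_{r=1}^{n}\frac{(\alpha x_{r}q^{|\boldsymbol{k}|})_{m_{r}}}{(\alpha bx_{r})_{m_{r}}}\cdot\frac{(\alpha\beta,\alpha\gamma)_{|\boldsymbol{m}|}}{(\alpha c,\alpha d)_{|\boldsymbol{m}|}}q^{\sum_{r=1}^{n}rm_{r}}. \end{aligned}$$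
   Context: $q$ is a complex number with $0<|q|<1$ and $n\ge1$ is an integer. $(z)_\infty=\prod_{i\ge0}(1-zq^i)$ and $(z)_k=(z)_\infty/(zq^k)_\infty=\prod_{i=0}^{k-1}(1-zq^i)$; $(c_1,\dots,c_p)_k=(c_1)_k\cdots(c_p)_k$ for $k$ a nonnegative integer or $\infty$. Bold letters denote multi-indices of nonnegative integers, $\boldsymbol k=(k_1,\dots,k_n)$, with $|\boldsymbol k|=k_1+\cdots+k_n$. If some $a_s=0$, the expression $\prod_{r,s}(qx_r/(x_sa_s))_{k_r}(a_1\cdots a_n)^{|\boldsymbol k|}$, which is polynomial in the $a_s$, is understood by continuity. *)

theory Defs
  imports "HOL-Analysis.Analysis"
begin

definition qpoch :: "complex \<Rightarrow> complex \<Rightarrow> nat \<Rightarrow> complex" where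
  "qpoch q z k = (\<Prod>i<k. 1 - z * q ^ i)"

definition qpoch_inf :: "complex \<Rightarrow> complex \<Rightarrow> complex" where
  "qpoch_inf q z = (\<Prod>i. 1 - z * q ^ i)"

(* q-shifted factorial homogenised in a: it equals a^k * (z/a)_k for a \<noteq> 0 and is
   a polynomial in a, hence gives the value "by continuity" at a = 0. *)
definition qpoch_hom :: "complex \<Rightarrow> complex \<Rightarrow> complex \<Rightarrow> nat \<Rightarrow> complex" where
  "qpoch_hom q z a k = (\<Prod>i<k. a - z * q ^ i)"

lemma qpoch_hom_eq:
  assumes "a \<noteq> 0"
  shows "qpoch_hom q z a k = a ^ k * qpoch q (z / a) k"
proof -
  have "qpoch_hom q z a k = (\<Prod>i<k. a * (1 - z / a * q ^ i))"
    unfolding qpoch_hom_def by (rule prod.cong) (use assms in \<open>auto simp: field_simps\<close>)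
  then show ?thesis
    by (simp add: qpoch_def prod.distrib)
qed

lemma continuous_on_qpoch_hom: "continuous_on UNIV (\<lambda>a. qpoch_hom q z a k)"
  unfolding qpoch_hom_def by (intro continuous_intros)

(* The powers a_s^(k_r) absorbed by the homogenised factors over all r, s together make up
   (a_1 ... a_n)^(k_1 + ... + k_n). *)
lemma prod_qpoch_hom_eq:
  fixes a x :: "nat \<Rightarrow> complex" and k :: "nat \<Rightarrow> nat"
  assumes "\<And>s. s \<in> {1..n} \<Longrightarrow> a s \<noteq> 0"
  shows "(\<Prod>r=1..n. \<Prod>s=1..n. qpoch_hom q (q * x r / x s) (a s) (k r)) =
         (\<Prod>r=1..n. \<Prod>s=1..n. qpoch q (q * x r / (x s * a s)) (k r)) *
         (\<Prod>s=1..n. a s) ^ (\<Sum>r=1..n. k r)"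
proof -
  have "(\<Prod>r=1..n. \<Prod>s=1..n. qpoch_hom q (q * x r / x s) (a s) (k r)) =
        (\<Prod>r=1..n. \<Prod>s=1..n. a s ^ k r * qpoch q (q * x r / (x s * a s)) (k r))"
    by (intro prod.cong refl) (use assms in \<open>auto simp: qpoch_hom_eq\<close>)
  also have "\<dots> = (\<Prod>r=1..n. (\<Prod>s=1..n. a s) ^ k r) *
        (\<Prod>r=1..n. \<Prod>s=1..n. qpoch q (q * x r / (x s * a s)) (k r))"
    by (simp add: prod.distrib prod_power_distrib)
  finally show ?thesis
    by (simp add: power_sum mult.commute)
qed

(* Product over 1 \<le> r < s \<le> n. *)
definition vandermonde_quot ::
    "complex \<Rightarrow> nat \<Rightarrow> (nat \<Rightarrow> complex) \<Rightarrow> (nat \<Rightarrow> nat) \<Rightarrow> complex" where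
  "vandermonde_quot q n x k =
     (\<Prod>r=1..n. \<Prod>s\<in>{r<..n}.
        (1 - q powi (int (k r) - int (k s)) * x r / x s) / (1 - x r / x s))"

end

theory Submission
  imports Defs "HOL-Complex_Analysis.Complex_Analysis" "HOL-Real_Asymp.Real_Asymp"
begin

text \<open>
  The kernels of the outer and the inner sum are inverse to each other as triangular matrices
  indexed by multi-indices. With \<open>y\<^sub>r = x\<^sub>r q\<^bsup>k\<^sub>r\<^esup>\<close> the inner kernel is a Vandermonde determinant
  divided by \<open>\<Prod>\<^sub>r W'(y\<^sub>r)\<close>, where \<open>W\<close> vanishes at all the nodes \<open>x\<^sub>s q\<^sup>i\<close>, \<open>i \<le> k\<^sub>s\<close>. In a sum over
  \<open>y\<^sub>r\<close> in the \<open>r\<close>-th chain of nodes of an antisymmetric function one of the variables may therefore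
  range over all the nodes, which produces an ordinary divided difference. It annihilates polynomials
  of small degree, which gives the inversion and with it the terminating case.

  For general \<open>a\<^sub>r\<close> the same divided difference, written as a Cauchy integral over a circle whose
  radius grows with the other variables, bounds the inner sum by \<open>C \<sigma>\<^bsup>|k|\<^esup>\<close> for every
  \<open>\<sigma> > max(|\<alpha>\<beta>|, |\<alpha>\<gamma>|)\<close>. So the outer series converges locally uniformly in the \<open>a\<^sub>r\<close>, and since the points
  \<open>q\<^sup>N\<close> accumulate at 0 the identity theorem extends the identity in one \<open>a\<^sub>r\<close> at a time.
\<close>

section \<open>q-shifted factorials\<close>

text \<open>The orthogonality of the kernels is accessible in one order only: with the inner kernel
  on the left the sum runs over nodes and is a divided difference. The expansion needs the opposite
  order, which follows from triangularity. It then holds for an arbitrary sequence of coefficients,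
  and the parameters b, c, d, \<beta>, \<gamma> enter through one choice of that sequence.

  The obstacle for general a_r is that the weights 1 / W' grow like negative powers of |q| with
  exponents quadratic in the multi-indices. The factor in |m| is a function of the product of all
  y_r; on a circle of radius R0 / |q|^M, with M the sum of the other m_r, its argument has a modulus
  that does not depend on M, and the large circle contributes a gain |q|^(M |k|). This gain
  outweighs the loss if the free variable is the one with the largest k_r, and a Gaussian factor is
  left over for the sum over m.

  The point a_r = 0, where the powers of q accumulate, has to be an interior point of holomorphy;
  this is why the powers of a_s are kept inside \<open>qpoch_hom\<close>.\<close>

lemma qpoch_0 [simp]: "qpoch q z 0 = 1"
  by (simp add: qpoch_def)

lemma qpoch_Suc: "qpoch q z (Suc k) = qpoch q z k * (1 - z * q ^ k)"
  by (simp add: qpoch_def)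

lemma qpoch_Suc': "qpoch q z (Suc k) = (1 - z) * qpoch q (z * q) k"
  unfolding qpoch_def by (subst prod.lessThan_Suc_shift) (simp add: mult_ac)

lemma qpoch_add: "qpoch q z (j + k) = qpoch q z j * qpoch q (z * q ^ j) k"
  by (induction k) (auto simp: qpoch_Suc power_add mult_ac)

lemma qpoch_nonzero_iff: "(\<forall>k. qpoch q z k \<noteq> 0) \<longleftrightarrow> (\<forall>i. z * q ^ i \<noteq> 1)"
  by (auto simp: qpoch_def)

text \<open>After \<rho>^k is pulled out, the factors 1 + t_i have summable t_i, and 1 + t \<le> exp
  t gives a constant independent of k. Keeping the exact base \<rho> matters, since the final
  geometric majorant is made of such bases.\<close>

lemma prod_geometric_le:
  fixes p :: real
  assumes "0 \<le> p" "p < 1" "0 < \<rho>" "0 \<le> c"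
  shows "(\<Prod>i<k. \<rho> + c * p ^ i) \<le> \<rho> ^ k * exp (c / (\<rho> * (1 - p)))"
proof -
  have sm: "summable (\<lambda>i. p ^ i)"
    using assms by (intro summable_geometric) auto
  have "(\<Prod>i<k. \<rho> + c * p ^ i) = (\<Prod>i<k. \<rho> * (1 + c / \<rho> * p ^ i))"
    using assms by (intro prod.cong) (auto simp: field_simps)
  also have "\<dots> = \<rho> ^ k * (\<Prod>i<k. 1 + c / \<rho> * p ^ i)"
    by (simp add: prod.distrib)
  also have "(\<Prod>i<k. 1 + c / \<rho> * p ^ i) \<le> exp (\<Sum>i<k. c / \<rho> * p ^ i)"
    using assms by (intro prod_le_exp_sum) auto
  also have "(\<Sum>i<k. c / \<rho> * p ^ i) = c / \<rho> * (\<Sum>i<k. p ^ i)"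
    by (simp add: sum_distrib_left)
  also have "(\<Sum>i<k. p ^ i) \<le> (\<Sum>i. p ^ i)"
    using assms by (intro sum_le_suminf sm) auto
  also have "(\<Sum>i. p ^ i) = 1 / (1 - p)"
    using assms by (intro suminf_geometric) auto
  finally show ?thesis
    using assms by (simp add: mult_left_mono divide_right_mono)
qed

lemma norm_prod_geometric_le:
  fixes w z q :: "complex"
  assumes "norm q < 1" "0 < \<rho>" "norm w \<le> \<rho>" "norm z \<le> c"
  shows "norm (\<Prod>i<k. w - z * q ^ i) \<le> \<rho> ^ k * exp (c / (\<rho> * (1 - norm q)))"
proof -
  have "0 \<le> c"
    using assms(4) norm_ge_zero order_trans by blast
  have "norm (w - z * q ^ i) \<le> \<rho> + c * norm q ^ i" for i
    using norm_triangle_ineq4[of w "z * q ^ i"] assms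
    by (simp add: norm_mult norm_power)
       (smt (verit, best) mult_right_mono norm_ge_zero zero_le_power)
  then have "norm (\<Prod>i<k. w - z * q ^ i) \<le> (\<Prod>i<k. \<rho> + c * norm q ^ i)"
    unfolding prod_norm[symmetric] by (intro prod_mono) auto
  also have "\<dots> \<le> \<rho> ^ k * exp (c / (\<rho> * (1 - norm q)))"
    using assms \<open>0 \<le> c\<close> by (intro prod_geometric_le) auto
  finally show ?thesis .
qed

lemma norm_qpoch_le:
  assumes "norm q < 1" "norm z \<le> c"
  shows "norm (qpoch q z k) \<le> exp (c / (1 - norm q))"
  using norm_prod_geometric_le[of q 1 1 z c k] assms by (simp add: qpoch_def)

lemma convergent_prod_qpoch:
  fixes q z :: complex
  assumes "norm q < 1"
  shows "convergent_prod (\<lambda>i. 1 - z * q ^ i)"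
proof -
  have "summable (\<lambda>i. norm ((1 - z * q ^ i) - 1))"
    using assms by (simp add: norm_mult norm_power summable_mult summable_geometric)
  then show ?thesis
    by (intro abs_convergent_prod_imp_convergent_prod summable_imp_abs_convergent_prod)
qed

lemma qpoch_LIMSEQ:
  assumes "norm q < 1"
  shows "(\<lambda>k. qpoch q z k) \<longlonglongrightarrow> qpoch_inf q z"
  unfolding qpoch_def qpoch_inf_def
  using convergent_prod_LIMSEQ[OF convergent_prod_qpoch[OF assms]] LIMSEQ_lessThan_iff_atMost by blast

lemma qpoch_inf_split:
  assumes "norm q < 1"
  shows "qpoch_inf q z = qpoch q z k * qpoch_inf q (z * q ^ k)"
proof (rule LIMSEQ_unique)
  show "(\<lambda>j. qpoch q z (k + j)) \<longlonglongrightarrow> qpoch_inf q z"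
    using LIMSEQ_ignore_initial_segment[OF qpoch_LIMSEQ[OF assms, of z], of k] by (simp add: add.commute)
  show "(\<lambda>j. qpoch q z (k + j)) \<longlonglongrightarrow> qpoch q z k * qpoch_inf q (z * q ^ k)"
    unfolding qpoch_add by (intro tendsto_intros qpoch_LIMSEQ assms)
qed

lemma qpoch_inf_eq_0_iff:
  assumes "norm q < 1"
  shows "qpoch_inf q z = 0 \<longleftrightarrow> (\<exists>i. z * q ^ i = 1)"
proof
  assume "\<exists>i. z * q ^ i = 1"
  then obtain i where "z * q ^ i = 1" ..
  then have "qpoch q z (Suc i) = 0"
    by (simp add: qpoch_Suc)
  then show "qpoch_inf q z = 0"
    using qpoch_inf_split[OF assms, of z "Suc i"] by simp
next
  assume 0: "qpoch_inf q z = 0"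
  show "\<exists>i. z * q ^ i = 1"
  proof (rule ccontr)
    assume "\<nexists>i. z * q ^ i = 1"
    then have "qpoch_inf q z \<noteq> 0"
      unfolding qpoch_inf_def
      by (intro prodinf_nonzero convergent_prod_qpoch assms) auto
    with 0 show False
      by simp
  qed
qed

lemma qpoch_inf_nonzero:
  assumes "norm q < 1" "norm z < 1"
  shows "qpoch_inf q z \<noteq> 0"
proof -
  have "norm (z * q ^ i) < 1" for i
  proof -
    have "norm z * norm q ^ i \<le> norm z * 1"
      using assms by (intro mult_left_mono power_le_one) auto
    then show ?thesis
      using assms by (simp add: norm_mult norm_power)
  qed
  then have "z * q ^ i \<noteq> 1" for i
    by (metis norm_one less_irrefl)
  then show ?thesis
    by (simp add: qpoch_inf_eq_0_iff[OF assms(1)])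
qed

lemma qpoch_nonzero: "norm q < 1 \<Longrightarrow> qpoch_inf q z \<noteq> 0 \<Longrightarrow> qpoch q z k \<noteq> 0"
  using qpoch_inf_split[of q z k] by auto

lemma qpoch_inf_nonzero_iff:
  assumes "norm q < 1"
  shows "qpoch_inf q z \<noteq> 0 \<longleftrightarrow> (\<forall>k. qpoch q z k \<noteq> 0)"
  using qpoch_inf_eq_0_iff[OF assms] qpoch_nonzero_iff by blast

text \<open>No factor vanishes, so the limit \<open>qpoch_inf q z\<close> is nonzero; the
  reciprocals converge and are therefore bounded.\<close>

lemma qpoch_bounded_below:
  assumes "norm q < 1" "\<And>k. qpoch q z k \<noteq> 0"
  obtains c where "c > 0" "\<And>k. norm (qpoch q z k) \<ge> c"
proof -
  have "qpoch_inf q z \<noteq> 0"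
    using assms qpoch_inf_nonzero_iff by blast
  then have "(\<lambda>k. inverse (qpoch q z k)) \<longlonglongrightarrow> inverse (qpoch_inf q z)"
    by (intro tendsto_inverse qpoch_LIMSEQ assms)
  then have "Bseq (\<lambda>k. inverse (qpoch q z k))"
    by (rule convergentI[THEN convergent_imp_Bseq])
  then obtain B where B: "B > 0" "\<And>k. norm (inverse (qpoch q z k)) \<le> B"
    by (auto elim: BseqE)
  show ?thesis
  proof (rule that[of "inverse B"])
    show "inverse B \<le> norm (qpoch q z k)" for k
      using B(2)[of k] assms(2)[of k] B(1)
      by (simp add: norm_inverse norm_divide field_simps)
  qed (use B in auto)
qed

text \<open>Factor by factor the worst case is the positive real one, 1 - \<theta> |q|^i. The
  q-factorial with base |q| and argument \<theta> is thus a lower bound for all z in the disc at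
  once.\<close>

lemma qpoch_bounded_below_uniform:
  assumes "norm q < 1" "0 \<le> \<theta>" "\<theta> < 1"
  obtains c where "c > 0" "\<And>z k. norm z \<le> \<theta> \<Longrightarrow> norm (qpoch q z k) \<ge> c"
proof -
  define p where "p = complex_of_real (norm q)"
  have "norm p < 1"
    using assms by (simp add: p_def)
  moreover have "qpoch p (of_real \<theta>) k \<noteq> 0" for k
    by (rule qpoch_nonzero[OF \<open>norm p < 1\<close> qpoch_inf_nonzero]) (use assms calculation in auto)
  ultimately obtain c where c: "c > 0" "\<And>k. norm (qpoch p (of_real \<theta>) k) \<ge> c"
    using qpoch_bounded_below by blast
  show ?thesis
  proof (rule that[OF c(1)])
    fix z :: complex and k
    assume z: "norm z \<le> \<theta>"
    have "norm (1 - of_real \<theta> * p ^ i) \<le> norm (1 - z * q ^ i)" for i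
    proof -
      have *: "norm z * norm q ^ i \<le> \<theta> * norm q ^ i" "\<theta> * norm q ^ i \<le> \<theta> * 1"
        using assms z by (intro mult_right_mono mult_left_mono power_le_one; simp)+
      have "1 - of_real \<theta> * p ^ i = of_real (1 - \<theta> * norm q ^ i)"
        by (simp add: p_def)
      then have "norm (1 - of_real \<theta> * p ^ i) = 1 - \<theta> * norm q ^ i"
        using * assms by (simp only: norm_of_real)
      also have "\<dots> \<le> norm (1 :: complex) - norm (z * q ^ i)"
        using * by (simp add: norm_mult norm_power)
      also have "\<dots> \<le> norm (1 - z * q ^ i)"
        by (rule norm_triangle_ineq2)
      finally show ?thesis .
    qed
    then have "norm (qpoch p (of_real \<theta>) k) \<le> norm (qpoch q z k)"
      unfolding qpoch_def prod_norm[symmetric] by (intro prod_mono) auto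
    with c(2)[of k] show "c \<le> norm (qpoch q z k)"
      by linarith
  qed
qed

lemma holomorphic_qpoch: "(\<lambda>z. qpoch q z k) holomorphic_on A"
  unfolding qpoch_def by (intro holomorphic_intros)

lemma holomorphic_qpoch_inf:
  assumes "norm q < 1"
  shows "qpoch_inf q holomorphic_on UNIV"
proof (rule holomorphic_uniform_sequence[where f = "\<lambda>k z. qpoch q z k"])
  show "\<And>k. (\<lambda>z. qpoch q z k) holomorphic_on UNIV"
    by (rule holomorphic_qpoch)
  fix z :: complex
  have "uniformly_convergent_on (cball z 1) (\<lambda>N w. \<Prod>i<N. 1 - w * q ^ i)"
  proof (rule uniformly_convergent_on_prod')
    show "uniformly_convergent_on (cball z 1) (\<lambda>N w. \<Sum>i<N. norm ((1 - w * q ^ i) - 1))"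
    proof (rule Weierstrass_m_test')
      fix i w
      assume "w \<in> cball z 1"
      then have "norm w \<le> norm z + 1"
        by (simp add: dist_norm) (metis add.commute diff_le_eq norm_minus_commute norm_triangle_ineq2 order_trans)
      then show "norm (norm ((1 - w * q ^ i) - 1)) \<le> (norm z + 1) * norm q ^ i"
        by (simp add: norm_mult norm_power mult_right_mono)
    next
      show "summable (\<lambda>i. (norm z + 1) * norm q ^ i)"
        using assms by (intro summable_mult summable_geometric) auto
    qed
  qed (auto intro!: continuous_intros)
  then obtain l where l: "uniform_limit (cball z 1) (\<lambda>N w. \<Prod>i<N. 1 - w * q ^ i) l sequentially"
    by (auto simp: uniformly_convergent_on_def)
  have "l w = qpoch_inf q w" if "w \<in> cball z 1" for w
    using tendsto_uniform_limitI[OF l that] qpoch_LIMSEQ[OF assms, of w]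
    unfolding qpoch_def by (rule LIMSEQ_unique)
  then have "uniform_limit (cball z 1) (\<lambda>N w. \<Prod>i<N. 1 - w * q ^ i) l sequentially \<longleftrightarrow>
      uniform_limit (cball z 1) (\<lambda>N w. \<Prod>i<N. 1 - w * q ^ i) (qpoch_inf q) sequentially"
    by (intro uniform_limit_cong') auto
  with l have "uniform_limit (cball z 1) (\<lambda>N w. \<Prod>i<N. 1 - w * q ^ i) (qpoch_inf q) sequentially"
    by simp
  then show "\<exists>d>0. cball z d \<subseteq> UNIV \<and> uniform_limit (cball z d) (\<lambda>k z. qpoch q z k) (qpoch_inf q) sequentially"
    unfolding qpoch_def by (intro exI[of _ 1]) auto
qed auto

lemma holomorphic_qpoch_inf_compose [holomorphic_intros]:
  assumes "norm q < 1" "f holomorphic_on A"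
  shows "(\<lambda>z. qpoch_inf q (f z)) holomorphic_on A"
  using holomorphic_on_compose_gen[OF assms(2) holomorphic_qpoch_inf[OF assms(1)]] by (simp add: o_def)

lemma holomorphic_qpoch_compose [holomorphic_intros]:
  assumes "f holomorphic_on A"
  shows "(\<lambda>z. qpoch q (f z) k) holomorphic_on A"
  using assms unfolding qpoch_def by (intro holomorphic_intros)

lemma norm_qpoch_inf_le:
  assumes "norm q < 1" "norm z \<le> c"
  shows "norm (qpoch_inf q z) \<le> exp (c / (1 - norm q))"
  by (rule LIMSEQ_le_const2[OF tendsto_norm[OF qpoch_LIMSEQ]]) (use norm_qpoch_le assms in auto)

lemma qpoch_inf_bounded_below_uniform:
  assumes "norm q < 1" "0 \<le> \<theta>" "\<theta> < 1"
  obtains c where "c > 0" "\<And>z. norm z \<le> \<theta> \<Longrightarrow> norm (qpoch_inf q z) \<ge> c"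
proof -
  obtain c where c: "c > 0" "\<And>z k. norm z \<le> \<theta> \<Longrightarrow> norm (qpoch q z k) \<ge> c"
    using qpoch_bounded_below_uniform[OF assms] by metis
  show ?thesis
    by (rule that[OF c(1)], rule LIMSEQ_le_const[OF tendsto_norm[OF qpoch_LIMSEQ]])
       (use c assms in auto)
qed

section \<open>Divided differences\<close>

text \<open>The classical divided difference of f at the points of S. Two readings are used: the
  coefficient of degree |S| - 1 of the interpolation polynomial, and the sum of the residues of f
  divided by the product of the w - z.\<close>

definition divdiff :: "complex set \<Rightarrow> (complex \<Rightarrow> complex) \<Rightarrow> complex" where
  "divdiff S f = (\<Sum>y\<in>S. f y / (\<Prod>z\<in>S - {y}. y - z))"

lemma lagrange_interpolation:
  fixes p :: "complex poly"
  assumes "finite S" "degree p < card S"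
  shows "p = (\<Sum>y\<in>S. smult (poly p y / (\<Prod>z\<in>S - {y}. y - z)) (\<Prod>z\<in>S - {y}. [:- z, 1:]))"
    (is "p = ?L")
proof (rule poly_eqI_degree)
  have deg: "degree (\<Prod>z\<in>S - {y}. [:- z, 1:]) = card S - 1" if "y \<in> S" for y :: complex
    by (subst degree_prod_eq_sum_degree) (use that assms in \<open>auto simp: card_Diff_singleton\<close>)
  have "degree ?L \<le> card S - 1"
    by (rule degree_sum_le) (use assms in \<open>auto simp: deg intro!: order_trans[OF degree_smult_le]\<close>)
  then show "degree ?L < card S"
    using assms by linarith
  show "poly p x = poly ?L x" if x: "x \<in> S" for x
  proof -
    have "poly ?L x = (\<Sum>y\<in>S. poly p y / (\<Prod>z\<in>S - {y}. y - z) * (\<Prod>z\<in>S - {y}. x - z))"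
      by (simp add: poly_sum poly_prod)
    also have "\<dots> = (\<Sum>y\<in>S. if y = x then poly p y else 0)"
    proof (rule sum.cong[OF refl])
      fix y
      assume y: "y \<in> S"
      show "poly p y / (\<Prod>z\<in>S - {y}. y - z) * (\<Prod>z\<in>S - {y}. x - z) = (if y = x then poly p y else 0)"
      proof (cases "y = x")
        case True
        have "(\<Prod>z\<in>S - {x}. x - z) \<noteq> 0"
          using assms by (subst prod_zero_iff) auto
        with True show ?thesis
          by simp
      next
        case False
        then have "(\<Prod>z\<in>S - {y}. x - z) = 0"
          using x assms by (subst prod_zero_iff) auto
        with False show ?thesis
          by simp
      qed
    qed
    also have "\<dots> = poly p x"
      using x assms by simp
    finally show ?thesis
      by simp
  qed
qed (use assms in auto)

text \<open>A polynomial of degree below |S| is its own interpolation polynomial; the divided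
  difference is its coefficient of degree |S| - 1, which is 0 as soon as the degree is smaller
  still.\<close>

lemma divdiff_poly_eq_0:
  assumes "finite S" "Suc (degree p) < card S"
  shows "divdiff S (poly p) = 0"
proof -
  have lead: "coeff (\<Prod>z\<in>S - {y}. [:- z, 1:]) (card S - 1) = 1" if "y \<in> S" for y :: complex
  proof -
    have "degree (\<Prod>z\<in>S - {y}. [:- z, 1:]) = card S - 1"
      by (subst degree_prod_eq_sum_degree) (use that assms in \<open>auto simp: card_Diff_singleton\<close>)
    then show ?thesis
      using lead_coeff_prod[of "\<lambda>z. [:- z, 1:]" "S - {y}"] by (simp del: One_nat_def)
  qed
  have "coeff p (card S - 1) =
      coeff (\<Sum>y\<in>S. smult (poly p y / (\<Prod>z\<in>S - {y}. y - z)) (\<Prod>z\<in>S - {y}. [:- z, 1:])) (card S - 1)"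
    by (rule arg_cong[where f = "\<lambda>p. coeff p (card S - 1)"], rule lagrange_interpolation)
       (use assms in auto)
  also have "\<dots> = divdiff S (poly p)"
    unfolding divdiff_def by (simp add: coeff_sum lead del: One_nat_def)
  finally show ?thesis
    using assms by (simp add: coeff_eq_0)
qed

text \<open>Lagrange interpolation of the constant 1, evaluated at w and divided by the product of
  all w - z.\<close>

lemma inverse_prod_partial_fractions:
  fixes S :: "complex set"
  assumes "finite S" "S \<noteq> {}" "w \<notin> S"
  shows "(\<Sum>y\<in>S. 1 / ((\<Prod>z\<in>S - {y}. y - z) * (w - y))) = 1 / (\<Prod>z\<in>S. w - z)"
proof -
  have nz: "(\<Prod>z\<in>S. w - z) \<noteq> 0"
    using assms by (subst prod_zero_iff) auto
  have split: "(\<Prod>z\<in>S. w - z) = (w - y) * (\<Prod>z\<in>S - {y}. w - z)" if "y \<in> S" for y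
    using assms that by (simp add: prod.remove)
  have "1 = poly 1 w"
    by simp
  also have "poly 1 w = poly (\<Sum>y\<in>S. smult (poly 1 y / (\<Prod>z\<in>S - {y}. y - z)) (\<Prod>z\<in>S - {y}. [:- z, 1:])) w"
    by (rule arg_cong[where f = "\<lambda>p. poly p w"], rule lagrange_interpolation)
       (use assms in \<open>auto simp: card_gt_0_iff\<close>)
  also have "\<dots> = (\<Sum>y\<in>S. (\<Prod>z\<in>S - {y}. w - z) / (\<Prod>z\<in>S - {y}. y - z))"
    by (simp add: poly_sum poly_prod)
  also have "\<dots> = (\<Sum>y\<in>S. (\<Prod>z\<in>S. w - z) * (1 / ((\<Prod>z\<in>S - {y}. y - z) * (w - y))))"
    by (intro sum.cong refl) (use assms in \<open>auto simp: split\<close>)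
  finally show ?thesis
    using nz unfolding sum_distrib_left[symmetric] by (simp add: nonzero_eq_divide_eq mult.commute)
qed

text \<open>Cauchy's formula for each f y, weighted as in the divided difference, merges by partial
  fractions into a single integral of f(w) over the product of the w - z. The cancellation among the
  terms is thereby built in; bounding them one by one would lose it.\<close>

lemma divdiff_bound:
  assumes S: "finite S" "S \<noteq> {}" "\<And>z. z \<in> S \<Longrightarrow> norm z < r"
    and f: "f holomorphic_on cball 0 r"
    and fB: "\<And>w. norm w = r \<Longrightarrow> norm (f w) \<le> B"
    and W: "\<And>w. norm w = r \<Longrightarrow> \<omega> \<le> norm (\<Prod>z\<in>S. w - z)" "\<omega> > 0"
    and r: "r > 0"
  shows "norm (divdiff S f) \<le> r * B / \<omega>"
proof -
  let ?d = "\<lambda>y. \<Prod>z\<in>S - {y}. y - z"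
  have "((\<lambda>w. \<Sum>y\<in>S. f w / (w - y) / ?d y) has_contour_integral
          (\<Sum>y\<in>S. 2 * of_real pi * \<i> * f y / ?d y)) (circlepath 0 r)"
  proof (intro has_contour_integral_sum has_contour_integral_div Cauchy_integral_circlepath S)
    show "continuous_on (cball 0 r) f"
      using f by (rule holomorphic_on_imp_continuous_on)
    show "f holomorphic_on ball 0 r"
      using f by (rule holomorphic_on_subset) auto
  qed (use S in auto)
  moreover have "(\<Sum>y\<in>S. 2 * of_real pi * \<i> * f y / ?d y) = 2 * of_real pi * \<i> * divdiff S f"
    by (simp add: divdiff_def sum_distrib_left)
  moreover have "(\<Sum>y\<in>S. f w / (w - y) / ?d y) = f w / (\<Prod>z\<in>S. w - z)" if "norm w = r" for w
  proof -
    have "w \<notin> S"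
      using S(3)[of w] that by auto
    have "(\<Sum>y\<in>S. f w / (w - y) / ?d y) = f w * (\<Sum>y\<in>S. 1 / (?d y * (w - y)))"
      by (simp add: sum_distrib_left mult.commute)
    then show ?thesis
      using inverse_prod_partial_fractions[OF S(1,2) \<open>w \<notin> S\<close>] by simp
  qed
  ultimately have ci: "((\<lambda>w. f w / (\<Prod>z\<in>S. w - z)) has_contour_integral
      2 * of_real pi * \<i> * divdiff S f) (circlepath 0 r)"
    using r by (auto elim!: has_contour_integral_eq)
  have B: "0 \<le> B"
    using fB[of "of_real r"] r by (auto intro: order_trans[OF norm_ge_zero])
  have "norm (2 * of_real pi * \<i> * divdiff S f) \<le> B / \<omega> * (2 * pi * r)"
  proof (rule has_contour_integral_bound_circlepath[OF ci])
    show "norm (f w / (\<Prod>z\<in>S. w - z)) \<le> B / \<omega>" if "norm (w - 0) = r" for w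
      using that fB W B by (auto simp: norm_divide intro!: frac_le)
  qed (use r B W in auto)
  then have "2 * pi * norm (divdiff S f) \<le> 2 * pi * (r * B / \<omega>)"
    by (simp add: norm_mult mult_ac)
  then show ?thesis
    by (subst (asm) mult_le_cancel_left_pos) auto
qed

section \<open>Antisymmetric sums over products of finite sets\<close>

lemma sum_PiE_remove:
  assumes "r \<in> I"
  shows "(\<Sum>y\<in>PiE I C. \<Phi> y) = (\<Sum>y\<in>PiE (I - {r}) C. \<Sum>w\<in>C r. \<Phi> (y(r := w)))"
proof -
  have "PiE I C = (\<lambda>(y, w). y(r := w)) ` (PiE (I - {r}) C \<times> C r)"
    using assms PiE_insert_eq[of r "I - {r}" C] by (force simp: insert_absorb)
  then have "(\<Sum>y\<in>PiE I C. \<Phi> y) = (\<Sum>y\<in>(\<lambda>(y, w). y(r := w)) ` (PiE (I - {r}) C \<times> C r). \<Phi> y)"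
    by simp
  also have "\<dots> = (\<Sum>(y, w)\<in>PiE (I - {r}) C \<times> C r. \<Phi> (y(r := w)))"
    using inj_combinator'[of r "I - {r}" C] by (subst sum.reindex) (auto simp: case_prod_unfold)
  also have "\<dots> = (\<Sum>y\<in>PiE (I - {r}) C. \<Sum>w\<in>C r. \<Phi> (y(r := w)))"
    by (rule sum.cartesian_product[symmetric])
  finally show ?thesis .
qed

(* Two coordinates ranging over the same set contribute nothing, so one coordinate may be
   allowed to range over the union of all the sets. *)
lemma sum_PiE_antisymmetric:
  fixes \<Phi> :: "('i \<Rightarrow> 'a) \<Rightarrow> complex"
  assumes I: "finite I" "r \<in> I" and C: "\<And>s. s \<in> I \<Longrightarrow> finite (C s)"
    and disj: "\<And>s t. s \<in> I \<Longrightarrow> t \<in> I \<Longrightarrow> s \<noteq> t \<Longrightarrow> C s \<inter> C t = {}"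
    and anti: "\<And>y s. s \<in> I \<Longrightarrow> s \<noteq> r \<Longrightarrow> y \<in> (\<Pi>\<^sub>E i\<in>I. \<Union>(C ` I)) \<Longrightarrow>
       \<Phi> (y \<circ> Transposition.transpose r s) = - \<Phi> y"
  shows "(\<Sum>y\<in>PiE I C. \<Phi> y) = (\<Sum>y\<in>PiE (I - {r}) C. \<Sum>w\<in>(\<Union>s\<in>I. C s). \<Phi> (y(r := w)))"
proof -
  \<comment> \<open>\<open>D s\<close> lets coordinate r run through the set that belongs to
    coordinate s. For s \<noteq> r two coordinates then share one set, and exchanging them maps the
    product to itself.\<close>
  define D where "D = (\<lambda>s. C(r := C s))"
  have rem: "(\<Sum>y\<in>PiE I (D s). \<Phi> y) = (\<Sum>y\<in>PiE (I - {r}) C. \<Sum>w\<in>C s. \<Phi> (y(r := w)))" for s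
  proof -
    have "PiE (I - {r}) (D s) = PiE (I - {r}) C"
      by (rule PiE_cong) (auto simp: D_def)
    then show ?thesis
      using sum_PiE_remove[OF I(2), of \<Phi> "D s"] by (simp add: D_def)
  qed
  have zero: "(\<Sum>y\<in>PiE I (D s). \<Phi> y) = 0" if s: "s \<in> I - {r}" for s
  proof -
    let ?\<tau> = "\<lambda>y. y \<circ> Transposition.transpose r s"
    have maps: "?\<tau> y \<in> PiE I (D s)" if y: "y \<in> PiE I (D s)" for y
    proof (rule PiE_I)
      fix t
      assume t: "t \<in> I"
      have *: "y i \<in> D s i" if "i \<in> I" for i
        using y that by auto
      have "Transposition.transpose r s t \<in> I"
        using t s I(2) by (auto simp: Transposition.transpose_def)
      from *[OF this] show "?\<tau> y t \<in> D s t"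
        using s by (auto simp: Transposition.transpose_def D_def split: if_splits)
    next
      fix t
      assume "t \<notin> I"
      then show "?\<tau> y t = undefined"
        using y s I(2) by (auto simp: Transposition.transpose_def)
    qed
    have sub: "PiE I (D s) \<subseteq> (\<Pi>\<^sub>E i\<in>I. \<Union>(C ` I))"
      using s I(2) by (intro PiE_mono) (auto simp: D_def)
    have inv: "?\<tau> (?\<tau> y) = y" for y :: "'i \<Rightarrow> 'a"
      by (auto simp: fun_eq_iff)
    have "(\<Sum>y\<in>PiE I (D s). \<Phi> y) = (\<Sum>y\<in>PiE I (D s). \<Phi> (?\<tau> y))"
      by (rule sum.reindex_bij_witness[of _ ?\<tau> ?\<tau>]) (use maps inv in auto)
    also have "\<dots> = - (\<Sum>y\<in>PiE I (D s). \<Phi> y)"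
      using anti s sub by (subst sum_negf[symmetric]) (intro sum.cong, auto)
    finally show ?thesis
      by simp
  qed
  have "(\<Sum>y\<in>PiE (I - {r}) C. \<Sum>w\<in>(\<Union>s\<in>I. C s). \<Phi> (y(r := w))) =
        (\<Sum>y\<in>PiE (I - {r}) C. \<Sum>s\<in>I. \<Sum>w\<in>C s. \<Phi> (y(r := w)))"
    by (intro sum.cong refl sum.UNION_disjoint) (use I C disj in auto)
  also have "\<dots> = (\<Sum>s\<in>I. \<Sum>y\<in>PiE I (D s). \<Phi> y)"
    unfolding rem by (rule sum.swap)
  also have "\<dots> = (\<Sum>y\<in>PiE I (D r). \<Phi> y)"
    using I zero by (simp add: sum.remove)
  finally show ?thesis
    by (simp add: D_def)
qed

section \<open>Sums over chains of nodes\<close>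

definition vdm :: "nat \<Rightarrow> (nat \<Rightarrow> complex) \<Rightarrow> complex" where
  "vdm n y = (\<Prod>r=1..n. \<Prod>s\<in>{r<..n}. y s - y r)"

text \<open>Over a full square of indices one or two indices can be split off by
  \<open>insert\<close>, which the triangular ranges do not allow directly.\<close>

lemma vdm_altdef: "vdm n y = (\<Prod>r\<in>{1..n}. \<Prod>s\<in>{1..n}. if r < s then y s - y r else 1)"
  unfolding vdm_def
proof (rule prod.cong[OF refl])
  fix r assume "r \<in> {1..n}"
  then have "{r<..n} = {s\<in>{1..n}. r < s}"
    by auto
  then show "(\<Prod>s\<in>{r<..n}. y s - y r) = (\<Prod>s\<in>{1..n}. if r < s then y s - y r else 1)"
    by (simp only:) (rule prod.inter_filter, simp)
qed

text \<open>With a < b, the factor of the pair (a, b) changes sign. For any other index c the two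
  factors joining c to a and to b are interchanged, each with a change of sign if c lies between a
  and b, so their product is unchanged.\<close>

lemma vdm_transpose:
  assumes "a \<in> {1..n}" "b \<in> {1..n}" "a \<noteq> b"
  shows "vdm n (y \<circ> Transposition.transpose a b) = - vdm n y"
  using assms
proof (induction a b rule: linorder_wlog)
  case (le a b)
  then have "a < b"
    by simp
  define J where "J = {1..n} - {a, b}"
  have I: "{1..n} = insert a (insert b J)" and J: "finite J" "a \<notin> J" "b \<notin> J"
    using le by (auto simp: J_def)
  have split: "vdm n z = (z b - z a) *
      (\<Prod>c\<in>J. (if a < c then z c - z a else 1) * (if b < c then z c - z b else 1) *
         ((if c < a then z a - z c else 1) * (if c < b then z b - z c else 1))) *
      (\<Prod>r\<in>J. \<Prod>s\<in>J. if r < s then z s - z r else 1)" for z :: "nat \<Rightarrow> complex"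
    unfolding vdm_altdef I using J \<open>a < b\<close> by (simp add: prod.distrib mult_ac)
  let ?y = "y \<circ> Transposition.transpose a b"
  have yab: "?y a = y b" "?y b = y a" "\<And>c. c \<in> J \<Longrightarrow> ?y c = y c"
    using J by (auto simp: Transposition.transpose_def)
  have 1: "(\<Prod>r\<in>J. \<Prod>s\<in>J. if r < s then ?y s - ?y r else 1) =
        (\<Prod>r\<in>J. \<Prod>s\<in>J. if r < s then y s - y r else 1)"
    by (intro prod.cong refl) (use yab in auto)
  have 2: "(\<Prod>c\<in>J. (if a < c then ?y c - ?y a else 1) * (if b < c then ?y c - ?y b else 1) *
         ((if c < a then ?y a - ?y c else 1) * (if c < b then ?y b - ?y c else 1))) =
        (\<Prod>c\<in>J. (if a < c then y c - y a else 1) * (if b < c then y c - y b else 1) *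
         ((if c < a then y a - y c else 1) * (if c < b then y b - y c else 1)))"
  proof (intro prod.cong refl)
    fix c assume c: "c \<in> J"
    then have "c \<noteq> a" "c \<noteq> b"
      using J by auto
    then show "(if a < c then ?y c - ?y a else 1) * (if b < c then ?y c - ?y b else 1) *
         ((if c < a then ?y a - ?y c else 1) * (if c < b then ?y b - ?y c else 1)) =
        (if a < c then y c - y a else 1) * (if b < c then y c - y b else 1) *
         ((if c < a then y a - y c else 1) * (if c < b then y b - y c else 1))"
      using \<open>a < b\<close> unfolding yab(1,2) yab(3)[OF c] by (auto simp: algebra_simps)
  qed
  show ?case
    unfolding split[of ?y] 1 2 unfolding yab(1,2) split[of y] by (simp add: algebra_simps)
next
  case (sym a b)
  then show ?case
    by (metis transpose_commute)
qed

text \<open>For fixed s the power q^(m s) occurs once for every r < s, that is s - 1 times.\<close>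

lemma prod_triangle_power:
  "(\<Prod>r=1..n. \<Prod>s\<in>{r<..n}. (q :: complex) ^ m s) = q ^ (\<Sum>r=1..n. (r - 1) * m r)"
proof -
  have "(\<Prod>r=1..n. \<Prod>s\<in>{r<..n}. q ^ m s) = (\<Prod>r=1..n. \<Prod>s\<in>{1..n}. if r < s then q ^ m s else 1)"
  proof (rule prod.cong[OF refl])
    fix r assume "r \<in> {1..n}"
    then have "{r<..n} = {s\<in>{1..n}. r < s}"
      by auto
    then show "(\<Prod>s\<in>{r<..n}. q ^ m s) = (\<Prod>s\<in>{1..n}. if r < s then q ^ m s else 1)"
      by (simp only:) (rule prod.inter_filter, simp)
  qed
  also have "\<dots> = (\<Prod>s=1..n. \<Prod>r\<in>{1..n}. if r < s then q ^ m s else 1)"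
    by (rule prod.swap)
  also have "\<dots> = (\<Prod>s=1..n. q ^ ((s - 1) * m s))"
  proof (rule prod.cong[OF refl])
    fix s assume s: "s \<in> {1..n}"
    have "(\<Prod>r\<in>{1..n}. if r < s then q ^ m s else 1) = (\<Prod>r\<in>{r\<in>{1..n}. r < s}. q ^ m s)"
      by (rule prod.inter_filter[symmetric]) simp
    also have "{r\<in>{1..n}. r < s} = {1..<s}"
      using s by auto
    finally show "(\<Prod>r\<in>{1..n}. if r < s then q ^ m s else 1) = q ^ ((s - 1) * m s)"
      by (simp add: power_mult[symmetric] mult.commute)
  qed
  finally show ?thesis
    by (simp add: power_sum)
qed

text \<open>Multiplication of w by q turns the factor of index i + 1 into q times the old factor of
  index i, so up to powers of q only the first and the last factor change. E holds the index of an
  omitted factor: in the application w = x_r q^m, and E is {m} on the chain of w and empty on the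
  others.\<close>

lemma prod_geometric_shift:
  fixes w x q :: complex
  assumes "E \<subseteq> {..<k}"
  shows "(\<Prod>i\<in>{..k} - Suc ` E. w * q - x * q ^ i) * (w - x * q ^ k) =
         (w * q - x) * q ^ (k - card E) * (\<Prod>i\<in>{..k} - E. w - x * q ^ i)"
proof -
  have fin: "finite E"
    using assms finite_subset by blast
  have 1: "{..k} - Suc ` E = insert 0 (Suc ` ({..<k} - E))"
  proof -
    have "i \<in> {..k} - Suc ` E \<longleftrightarrow> i \<in> insert 0 (Suc ` ({..<k} - E))" for i
      by (cases i) auto
    then show ?thesis
      by blast
  qed
  have 2: "{..k} - E = insert k ({..<k} - E)"
    using assms by auto
  have "(\<Prod>i\<in>{..k} - Suc ` E. w * q - x * q ^ i) = (w * q - x) * (\<Prod>i\<in>{..<k} - E. q * (w - x * q ^ i))"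
    unfolding 1 by (simp add: prod.reindex algebra_simps)
  also have "(\<Prod>i\<in>{..<k} - E. q * (w - x * q ^ i)) = q ^ (k - card E) * (\<Prod>i\<in>{..<k} - E. w - x * q ^ i)"
    using assms fin by (simp add: prod.distrib card_Diff_subset)
  finally show ?thesis
    unfolding 2 by (simp add: mult_ac)
qed

text \<open>The conditions on x make all points \<open>x r * q ^ i\<close> nonzero and pairwise
  distinct, so that divided differences with simple nodes apply. They express that the denominators
  in which only q and x occur do not vanish.\<close>

locale An_params =
  fixes q :: complex and n :: nat and x :: "nat \<Rightarrow> complex"
  assumes q_pos: "0 < norm q" and q_less: "norm q < 1"
    and x_nonzero: "\<And>r. r \<in> {1..n} \<Longrightarrow> x r \<noteq> 0"
    and x_distinct: "\<And>r s. r \<in> {1..n} \<Longrightarrow> s \<in> {1..n} \<Longrightarrow> r < s \<Longrightarrow> x r \<noteq> x s"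
    and x_generic: "\<And>r s k. r \<in> {1..n} \<Longrightarrow> s \<in> {1..n} \<Longrightarrow> qpoch q (q * x r / x s) k \<noteq> 0"
begin

lemma q_nonzero [simp]: "q \<noteq> 0"
  using q_pos by auto

lemma x_power_less:
  assumes "r \<in> {1..n}" "s \<in> {1..n}" "j < i"
  shows "x r * q ^ i \<noteq> x s * q ^ j"
proof
  assume eq: "x r * q ^ i = x s * q ^ j"
  \<comment> \<open>The equation says x_s = x_r q^(e + 1), and then the factor of index e in the
    q-factorial of q x_r / x_s vanishes.\<close>
  define e where "e = i - Suc j"
  have "i = j + Suc e"
    using assms by (simp add: e_def)
  then have "q ^ j * (x r * q * q ^ e) = q ^ j * x s"
    using eq by (simp add: power_add mult_ac)
  then have "x r * q * q ^ e = x s"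
    by simp
  then have "1 - q * x r / x s * q ^ e = 0"
    using x_nonzero[OF assms(2)] by (simp add: field_simps)
  then have "qpoch q (q * x r / x s) (Suc e) = 0"
    by (simp add: qpoch_Suc)
  then show False
    using x_generic assms by blast
qed

lemma x_power_inj:
  assumes "r \<in> {1..n}" "s \<in> {1..n}"
  shows "x r * q ^ i = x s * q ^ j \<longleftrightarrow> r = s \<and> i = j"
proof
  assume eq: "x r * q ^ i = x s * q ^ j"
  then have "i = j"
    using x_power_less[OF assms, of j i] x_power_less[of s r i j] assms
    by (metis linorder_neqE_nat)
  moreover from this have "x r = x s"
    using eq by simp
  then have "r = s"
    using x_distinct assms by (metis linorder_neqE_nat)
  ultimately show "r = s \<and> i = j"
    by simp
qed auto

lemma vdm_x_nonzero: "vdm n x \<noteq> 0"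
proof -
  have "x s - x r \<noteq> 0" if "r \<in> {1..n}" "s \<in> {r<..n}" for r s
    using x_distinct[of r s] that by auto
  then show ?thesis
    by (simp add: vdm_def)
qed

section \<open>Nodes and the weights of the inner kernel\<close>

definition chain :: "(nat \<Rightarrow> nat) \<Rightarrow> nat \<Rightarrow> complex set" where
  "chain k r = (\<lambda>i. x r * q ^ i) ` {0..k r}"

definition nodes :: "(nat \<Rightarrow> nat) \<Rightarrow> complex set" where
  "nodes k = (\<Union>r\<in>{1..n}. chain k r)"

text \<open>For y among the nodes this is the derivative at y of the monic polynomial W whose simple
  zeros are the nodes; elsewhere it is the value of W itself. So it never vanishes.\<close>

definition dW :: "(nat \<Rightarrow> nat) \<Rightarrow> complex \<Rightarrow> complex" where
  "dW k y = (\<Prod>z\<in>nodes k - {y}. y - z)"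

abbreviation wt :: "(nat \<Rightarrow> nat) \<Rightarrow> nat" where
  "wt k \<equiv> (\<Sum>i=1..n. k i)"

abbreviation multi :: "(nat \<Rightarrow> nat) set" where
  "multi \<equiv> PiE {1..n} (\<lambda>_. UNIV)"

text \<open>Only slot r0 is a free variable; the other slots sit at the nodes given by m, and the
  value of m at r0 is overwritten. The Vandermonde factor stays inside because it depends on
  w.\<close>

abbreviation slot_divdiff :: "(nat \<Rightarrow> nat) \<Rightarrow> nat \<Rightarrow> (nat \<Rightarrow> nat) \<Rightarrow> ((nat \<Rightarrow> complex) \<Rightarrow> complex) \<Rightarrow> complex" where
  "slot_divdiff k r0 m \<Phi> \<equiv> divdiff (nodes k)
     (\<lambda>w. vdm n ((\<lambda>r. x r * q ^ m r)(r0 := w)) * \<Phi> ((\<lambda>r. x r * q ^ m r)(r0 := w)))"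

lemma finite_chain [simp]: "finite (chain k r)"
  by (simp add: chain_def)

lemma finite_nodes [simp]: "finite (nodes k)"
  by (simp add: nodes_def)

lemma chain_disjoint: "r \<in> {1..n} \<Longrightarrow> s \<in> {1..n} \<Longrightarrow> r \<noteq> s \<Longrightarrow> chain k r \<inter> chain k s = {}"
  using x_power_inj by (auto simp: chain_def)

lemma inj_on_chain: "r \<in> {1..n} \<Longrightarrow> inj_on (\<lambda>i. x r * q ^ i) A"
  by (rule inj_onI) (use x_power_inj[of r r] in blast)

lemma prod_nodes: "(\<Prod>z\<in>nodes k. f z) = (\<Prod>s=1..n. \<Prod>i=0..k s. f (x s * q ^ i))"
proof -
  have "(\<Prod>z\<in>nodes k. f z) = (\<Prod>s=1..n. \<Prod>z\<in>chain k s. f z)"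
    unfolding nodes_def using chain_disjoint by (intro prod.UNION_disjoint) auto
  also have "\<dots> = (\<Prod>s=1..n. \<Prod>i=0..k s. f (x s * q ^ i))"
  proof (rule prod.cong[OF refl])
    fix s assume "s \<in> {1..n}"
    from inj_on_chain[OF this] show "(\<Prod>z\<in>chain k s. f z) = (\<Prod>i=0..k s. f (x s * q ^ i))"
      unfolding chain_def by (subst prod.reindex) auto
  qed
  finally show ?thesis .
qed

lemma card_nodes: "card (nodes k) = wt k + n"
proof -
  have "card (nodes k) = (\<Sum>s=1..n. card (chain k s))"
    unfolding nodes_def using chain_disjoint by (intro card_UN_disjoint) auto
  also have "\<dots> = (\<Sum>s=1..n. k s + 1)"
    by (intro sum.cong refl) (simp add: chain_def card_image inj_on_chain)
  also have "\<dots> = wt k + n"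
    by (subst sum.distrib) simp
  finally show ?thesis .
qed

lemma dW_nonzero: "dW k y \<noteq> 0"
  unfolding dW_def by (subst prod_zero_iff) auto

lemma dW_eq:
  assumes "r \<in> {1..n}" "m \<le> k r"
  shows "dW k (x r * q ^ m) =
    (\<Prod>s=1..n. \<Prod>i\<in>{..k s} - (if s = r then {m} else {}). x r * q ^ m - x s * q ^ i)"
proof -
  let ?E = "\<lambda>s. {..k s} - (if s = r then {m} else {})"
  have "nodes k - {x r * q ^ m} = (\<Union>s\<in>{1..n}. (\<lambda>i. x s * q ^ i) ` ?E s)"
  proof (intro equalityI subsetI)
    fix z assume "z \<in> nodes k - {x r * q ^ m}"
    then obtain s i where "s \<in> {1..n}" "i \<in> {0..k s}" "z = x s * q ^ i" "z \<noteq> x r * q ^ m"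
      by (auto simp: nodes_def chain_def)
    then show "z \<in> (\<Union>s\<in>{1..n}. (\<lambda>i. x s * q ^ i) ` ?E s)"
      by (intro UN_I[of s] image_eqI[of _ _ i]) auto
  next
    fix z assume "z \<in> (\<Union>s\<in>{1..n}. (\<lambda>i. x s * q ^ i) ` ?E s)"
    then obtain s i where s: "s \<in> {1..n}" "i \<in> ?E s" "z = x s * q ^ i"
      by blast
    then have "z \<in> nodes k"
      unfolding nodes_def chain_def by (intro UN_I[of s] image_eqI[of _ _ i]) auto
    moreover have "z \<noteq> x r * q ^ m"
      using s x_power_inj[OF s(1) assms(1), of i m] by auto
    ultimately show "z \<in> nodes k - {x r * q ^ m}"
      by blast
  qed
  then have "dW k (x r * q ^ m) = (\<Prod>z\<in>(\<Union>s\<in>{1..n}. (\<lambda>i. x s * q ^ i) ` ?E s). x r * q ^ m - z)"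
    unfolding dW_def by (rule arg_cong)
  also have "\<dots> = (\<Prod>s=1..n. \<Prod>z\<in>(\<lambda>i. x s * q ^ i) ` ?E s. x r * q ^ m - z)"
    using x_power_inj by (intro prod.UNION_disjoint) auto
  also have "\<dots> = (\<Prod>s=1..n. \<Prod>i\<in>?E s. x r * q ^ m - x s * q ^ i)"
  proof (rule prod.cong[OF refl])
    fix s assume s: "s \<in> {1..n}"
    show "(\<Prod>z\<in>(\<lambda>i. x s * q ^ i) ` ?E s. x r * q ^ m - z) = (\<Prod>i\<in>?E s. x r * q ^ m - x s * q ^ i)"
      using inj_on_chain[OF s] by (subst prod.reindex) auto
  qed
  finally show ?thesis .
qed

text \<open>Passing from m to m + 1 changes, up to powers of q, only the first and the last factor
  on each chain s, and this produces one new factor in each of the two q-factorials. The chain s = r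
  has one factor fewer because the point itself is left out; this is the origin of the isolated
  q^m.\<close>

lemma dW_ratio:
  assumes r: "r \<in> {1..n}" and m: "m \<le> k r"
  shows "dW k (x r) / dW k (x r * q ^ m) =
    q ^ m * (\<Prod>s=1..n. qpoch q (q powi (- int (k s)) * x r / x s) m / qpoch q (q * x r / x s) m)"
proof -
  define A where "A = (\<lambda>m s. \<Prod>i\<in>{..k s} - (if s = r then {m} else {}). x r * q ^ m - x s * q ^ i)"
  let ?d = "\<lambda>s. if s = r then 1 else 0 :: nat"
  have step: "A (Suc m) s * (x r * q ^ m - x s * q ^ k s) = (x r * q ^ m * q - x s) * q ^ (k s - ?d s) * A m s"
    if "m < k r" for m s
    using prod_geometric_shift[of "if s = r then {m} else {}" "k s" "x r * q ^ m" q "x s"] that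
    by (cases "s = r") (simp_all add: A_def mult_ac)
  have main: "A m s * qpoch q (q powi (- int (k s)) * x r / x s) m * q ^ (?d s * m) =
      A 0 s * qpoch q (q * x r / x s) m" if "m \<le> k r" "s \<in> {1..n}" for m s
    using that
  proof (induction m)
    case (Suc m)
    have nz: "x s \<noteq> 0" "q ^ k s \<noteq> 0"
      using x_nonzero Suc.prems by auto
    have pw: "q powi (- int (k s)) = 1 / q ^ k s"
      by (simp add: power_int_minus field_simps)
    define t where "t = x r * q ^ m - x s * q ^ k s"
    define u where "u = x r * q ^ m * q - x s"
    have tu: "A (Suc m) s * t = u * q ^ (k s - ?d s) * A m s"
      unfolding t_def u_def by (rule step) (use Suc.prems in auto)
    have f1: "1 - q powi (- int (k s)) * x r / x s * q ^ m = - t / (x s * q ^ k s)"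
      using nz unfolding pw t_def by (simp add: field_simps)
    have f2: "q ^ (k s - ?d s) * q ^ ?d s = q ^ k s"
      using Suc.prems by (auto simp flip: power_Suc2)
    have "A (Suc m) s * qpoch q (q powi (- int (k s)) * x r / x s) (Suc m) * q ^ (?d s * Suc m) =
      - (A (Suc m) s * t) * q ^ ?d s *
       (qpoch q (q powi (- int (k s)) * x r / x s) m * q ^ (?d s * m)) / (x s * q ^ k s)"
      unfolding qpoch_Suc f1 by (simp add: mult_ac power_add)
    also have "\<dots> = - u * (q ^ (k s - ?d s) * q ^ ?d s) *
       (A m s * qpoch q (q powi (- int (k s)) * x r / x s) m * q ^ (?d s * m)) / (x s * q ^ k s)"
      unfolding tu by (simp add: mult_ac)
    also have "\<dots> = - u * (A 0 s * qpoch q (q * x r / x s) m) / x s"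
      unfolding f2 using Suc nz by simp
    also have "\<dots> = A 0 s * qpoch q (q * x r / x s) (Suc m)"
      using nz by (simp add: u_def qpoch_Suc field_simps)
    finally show ?case .
  qed simp
  have dWA: "dW k (x r * q ^ m) = (\<Prod>s=1..n. A m s)" if "m \<le> k r" for m
    using dW_eq[of r m k] that r by (simp add: A_def)
  have A_nz: "(\<Prod>s=1..n. A m s) \<noteq> 0"
    using dWA[OF m] dW_nonzero by metis
  have "dW k (x r) / dW k (x r * q ^ m) = (\<Prod>s=1..n. A 0 s) / (\<Prod>s=1..n. A m s)"
    using dWA[of 0] dWA[of m] m by simp
  also have "\<dots> = (\<Prod>s=1..n. A 0 s / A m s)"
    by (simp add: prod_dividef)
  also have "\<dots> = (\<Prod>s=1..n. q ^ (?d s * m) *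
      (qpoch q (q powi (- int (k s)) * x r / x s) m / qpoch q (q * x r / x s) m))"
  proof (rule prod.cong[OF refl])
    fix s assume s: "s \<in> {1..n}"
    have "A m s \<noteq> 0"
      using A_nz s by (auto simp: prod_zero_iff)
    then show "A 0 s / A m s = q ^ (?d s * m) *
      (qpoch q (q powi (- int (k s)) * x r / x s) m / qpoch q (q * x r / x s) m)"
      using main[OF m s] x_generic[OF r s, of m] by (simp add: field_simps)
  qed
  also have "\<dots> = (\<Prod>s=1..n. q ^ (?d s * m)) *
      (\<Prod>s=1..n. qpoch q (q powi (- int (k s)) * x r / x s) m / qpoch q (q * x r / x s) m)"
    by (rule prod.distrib)
  also have "(\<Prod>s=1..n. q ^ (?d s * m)) = q ^ m"
  proof -
    have "(\<Prod>s=1..n. q ^ (?d s * m)) = (\<Prod>s\<in>{1..n}. if s = r then q ^ m else 1)"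
      by (intro prod.cong) auto
    then show ?thesis
      using r by simp
  qed
  finally show ?thesis .
qed

text \<open>Each pair r < s needs one power q^(m s) to clear the negative exponent in its numerator;
  collecting these powers gives the exponent with the weights r - 1.\<close>

lemma vandermonde_quot_eq:
  "vandermonde_quot q n x m * q ^ (\<Sum>r=1..n. (r - 1) * m r) =
   vdm n (\<lambda>r. x r * q ^ m r) / vdm n x"
proof -
  have "vandermonde_quot q n x m * q ^ (\<Sum>r=1..n. (r - 1) * m r) =
    (\<Prod>r=1..n. \<Prod>s\<in>{r<..n}. (1 - q powi (int (m r) - int (m s)) * x r / x s) / (1 - x r / x s) * q ^ m s)"
    unfolding vandermonde_quot_def prod_triangle_power[symmetric] by (simp only: prod.distrib)
  also have "\<dots> = (\<Prod>r=1..n. \<Prod>s\<in>{r<..n}. (x s * q ^ m s - x r * q ^ m r) / (x s - x r))"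
  proof (intro prod.cong refl)
    fix r s assume rs: "r \<in> {1..n}" "s \<in> {r<..n}"
    then have nz: "x s \<noteq> 0" "x r \<noteq> x s"
      using x_nonzero[of s] x_distinct[of r s] by auto
    have "q powi (int (m r) - int (m s)) = q ^ m r / q ^ m s"
      by (simp add: power_int_diff)
    then have num: "(1 - q powi (int (m r) - int (m s)) * x r / x s) * q ^ m s = (x s * q ^ m s - x r * q ^ m r) / x s"
      using nz by (simp add: field_simps)
    have den: "1 - x r / x s = (x s - x r) / x s"
      using nz by (simp add: field_simps)
    show "(1 - q powi (int (m r) - int (m s)) * x r / x s) / (1 - x r / x s) * q ^ m s =
        (x s * q ^ m s - x r * q ^ m r) / (x s - x r)"
      unfolding times_divide_eq_left num den using nz by simp
  qed
  finally show ?thesis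
    by (simp add: vdm_def prod_dividef)
qed

definition inner_weight :: "(nat \<Rightarrow> nat) \<Rightarrow> (nat \<Rightarrow> nat) \<Rightarrow> complex" where
  "inner_weight k m = vandermonde_quot q n x m
     * (\<Prod>r=1..n. \<Prod>s=1..n. qpoch q (q powi (- int (k s)) * x r / x s) (m r)
                             / qpoch q (q * x r / x s) (m r))
     * q ^ (\<Sum>r=1..n. r * m r)"

text \<open>The exponent r m_r is split into (r - 1) m_r, which turns the quotient into Vandermonde
  products, and m_r, which is consumed by \<open>dW_ratio\<close>. Up to factors free of m, the
  weight is then an antisymmetric function of the nodes times a product of one-variable
  weights.\<close>

lemma inner_weight_eq:
  assumes "\<And>r. r \<in> {1..n} \<Longrightarrow> m r \<le> k r"
  shows "inner_weight k m = vdm n (\<lambda>r. x r * q ^ m r) / vdm n x *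
           (\<Prod>r=1..n. dW k (x r) / dW k (x r * q ^ m r))"
proof -
  have e: "(\<Sum>r=1..n. r * m r) = (\<Sum>r=1..n. (r - 1) * m r) + wt m"
    unfolding sum.distrib[symmetric] by (intro sum.cong refl) (auto simp: algebra_simps)
  have "inner_weight k m = vandermonde_quot q n x m * q ^ (\<Sum>r=1..n. (r - 1) * m r) *
    (q ^ wt m * (\<Prod>r=1..n. \<Prod>s=1..n. qpoch q (q powi (- int (k s)) * x r / x s) (m r)
                             / qpoch q (q * x r / x s) (m r)))"
    unfolding inner_weight_def e by (simp add: power_add mult_ac)
  also have "q ^ wt m * (\<Prod>r=1..n. \<Prod>s=1..n. qpoch q (q powi (- int (k s)) * x r / x s) (m r)
                             / qpoch q (q * x r / x s) (m r)) =
     (\<Prod>r=1..n. q ^ m r * (\<Prod>s=1..n. qpoch q (q powi (- int (k s)) * x r / x s) (m r)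
                             / qpoch q (q * x r / x s) (m r)))"
    by (simp add: power_sum prod.distrib)
  also have "\<dots> = (\<Prod>r=1..n. dW k (x r) / dW k (x r * q ^ m r))"
    by (intro prod.cong refl) (use dW_ratio assms in auto)
  finally show ?thesis
    unfolding vandermonde_quot_eq .
qed

lemma bij_betw_PiE_chain:
  assumes "J \<subseteq> {1..n}"
  shows "bij_betw (\<lambda>m. \<lambda>r\<in>J. x r * q ^ m r) (\<Pi>\<^sub>E r\<in>J. {0..k r}) (PiE J (chain k))"
proof (rule bij_betw_imageI)
  show "inj_on (\<lambda>m. \<lambda>r\<in>J. x r * q ^ m r) (\<Pi>\<^sub>E r\<in>J. {0..k r})"
  proof (rule inj_onI)
    fix m m' assume m: "m \<in> (\<Pi>\<^sub>E r\<in>J. {0..k r})" "m' \<in> (\<Pi>\<^sub>E r\<in>J. {0..k r})"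
      and eq: "(\<lambda>r\<in>J. x r * q ^ m r) = (\<lambda>r\<in>J. x r * q ^ m' r)"
    show "m = m'"
    proof (rule PiE_ext[OF m])
      fix r assume "r \<in> J"
      then show "m r = m' r"
        using fun_cong[OF eq, of r] assms x_power_inj[of r r "m r" "m' r"] by auto
    qed
  qed
  show "(\<lambda>m. \<lambda>r\<in>J. x r * q ^ m r) ` (\<Pi>\<^sub>E r\<in>J. {0..k r}) = PiE J (chain k)"
  proof (intro equalityI subsetI)
    fix y assume y: "y \<in> PiE J (chain k)"
    then have "\<forall>r\<in>J. \<exists>i\<in>{0..k r}. y r = x r * q ^ i"
      by (auto simp: chain_def PiE_iff)
    then obtain m where m: "\<And>r. r \<in> J \<Longrightarrow> m r \<in> {0..k r} \<and> y r = x r * q ^ m r"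
      by metis
    have "y = (\<lambda>r\<in>J. x r * q ^ (restrict m J) r)"
      using y m by (auto simp: fun_eq_iff PiE_iff extensional_def)
    moreover have "restrict m J \<in> (\<Pi>\<^sub>E r\<in>J. {0..k r})"
      using m by auto
    ultimately show "y \<in> (\<lambda>m. \<lambda>r\<in>J. x r * q ^ m r) ` (\<Pi>\<^sub>E r\<in>J. {0..k r})"
      by blast
  qed (auto simp: chain_def PiE_iff intro!: imageI)
qed

text \<open>The Vandermonde product is antisymmetric, while \<Phi> and the product of the 1 /
  W'(y_r) are symmetric; so slot r0 may run over all nodes. The condition \<open>vcong\<close> is
  there because tuples in a \<open>PiE\<close> are undefined outside the index set, whereas
  \<open>\<lambda>r. x r * q ^ m r\<close> is not.\<close>

lemma inner_sum_eq:
  assumes r: "r0 \<in> {1..n}"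
    and symm: "\<And>y s. s \<in> {1..n} \<Longrightarrow> s \<noteq> r0 \<Longrightarrow> y \<in> (\<Pi>\<^sub>E r\<in>{1..n}. nodes k) \<Longrightarrow>
       \<Phi> (y \<circ> Transposition.transpose r0 s) = \<Phi> y"
    and vcong: "\<And>y y'. (\<And>r. r \<in> {1..n} \<Longrightarrow> y r = y' r) \<Longrightarrow> \<Phi> y = \<Phi> y'"
  shows "(\<Sum>m\<in>(\<Pi>\<^sub>E r\<in>{1..n}. {0..k r}). inner_weight k m * \<Phi> (\<lambda>r. x r * q ^ m r)) =
    dW k (x r0) / vdm n x *
    (\<Sum>m\<in>(\<Pi>\<^sub>E r\<in>{1..n} - {r0}. {0..k r}).
       (\<Prod>r\<in>{1..n} - {r0}. dW k (x r) / dW k (x r * q ^ m r)) *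
       slot_divdiff k r0 m \<Phi>)"
proof -
  let ?I = "{1..n}"
  have vdm_cong: "vdm n y = vdm n y'" if "\<And>r. r \<in> {1..n} \<Longrightarrow> y r = y' r" for y y'
    unfolding vdm_def by (intro prod.cong refl) (use that in auto)
  define \<Psi> where "\<Psi> = (\<lambda>y. vdm n y * (\<Prod>r\<in>?I. 1 / dW k (y r)) * \<Phi> y)"
  have \<Psi>_cong: "\<Psi> y = \<Psi> y'" if "\<And>r. r \<in> {1..n} \<Longrightarrow> y r = y' r" for y y'
    unfolding \<Psi>_def using that vdm_cong[of y y'] vcong[of y y'] by simp
  have "(\<Sum>m\<in>(\<Pi>\<^sub>E r\<in>?I. {0..k r}). inner_weight k m * \<Phi> (\<lambda>r. x r * q ^ m r)) =
        (\<Sum>m\<in>(\<Pi>\<^sub>E r\<in>?I. {0..k r}). (\<Prod>r\<in>?I. dW k (x r)) / vdm n x * \<Psi> (\<lambda>r\<in>?I. x r * q ^ m r))"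
  proof (rule sum.cong[OF refl])
    fix m assume m: "m \<in> (\<Pi>\<^sub>E r\<in>?I. {0..k r})"
    have 1: "\<Psi> (\<lambda>r\<in>?I. x r * q ^ m r) = \<Psi> (\<lambda>r. x r * q ^ m r)"
      by (rule \<Psi>_cong) auto
    have 2: "inner_weight k m = vdm n (\<lambda>r. x r * q ^ m r) / vdm n x *
           (\<Prod>r=1..n. dW k (x r) / dW k (x r * q ^ m r))"
      by (rule inner_weight_eq) (use m in \<open>auto simp: PiE_iff\<close>)
    show "inner_weight k m * \<Phi> (\<lambda>r. x r * q ^ m r) =
        (\<Prod>r\<in>?I. dW k (x r)) / vdm n x * \<Psi> (\<lambda>r\<in>?I. x r * q ^ m r)"
      unfolding 1 2 unfolding \<Psi>_def by (simp add: prod_dividef)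
  qed
  also have "\<dots> = (\<Prod>r\<in>?I. dW k (x r)) / vdm n x * (\<Sum>y\<in>PiE ?I (chain k). \<Psi> y)"
    unfolding sum_distrib_left[symmetric]
    by (rule arg_cong[where f = "\<lambda>s. _ * s"], rule sum.reindex_bij_betw, rule bij_betw_PiE_chain) auto
  also have "(\<Sum>y\<in>PiE ?I (chain k). \<Psi> y) =
     (\<Sum>y\<in>PiE (?I - {r0}) (chain k). \<Sum>w\<in>nodes k. \<Psi> (y(r0 := w)))"
    unfolding nodes_def
  proof (rule sum_PiE_antisymmetric)
    fix y s assume s: "s \<in> ?I" "s \<noteq> r0" and y: "y \<in> (\<Pi>\<^sub>E i\<in>?I. \<Union>(chain k ` ?I))"
    have "bij_betw (Transposition.transpose r0 s) ?I ?I"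
      using r s by simp
    then have "(\<Prod>i\<in>?I. 1 / dW k (y (Transposition.transpose r0 s i))) = (\<Prod>i\<in>?I. 1 / dW k (y i))"
      by (rule prod.reindex_bij_betw)
    then show "\<Psi> (y \<circ> Transposition.transpose r0 s) = - \<Psi> y"
      using symm[OF s] y vdm_transpose[OF r s(1)] s(2) by (simp add: \<Psi>_def nodes_def)
  qed (use r chain_disjoint in auto)
  also have "\<dots> = (\<Sum>m\<in>(\<Pi>\<^sub>E r\<in>?I - {r0}. {0..k r}). \<Sum>w\<in>nodes k. \<Psi> ((\<lambda>r\<in>?I - {r0}. x r * q ^ m r)(r0 := w)))"
    by (rule sum.reindex_bij_betw[symmetric], rule bij_betw_PiE_chain) auto
  also have "\<dots> = (\<Sum>m\<in>(\<Pi>\<^sub>E r\<in>?I - {r0}. {0..k r}). (\<Prod>r\<in>?I - {r0}. 1 / dW k (x r * q ^ m r)) *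
     slot_divdiff k r0 m \<Phi>)"
    unfolding divdiff_def sum_distrib_left
  proof (intro sum.cong refl)
    fix m w assume "w \<in> nodes k"
    have "\<Psi> ((\<lambda>r\<in>?I - {r0}. x r * q ^ m r)(r0 := w)) = \<Psi> ((\<lambda>r. x r * q ^ m r)(r0 := w))"
      by (rule \<Psi>_cong) auto
    moreover have "(\<Prod>r\<in>?I. 1 / dW k (((\<lambda>r. x r * q ^ m r)(r0 := w)) r)) =
       1 / dW k w * (\<Prod>r\<in>?I - {r0}. 1 / dW k (x r * q ^ m r))"
      using r by (subst prod.remove[of _ r0]) auto
    ultimately show "\<Psi> ((\<lambda>r\<in>?I - {r0}. x r * q ^ m r)(r0 := w)) =
      (\<Prod>r\<in>?I - {r0}. 1 / dW k (x r * q ^ m r)) *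
      (vdm n ((\<lambda>r. x r * q ^ m r)(r0 := w)) * \<Phi> ((\<lambda>r. x r * q ^ m r)(r0 := w)) / (\<Prod>z\<in>nodes k - {w}. w - z))"
      by (simp add: \<Psi>_def dW_def mult_ac)
  qed
  finally show ?thesis
    using r by (simp add: sum_distrib_left prod.remove[of _ r0] prod_dividef mult_ac)
qed

end

section \<open>Inversion of the kernels\<close>

text \<open>From H G = 1 one gets H (G H - 1) = 0, and a triangular H with nonzero diagonal
  annihilates only 0, by induction along w. \<open>B j\<close> is the finite set of indices below j,
  so all sums are finite even if T is infinite.\<close>

lemma right_inverse_triangular:
  fixes H G :: "'a \<Rightarrow> 'a \<Rightarrow> complex" and B :: "'a \<Rightarrow> 'a set" and w :: "'a \<Rightarrow> nat"
  assumes fin: "\<And>j. j \<in> T \<Longrightarrow> finite (B j)" and sub: "\<And>j. j \<in> T \<Longrightarrow> B j \<subseteq> T"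
    and refl: "\<And>j. j \<in> T \<Longrightarrow> j \<in> B j"
    and trans: "\<And>j k. j \<in> T \<Longrightarrow> k \<in> B j \<Longrightarrow> B k \<subseteq> B j"
    and less: "\<And>j k. j \<in> T \<Longrightarrow> k \<in> B j \<Longrightarrow> k \<noteq> j \<Longrightarrow> w k < w j"
    and H0: "\<And>j m. j \<in> T \<Longrightarrow> m \<in> T \<Longrightarrow> m \<notin> B j \<Longrightarrow> H j m = 0"
    and G0: "\<And>j m. j \<in> T \<Longrightarrow> m \<in> T \<Longrightarrow> m \<notin> B j \<Longrightarrow> G j m = 0"
    and HG: "\<And>j m. j \<in> T \<Longrightarrow> m \<in> T \<Longrightarrow> (\<Sum>k\<in>B j. H j k * G k m) = (if j = m then 1 else 0)"
    and j: "j \<in> T" and m: "m \<in> T"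
  shows "(\<Sum>k\<in>B j. G j k * H k m) = (if j = m then 1 else 0)"
proof -
  define P where "P = (\<lambda>k. (\<Sum>l\<in>B k. G k l * H l m) - (if k = m then 1 else 0))"
  have HP: "(\<Sum>k\<in>B j. H j k * P k) = 0" if j: "j \<in> T" for j
  proof -
    have "(\<Sum>l\<in>B k. G k l * H l m) = (\<Sum>l\<in>B j. G k l * H l m)" if "k \<in> B j" for k
      by (rule sum.mono_neutral_left)
         (use that j fin trans G0 sub in \<open>auto, (meson in_mono)+\<close>)
    then have "(\<Sum>k\<in>B j. H j k * P k) =
        (\<Sum>k\<in>B j. \<Sum>l\<in>B j. H j k * G k l * H l m) - (\<Sum>k\<in>B j. if k = m then H j k else 0)"
      unfolding sum_subtractf[symmetric]
      by (intro sum.cong refl) (auto simp: P_def right_diff_distrib sum_distrib_left mult.assoc)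
    also have "(\<Sum>k\<in>B j. \<Sum>l\<in>B j. H j k * G k l * H l m) = (\<Sum>l\<in>B j. (\<Sum>k\<in>B j. H j k * G k l) * H l m)"
      by (subst sum.swap) (simp add: sum_distrib_right)
    also have "\<dots> = (\<Sum>l\<in>B j. if j = l then H l m else 0)"
      using j sub by (intro sum.cong refl) (auto simp: HG subset_iff)
    also have "\<dots> = H j m"
      using j refl fin by simp
    also have "(\<Sum>k\<in>B j. if k = m then H j k else 0) = H j m"
      using j m fin H0 by simp
    finally show ?thesis
      by simp
  qed
  have "P j = 0"
    using j
  proof (induction "w j" arbitrary: j rule: less_induct)
    case less
    have "H j j * P j = (\<Sum>k\<in>{j}. H j k * P k)"
      by simp
    also have "\<dots> = (\<Sum>k\<in>B j. H j k * P k)"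
      by (rule sum.mono_neutral_left)
         (use less.prems less.hyps refl sub fin assms(5) in \<open>auto simp: subset_iff\<close>)
    also have "\<dots> = 0"
      by (rule HP[OF less.prems])
    finally have "H j j * P j = 0" .
    \<comment> \<open>In the diagonal entry (j, j) of H G only k = j can contribute: any other k
      below j would need j below k as well.\<close>
    moreover have "H j j \<noteq> 0"
    proof
      assume 0: "H j j = 0"
      have "(\<Sum>k\<in>B j. H j k * G k j) = 0"
      proof (rule sum.neutral, rule ballI)
        fix k assume k: "k \<in> B j"
        show "H j k * G k j = 0"
        proof (cases "k = j")
          case False
          have "j \<notin> B k"
            using assms(5)[OF less.prems k False] assms(5)[of k j] sub less.prems k False
            by (metis in_mono less_asym)
          then show ?thesis
            using G0 less.prems k sub by (metis in_mono mult_zero_right)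
        qed (use 0 in simp)
      qed
      then show False
        using HG[OF less.prems less.prems] by simp
    qed
    ultimately show ?case
      by simp
  qed
  then show ?thesis
    by (simp add: P_def)
qed

text \<open>Separates the n - 1 linear factors containing w from the Vandermonde product of the
  other variables; both the degree in w and the size on a circle are read off from this
  form.\<close>

lemma vdm_fun_upd:
  assumes "r0 \<in> {1..n}"
  shows "vdm n (y(r0 := w)) =
    (\<Prod>c\<in>{1..n} - {r0}. if r0 < c then y c - w else w - y c) *
    (\<Prod>r\<in>{1..n} - {r0}. \<Prod>s\<in>{1..n} - {r0}. if r < s then y s - y r else 1)"
proof -
  define J where "J = {1..n} - {r0}"
  have I: "{1..n} = insert r0 J" and J: "finite J" "r0 \<notin> J"
    using assms by (auto simp: J_def)
  let ?z = "y(r0 := w)"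
  have "vdm n ?z = (\<Prod>c\<in>J. (if r0 < c then ?z c - ?z r0 else 1) * (if c < r0 then ?z r0 - ?z c else 1)) *
      (\<Prod>r\<in>J. \<Prod>s\<in>J. if r < s then ?z s - ?z r else 1)"
    unfolding vdm_altdef I using J by (simp add: prod.distrib mult_ac)
  also have "(\<Prod>c\<in>J. (if r0 < c then ?z c - ?z r0 else 1) * (if c < r0 then ?z r0 - ?z c else 1)) =
      (\<Prod>c\<in>J. if r0 < c then y c - w else w - y c)"
  proof (rule prod.cong[OF refl])
    fix c assume "c \<in> J"
    then have "c \<noteq> r0"
      using J by auto
    then show "(if r0 < c then ?z c - ?z r0 else 1) * (if c < r0 then ?z r0 - ?z c else 1) =
        (if r0 < c then y c - w else w - y c)"
      by auto
  qed
  also have "(\<Prod>r\<in>J. \<Prod>s\<in>J. if r < s then ?z s - ?z r else 1) =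
      (\<Prod>r\<in>J. \<Prod>s\<in>J. if r < s then y s - y r else 1)"
    using J by (intro prod.cong refl) auto
  finally show ?thesis
    unfolding J_def .
qed

lemma vdm_fun_upd_poly:
  assumes "r0 \<in> {1..n}"
  obtains p where "degree p \<le> n - 1" "\<And>w. vdm n (y(r0 := w)) = poly p w"
proof -
  define p where "p = smult (\<Prod>r\<in>{1..n} - {r0}. \<Prod>s\<in>{1..n} - {r0}. if r < s then y s - y r else 1)
    (\<Prod>c\<in>{1..n} - {r0}. if r0 < c then [:y c, -1:] else [:- y c, 1:])"
  have "degree p \<le> degree (\<Prod>c\<in>{1..n} - {r0}. if r0 < c then [:y c, -1:] else [:- y c, 1:])"
    unfolding p_def by (rule degree_smult_le)
  also have "\<dots> \<le> (\<Sum>c\<in>{1..n} - {r0}. degree (if r0 < c then [:y c, -1:] else [:- y c, 1:]))"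
    using degree_prod_sum_le[of "{1..n} - {r0}" "\<lambda>c. if r0 < c then [:y c, -1:] else [:- y c, 1:]"]
    by (simp add: o_def)
  also have "\<dots> = (\<Sum>c\<in>{1..n} - {r0}. 1)"
    by (intro sum.cong) auto
  also have "\<dots> = n - 1"
    using assms by simp
  finally have "degree p \<le> n - 1" .
  moreover have "vdm n (y(r0 := w)) = poly p w" for w
    unfolding vdm_fun_upd[OF assms] p_def
    by (simp add: poly_prod mult.commute) (intro disjI2 prod.cong, auto)
  ultimately show ?thesis
    using that by blast
qed

lemma power_int_minus_of_nat: "(q :: complex) powi (- int k) = 1 / q ^ k"
  by (simp add: power_int_minus field_simps)

lemma power_int_diff_of_nat: "(q :: complex) \<noteq> 0 \<Longrightarrow> q powi (int a - int b) = q ^ a / q ^ b"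
  by (simp add: power_int_diff)

text \<open>With z = x_r / x_s, a = m_r and b = m_s these are the factors of the pairs (r, s) and
  (s, r) on the diagonal k = m. Together with the Vandermonde numerator 1 - q^(a - b) z they turn
  into the denominators of the same two pairs and the Vandermonde denominator, up to a power of
  q.\<close>

lemma qpoch_reflect_pair:
  fixes q z :: complex
  assumes "q \<noteq> 0" "z \<noteq> 0"
  shows "qpoch q (q powi (- int b) * z) a * qpoch q (q powi (- int a) / z) b *
      (1 - q powi (int a - int b) * z) * q ^ (a * b + b) =
    qpoch q (q / z) b * qpoch q (q * z) a * (1 - z)"
proof (induction b)
  case 0
  have "qpoch q z a * (1 - q ^ a * z) = qpoch q z (Suc a)"
    by (simp add: qpoch_Suc mult.commute)
  also have "\<dots> = qpoch q (q * z) a * (1 - z)"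
    by (simp add: qpoch_Suc' mult.commute)
  finally show ?case
    by simp
next
  case (Suc b)
  let ?zb = "q powi (- int b) * z" and ?zb1 = "q powi (- int (Suc b)) * z"
  have zb: "?zb1 * q = ?zb"
    using assms unfolding power_int_minus_of_nat power_int_diff_of_nat[OF assms(1)] by (simp add: field_simps)
  have e: "?zb1 * q ^ a = q powi (int a - int (Suc b)) * z"
    using assms unfolding power_int_minus_of_nat power_int_diff_of_nat[OF assms(1)] by (simp add: field_simps)
  have "qpoch q ?zb1 a * (1 - q powi (int a - int (Suc b)) * z) = qpoch q ?zb1 (Suc a)"
    by (simp only: qpoch_Suc e)
  also have "\<dots> = (1 - ?zb1) * qpoch q ?zb a"
    by (simp only: qpoch_Suc' zb)
  finally have 1: "qpoch q ?zb1 a * (1 - q powi (int a - int (Suc b)) * z) = (1 - ?zb1) * qpoch q ?zb a" .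
  have 2: "(1 - ?zb1) * (1 - q powi (- int a) / z * q ^ b) * q ^ (a + 1) =
     (1 - q / z * q ^ b) * (1 - q powi (int a - int b) * z)"
    using assms unfolding power_int_minus_of_nat power_int_diff_of_nat[OF assms(1)] by (simp add: field_simps)
  have "qpoch q ?zb1 a * qpoch q (q powi (- int a) / z) (Suc b) *
      (1 - q powi (int a - int (Suc b)) * z) * q ^ (a * Suc b + Suc b) =
     (qpoch q ?zb1 a * (1 - q powi (int a - int (Suc b)) * z)) *
     (qpoch q (q powi (- int a) / z) b * (1 - q powi (- int a) / z * q ^ b)) * (q ^ (a * b + b) * q ^ (a + 1))"
    by (simp add: qpoch_Suc power_add mult_ac)
  also have "\<dots> = qpoch q ?zb a * qpoch q (q powi (- int a) / z) b * q ^ (a * b + b) *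
      ((1 - ?zb1) * (1 - q powi (- int a) / z * q ^ b) * q ^ (a + 1))"
    unfolding 1 by (simp only: mult_ac)
  also have "\<dots> = (qpoch q ?zb a * qpoch q (q powi (- int a) / z) b *
      (1 - q powi (int a - int b) * z) * q ^ (a * b + b)) * (1 - q / z * q ^ b)"
    unfolding 2 by (simp only: mult_ac)
  also have "\<dots> = qpoch q (q / z) (Suc b) * qpoch q (q * z) a * (1 - z)"
    unfolding Suc.IH by (simp add: qpoch_Suc mult_ac)
  finally show ?case .
qed

text \<open>Squaring removes the sign (-1)^a and the halved exponent a (a + 1) / 2 of the reflection
  formula. The square suffices, because the inner weight enters the diagonal product of the kernels
  twice.\<close>

lemma qpoch_reflect_diag:
  fixes q :: complex
  assumes "q \<noteq> 0"
  shows "(qpoch q (q powi (- int a)) a)\<^sup>2 * q ^ (a * a) * q ^ a = (qpoch q q a)\<^sup>2"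
proof (induction a)
  case (Suc a)
  let ?p = "1 - q powi (- int (Suc a))"
  have 1: "qpoch q (q powi (- int (Suc a))) (Suc a) = ?p * qpoch q (q powi (- int a)) a"
  proof -
    have "q powi (- int (Suc a)) * q = q powi (- int a)"
      using assms unfolding power_int_minus_of_nat by (simp add: field_simps)
    then show ?thesis
      by (simp only: qpoch_Suc')
  qed
  have "?p * q ^ Suc a = - (1 - q ^ Suc a)"
    using assms unfolding power_int_minus_of_nat by (simp add: field_simps)
  then have 2: "?p\<^sup>2 * (q ^ Suc a)\<^sup>2 = (1 - q ^ Suc a)\<^sup>2"
    by (metis power_mult_distrib power2_minus)
  have 3: "q ^ (Suc a * Suc a) * q ^ Suc a = (q ^ Suc a)\<^sup>2 * (q ^ (a * a) * q ^ a)"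
    unfolding power_mult[symmetric] power_add[symmetric]
    by (rule arg_cong[where f = "\<lambda>e. q ^ e"]) simp
  have "(qpoch q (q powi (- int (Suc a))) (Suc a))\<^sup>2 * q ^ (Suc a * Suc a) * q ^ Suc a =
      ?p\<^sup>2 * (q ^ Suc a)\<^sup>2 * ((qpoch q (q powi (- int a)) a)\<^sup>2 * q ^ (a * a) * q ^ a)"
    unfolding 1 mult.assoc[of _ "q ^ (Suc a * Suc a)"] 3 power_mult_distrib by (simp only: mult_ac)
  also have "\<dots> = (qpoch q q (Suc a))\<^sup>2"
    unfolding 2 Suc.IH by (simp add: qpoch_Suc power_mult_distrib)
  finally show ?case .
qed simp

lemma prod_pairs:
  fixes f :: "nat \<Rightarrow> nat \<Rightarrow> complex"
  shows "(\<Prod>r=1..n. \<Prod>s=1..n. f r s) = (\<Prod>r=1..n. f r r) * (\<Prod>r=1..n. \<Prod>s\<in>{r<..n}. f r s * f s r)"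
proof (induction n)
  case (Suc n)
  have I: "{1..Suc n} = insert (Suc n) {1..n}"
    by auto
  have "(\<Prod>r=1..Suc n. \<Prod>s=1..Suc n. f r s) =
     f (Suc n) (Suc n) * (\<Prod>s=1..n. f (Suc n) s) * (\<Prod>r=1..n. f r (Suc n) * (\<Prod>s=1..n. f r s))"
    unfolding I by simp
  also have "\<dots> = f (Suc n) (Suc n) * (\<Prod>r=1..n. f r (Suc n) * f (Suc n) r) * (\<Prod>r=1..n. \<Prod>s=1..n. f r s)"
    by (simp add: prod.distrib mult_ac)
  also have "\<dots> = (\<Prod>r=1..Suc n. f r r) * ((\<Prod>r=1..n. f r (Suc n) * f (Suc n) r) *
       (\<Prod>r=1..n. \<Prod>s\<in>{r<..n}. f r s * f s r))"
    unfolding Suc.IH I by (simp add: mult_ac)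
  also have "(\<Prod>r=1..n. f r (Suc n) * f (Suc n) r) * (\<Prod>r=1..n. \<Prod>s\<in>{r<..n}. f r s * f s r) =
     (\<Prod>r=1..n. \<Prod>s\<in>{r<..Suc n}. f r s * f s r)"
    unfolding prod.distrib[symmetric]
  proof (rule prod.cong[OF refl])
    fix r assume "r \<in> {1..n}"
    then have "{r<..Suc n} = insert (Suc n) {r<..n}"
      by auto
    then show "f r (Suc n) * f (Suc n) r * (\<Prod>s\<in>{r<..n}. f r s * f s r) = (\<Prod>s\<in>{r<..Suc n}. f r s * f s r)"
      by simp
  qed
  also have "\<dots> = (\<Prod>r=1..Suc n. \<Prod>s\<in>{r<..Suc n}. f r s * f s r)"
    unfolding I by simp
  finally show ?case .
qed simp

section \<open>The two kernels and their orthogonality\<close>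

context An_params
begin

abbreviation box :: "(nat \<Rightarrow> nat) \<Rightarrow> (nat \<Rightarrow> nat) set" where
  "box k \<equiv> (\<Pi>\<^sub>E r\<in>{1..n}. {0..k r})"

text \<open>Off-diagonal pairs are removed by \<open>qpoch_reflect_pair\<close> and diagonal factors
  by \<open>qpoch_reflect_diag\<close>. The exponents M_r M_s left by the former and M_r^2 left by
  the latter combine to the expansion of |M|^2.\<close>

lemma inner_weight_diag: "(inner_weight M M)\<^sup>2 * q ^ (wt M * wt M) = q ^ wt M"
proof -
  define \<rho> where "\<rho> = (\<lambda>r s. qpoch q (q powi (- int (M s)) * x r / x s) (M r) / qpoch q (q * x r / x s) (M r))"
  define B where "B = (\<Prod>r=1..n. \<rho> r r)"
  define A where "A = (\<Prod>r=1..n. \<Prod>s\<in>{r<..n}. q ^ (M r * M s))"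
  define Q where "Q = (\<Prod>r=1..n. q ^ (M r * M r))"
  have pair: "(1 - q powi (int (M r) - int (M s)) * x r / x s) / (1 - x r / x s) *
     (\<rho> r s * \<rho> s r) * (q ^ (M r * M s) * q ^ M s) = 1"
    if rs: "r \<in> {1..n}" "s \<in> {r<..n}" for r s
  proof -
    have nz: "x r \<noteq> 0" "x s \<noteq> 0" "1 - x r / x s \<noteq> 0"
      using x_nonzero[of r] x_nonzero[of s] x_distinct[of r s] rs by auto
    have g: "qpoch q (q * x r / x s) (M r) \<noteq> 0" "qpoch q (q * x s / x r) (M s) \<noteq> 0"
      using x_generic rs by auto
    define d where "d = 1 - x r / x s"
    define N1 N2 where "N1 = qpoch q (q powi (- int (M s)) * x r / x s) (M r)"
      and "N2 = qpoch q (q powi (- int (M r)) * x s / x r) (M s)"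
    define D1 D2 where "D1 = qpoch q (q * x r / x s) (M r)" and "D2 = qpoch q (q * x s / x r) (M s)"
    define v where "v = 1 - q powi (int (M r) - int (M s)) * x r / x s"
    have "N1 * N2 * v * (q ^ (M r * M s) * q ^ M s) = D2 * D1 * d"
      using qpoch_reflect_pair[of q "x r / x s" "M s" "M r"] nz
      by (simp add: power_add N1_def N2_def D1_def D2_def v_def d_def)
    moreover have "d \<noteq> 0" "D1 \<noteq> 0" "D2 \<noteq> 0"
      using nz g by (auto simp: d_def D1_def D2_def)
    ultimately have "v / d * (N1 / D1 * (N2 / D2)) * (q ^ (M r * M s) * q ^ M s) = 1"
      by (simp add: divide_simps mult_ac)
    then show ?thesis
      by (simp add: \<rho>_def N1_def N2_def D1_def D2_def v_def d_def)
  qed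
  have iw: "inner_weight M M = vandermonde_quot q n x M * (\<Prod>r=1..n. \<Prod>s=1..n. \<rho> r s) * q ^ (\<Sum>r=1..n. r * M r)"
    by (simp only: inner_weight_def \<rho>_def)
  have "inner_weight M M * (A * q ^ (\<Sum>r=1..n. (r - 1) * M r)) =
     B * q ^ (\<Sum>r=1..n. r * M r) *
     (\<Prod>r=1..n. \<Prod>s\<in>{r<..n}. (1 - q powi (int (M r) - int (M s)) * x r / x s) / (1 - x r / x s) *
     (\<rho> r s * \<rho> s r) * (q ^ (M r * M s) * q ^ M s))"
    unfolding iw prod_pairs[of \<rho>] B_def A_def
      prod_triangle_power[symmetric] vandermonde_quot_def prod.distrib by (simp only: mult_ac)
  also have "\<dots> = B * q ^ (\<Sum>r=1..n. r * M r) * 1"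
    by (rule arg_cong[where f = "\<lambda>t. _ * t"], intro prod.neutral ballI, rule pair)
  also have "(\<Sum>r=1..n. r * M r) = (\<Sum>r=1..n. (r - 1) * M r) + wt M"
    unfolding sum.distrib[symmetric] by (intro sum.cong refl) (auto simp: algebra_simps)
  finally have 1: "inner_weight M M * A = B * q ^ wt M"
    by (simp add: power_add mult.assoc[symmetric])
  have 2: "B\<^sup>2 * Q * q ^ wt M = 1"
  proof -
    have "B\<^sup>2 * Q * q ^ wt M = (\<Prod>r=1..n. (\<rho> r r)\<^sup>2 * q ^ (M r * M r) * q ^ M r)"
      by (simp add: B_def Q_def prod.distrib power_sum prod_power_distrib)
    also have "\<dots> = (\<Prod>r=1..n. 1)"
    proof (rule prod.cong[OF refl])
      fix r assume r: "r \<in> {1..n}"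
      have "qpoch q q (M r) \<noteq> 0"
        using x_generic[OF r r, of "M r"] x_nonzero[OF r] by simp
      then show "(\<rho> r r)\<^sup>2 * q ^ (M r * M r) * q ^ M r = 1"
        using qpoch_reflect_diag[of q "M r"] x_nonzero[OF r] by (simp add: \<rho>_def power_divide)
    qed
    finally show ?thesis
      by simp
  qed
  have 3: "Q * A\<^sup>2 = q ^ (wt M * wt M)"
  proof -
    have "q ^ (wt M * wt M) = (\<Prod>r=1..n. \<Prod>s=1..n. q ^ (M r * M s))"
      by (simp add: sum_product power_sum)
    also have "\<dots> = Q * (\<Prod>r=1..n. \<Prod>s\<in>{r<..n}. q ^ (M r * M s) * q ^ (M s * M r))"
      unfolding prod_pairs Q_def by simp
    also have "(\<Prod>r=1..n. \<Prod>s\<in>{r<..n}. q ^ (M r * M s) * q ^ (M s * M r)) = A\<^sup>2"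
      unfolding A_def prod.distrib power2_eq_square by (simp add: mult.commute)
    finally show ?thesis
      by simp
  qed
  have "(inner_weight M M)\<^sup>2 * q ^ (wt M * wt M) = (inner_weight M M * A)\<^sup>2 * Q"
    unfolding 3[symmetric] by (simp add: power_mult_distrib mult_ac)
  also have "\<dots> = (B\<^sup>2 * Q * q ^ wt M) * q ^ wt M"
    unfolding 1 by (simp add: power_mult_distrib power2_eq_square mult_ac)
  finally show ?thesis
    unfolding 2 by simp
qed

definition outer_term :: "complex \<Rightarrow> (nat \<Rightarrow> complex) \<Rightarrow> (nat \<Rightarrow> nat) \<Rightarrow> complex" where
  "outer_term \<alpha> a k = vandermonde_quot q n x k
     * ((\<Prod>r=1..n. \<Prod>s=1..n. qpoch_hom q (q * x r / x s) (a s) (k r))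
        / (\<Prod>r=1..n. \<Prod>s=1..n. qpoch q (q * x r / x s) (k r)))
     * (\<Prod>r=1..n. (1 - \<alpha> * x r * q ^ (k r + wt k)) / (1 - \<alpha> * x r))
     * (\<Prod>r=1..n. qpoch q (\<alpha> * x r) (wt k) / qpoch q (\<alpha> * x r * a r) (wt k))
     * q powi (int (\<Sum>r=1..n. (r - 1) * k r) - int (n * wt k))"

text \<open>The factors with b, c, d, \<beta>, \<gamma> depend on m but not on k and are left out,
  so the matrix to be inverted involves no parameters besides q, x and \<alpha>.\<close>

definition inner_kernel :: "complex \<Rightarrow> (nat \<Rightarrow> nat) \<Rightarrow> (nat \<Rightarrow> nat) \<Rightarrow> complex" where
  "inner_kernel \<alpha> k m = inner_weight k m * (\<Prod>r=1..n. qpoch q (\<alpha> * x r * q ^ wt k) (m r))"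

text \<open>For a_r = q^(M_r + 1) one has (q / a_r)_k = (q^(-M_r))_k, so M_r, and not M_r + 1, is
  the last index k_r that survives in the outer sum.\<close>

abbreviation qshift :: "(nat \<Rightarrow> nat) \<Rightarrow> nat \<Rightarrow> complex" where
  "qshift M \<equiv> (\<lambda>r. q ^ Suc (M r))"

lemma box_subset: "k \<in> box M \<Longrightarrow> box k \<subseteq> box M"
  by (rule PiE_mono) (auto simp: PiE_iff)

lemma wt_box: "k \<in> box M \<Longrightarrow> wt k \<le> wt M"
  by (rule sum_mono) (auto simp: PiE_iff)

lemma wt_box_less:
  assumes "k \<in> box M" "M \<in> multi" "k \<noteq> M"
  shows "wt k < wt M"
proof (rule sum_strict_mono_ex1)
  show "\<exists>r\<in>{1..n}. k r < M r"
  proof (rule ccontr)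
    assume "\<not> (\<exists>r\<in>{1..n}. k r < M r)"
    moreover have "k r \<le> M r" if "r \<in> {1..n}" for r
      using assms(1) that by (auto simp: PiE_iff)
    ultimately have "k r = M r" if "r \<in> {1..n}" for r
      using that le_neq_implies_less by blast
    then have "k = M"
      using assms(1,2) by (intro PiE_ext[of k _ "\<lambda>_. UNIV" M]) (auto simp: PiE_iff)
    with assms(3) show False
      by simp
  qed
qed (use assms in \<open>auto simp: PiE_iff\<close>)

lemma box_outside: "m \<in> multi \<Longrightarrow> m \<notin> box k \<Longrightarrow> \<exists>r\<in>{1..n}. k r < m r"
  by (force simp: PiE_iff)

lemma inner_kernel_outside:
  assumes "m \<in> multi" "m \<notin> box k"
  shows "inner_kernel \<alpha> k m = 0"
proof -
  obtain r where r: "r \<in> {1..n}" "k r < m r"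
    using box_outside assms by blast
  have "qpoch q (q powi (- int (k r)) * x r / x r) (m r) = 0"
    using r x_nonzero[of r] unfolding qpoch_def power_int_minus_of_nat
    by (auto intro!: bexI[of _ "k r"])
  note 0 = this
  have "(\<Prod>r=1..n. \<Prod>s=1..n. qpoch q (q powi (- int (k s)) * x r / x s) (m r) / qpoch q (q * x r / x s) (m r)) = 0"
    by (intro prod_zero bexI[of _ r]) (simp_all only: 0 r finite_atLeastAtMost div_0)
  then show ?thesis
    by (simp add: inner_kernel_def inner_weight_def)
qed

lemma outer_term_outside:
  assumes "m r > k r" "r \<in> {1..n}" "a r = q ^ Suc (k r)"
  shows "outer_term \<alpha> a m = 0"
proof -
  have "qpoch_hom q (q * x r / x r) (a r) (m r) = 0"
    using assms x_nonzero[of r] unfolding qpoch_hom_def by (auto intro!: bexI[of _ "k r"])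
  note 0 = this
  have "(\<Prod>r=1..n. \<Prod>s=1..n. qpoch_hom q (q * x r / x s) (a s) (m r)) = 0"
    by (intro prod_zero bexI[of _ r]) (simp_all only: 0 assms(2) finite_atLeastAtMost)
  then show ?thesis
    by (simp add: outer_term_def)
qed

definition node_poly :: "(nat \<Rightarrow> nat) \<Rightarrow> complex poly" where
  "node_poly m = (\<Prod>r=1..n. \<Prod>i<m r. [:- (x r * q ^ i), 1:])"

lemma degree_node_poly: "degree (node_poly m) \<le> wt m"
proof -
  have "degree (\<Prod>i<m r. [:- (x r * q ^ i), 1:]) \<le> m r" for r
    using degree_prod_sum_le[of "{..<m r}" "\<lambda>i. [:- (x r * q ^ i), 1:]"] by simp
  then show ?thesis
    unfolding node_poly_def
    by (intro order_trans[OF degree_prod_sum_le] sum_mono) auto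
qed

text \<open>Once a_s = q^(k_s + 1) is tied to k, the factor of index i is q / x_s times x_s q^(k_s)
  - x_r q^i. So one and the same polynomial is evaluated at each node x_s q^(k_s), which makes the
  expression symmetric in these nodes.\<close>

lemma prod_qpoch_hom_qshift:
  "(\<Prod>r=1..n. \<Prod>s=1..n. qpoch_hom q (q * x r / x s) (qshift k s) (m r)) =
   (\<Prod>s=1..n. (q / x s) ^ wt m) * (\<Prod>s=1..n. poly (node_poly m) (x s * q ^ k s))"
proof -
  have "qpoch_hom q (q * x r / x s) (qshift k s) (m r) =
     (q / x s) ^ m r * poly (\<Prod>i<m r. [:- (x r * q ^ i), 1:]) (x s * q ^ k s)" if "s \<in> {1..n}" for r s
  proof -
    have "qpoch_hom q (q * x r / x s) (qshift k s) (m r) =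
        (\<Prod>i<m r. (q / x s) * (x s * q ^ k s - x r * q ^ i))"
      unfolding qpoch_hom_def using x_nonzero[OF that] by (intro prod.cong refl) (simp add: field_simps)
    also have "\<dots> = (q / x s) ^ m r * (\<Prod>i<m r. x s * q ^ k s - x r * q ^ i)"
      by (simp only: prod.distrib prod_constant card_lessThan)
    finally show ?thesis
      by (simp add: poly_prod)
  qed
  then have "(\<Prod>r=1..n. \<Prod>s=1..n. qpoch_hom q (q * x r / x s) (qshift k s) (m r)) =
     (\<Prod>r=1..n. \<Prod>s=1..n. (q / x s) ^ m r * poly (\<Prod>i<m r. [:- (x r * q ^ i), 1:]) (x s * q ^ k s))"
    by simp
  also have "\<dots> = (\<Prod>s=1..n. \<Prod>r=1..n. (q / x s) ^ m r * poly (\<Prod>i<m r. [:- (x r * q ^ i), 1:]) (x s * q ^ k s))"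
    by (rule prod.swap)
  finally show ?thesis
    by (simp add: prod.distrib power_sum node_poly_def poly_prod)
qed

(* As a function of k the product of the two kernels is a symmetric polynomial in the
   x_s q^(k_s), of degree less than |M| in each of them, so the divided difference kills it. *)
lemma inner_kernel_outer_term_orthogonal:
  assumes n: "n \<ge> 1" and lt: "wt m < wt M"
    and \<alpha>: "\<And>r i. r \<in> {1..n} \<Longrightarrow> \<alpha> * x r * q ^ i \<noteq> 1"
  shows "(\<Sum>k\<in>box M. inner_kernel \<alpha> M k *
     (outer_term \<alpha> (qshift k) m / (\<Prod>r=1..n. qpoch q (\<alpha> * q * x r) (k r)))) = 0"
proof -
  define D where "D = wt M"
  \<comment> \<open>Writing (\<alpha> q x_r)_(|M| - 1 + k_r) in two ways shows that the q-factorials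
    containing \<alpha> and k_r reduce to this polynomial at the node x_r q^(k_r). The hypothesis
    |m| < |M| makes its length D - 1 - |m| a genuine difference.\<close>
  define Q where "Q = (\<Prod>i<D - 1 - wt m. [:1, - (\<alpha> * q ^ (wt m + 1) * q ^ i):])"
  define p where "p = node_poly m * Q"
  have Q: "poly Q y = qpoch q (\<alpha> * q ^ (wt m + 1) * y) (D - 1 - wt m)" for y
    by (simp add: Q_def poly_prod qpoch_def mult_ac)
  have "degree Q \<le> D - 1 - wt m"
    unfolding Q_def
    by (rule order_trans[OF degree_prod_sum_le]) (auto intro!: order_trans[OF sum_bounded_above[where K = 1]])
  then have degp: "degree p \<le> D - 1"
    using degree_mult_le[of "node_poly m" Q] degree_node_poly[of m] lt by (simp add: p_def D_def)
  have nz: "qpoch q (\<alpha> * x r * q ^ e) j \<noteq> 0" if "r \<in> {1..n}" for r e j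
  proof -
    have "(\<alpha> * x r * q ^ e) * q ^ i \<noteq> 1" for i
      using \<alpha>[OF that, of "e + i"] by (simp add: power_add mult_ac)
    then show ?thesis
      using qpoch_nonzero_iff by blast
  qed
  define C where "C = vandermonde_quot q n x m
     * (\<Prod>s=1..n. (q / x s) ^ wt m) / (\<Prod>r=1..n. \<Prod>s=1..n. qpoch q (q * x r / x s) (m r))
     * (\<Prod>r=1..n. (1 - \<alpha> * x r * q ^ (m r + wt m)) / (1 - \<alpha> * x r))
     * (\<Prod>r=1..n. qpoch q (\<alpha> * x r) (wt m))
     * q powi (int (\<Sum>r=1..n. (r - 1) * m r) - int (n * wt m))
     / (\<Prod>r=1..n. qpoch q (\<alpha> * x r * q) (D - 1))"
  have kern: "inner_kernel \<alpha> M k * (outer_term \<alpha> (qshift k) m / (\<Prod>r=1..n. qpoch q (\<alpha> * q * x r) (k r))) =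
     C * (inner_weight M k * (\<Prod>s=1..n. poly p (x s * q ^ k s)))" for k
  proof -
    have ratio: "qpoch q (\<alpha> * x r * q ^ D) (k r) /
        (qpoch q (\<alpha> * x r * q ^ Suc (k r)) (wt m) * qpoch q (\<alpha> * q * x r) (k r)) =
        poly Q (x r * q ^ k r) / qpoch q (\<alpha> * x r * q) (D - 1)" if r: "r \<in> {1..n}" for r
    proof -
      let ?z = "\<alpha> * x r * q"
      have e: "?z * q ^ (D - 1) = \<alpha> * x r * q ^ D" "D - 1 + k r = k r + wt m + (D - 1 - wt m)"
        using lt by (auto simp: D_def power_eq_if)
      have "qpoch q ?z (D - 1) * qpoch q (\<alpha> * x r * q ^ D) (k r) = qpoch q ?z (D - 1 + k r)"
        by (simp only: qpoch_add e(1))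
      also have "\<dots> = qpoch q ?z (k r) * qpoch q (?z * q ^ k r) (wt m) * qpoch q (?z * q ^ (k r + wt m)) (D - 1 - wt m)"
        unfolding e(2) by (simp add: qpoch_add)
      also have "qpoch q (?z * q ^ (k r + wt m)) (D - 1 - wt m) = poly Q (x r * q ^ k r)"
        by (simp add: Q power_add mult_ac)
      finally have "qpoch q ?z (D - 1) * qpoch q (\<alpha> * x r * q ^ D) (k r) =
         qpoch q ?z (k r) * qpoch q (?z * q ^ k r) (wt m) * poly Q (x r * q ^ k r)" .
      then show ?thesis
        using nz[OF r, of 1] nz[OF r, of "Suc (k r)"] by (simp add: field_simps)
    qed
    have "(\<Prod>r=1..n. qpoch q (\<alpha> * x r * q ^ D) (k r)) * (1 / (\<Prod>r=1..n. qpoch q (\<alpha> * x r * q ^ Suc (k r)) (wt m)) *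
         (1 / (\<Prod>r=1..n. qpoch q (\<alpha> * q * x r) (k r)))) =
       (\<Prod>r=1..n. qpoch q (\<alpha> * x r * q ^ D) (k r) /
        (qpoch q (\<alpha> * x r * q ^ Suc (k r)) (wt m) * qpoch q (\<alpha> * q * x r) (k r)))"
      by (simp add: prod_dividef prod.distrib)
    also have "\<dots> = (\<Prod>r=1..n. poly Q (x r * q ^ k r) / qpoch q (\<alpha> * x r * q) (D - 1))"
      by (intro prod.cong refl ratio)
    finally have R: "(\<Prod>r=1..n. qpoch q (\<alpha> * x r * q ^ D) (k r)) * (1 / (\<Prod>r=1..n. qpoch q (\<alpha> * x r * q ^ Suc (k r)) (wt m)) *
         (1 / (\<Prod>r=1..n. qpoch q (\<alpha> * q * x r) (k r)))) =
       (\<Prod>r=1..n. poly Q (x r * q ^ k r)) * (1 / (\<Prod>r=1..n. qpoch q (\<alpha> * x r * q) (D - 1)))"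
      by (simp add: prod_dividef)
    have "inner_kernel \<alpha> M k * (outer_term \<alpha> (qshift k) m / (\<Prod>r=1..n. qpoch q (\<alpha> * q * x r) (k r))) =
      (vandermonde_quot q n x m
     * (\<Prod>s=1..n. (q / x s) ^ wt m) / (\<Prod>r=1..n. \<Prod>s=1..n. qpoch q (q * x r / x s) (m r))
     * (\<Prod>r=1..n. (1 - \<alpha> * x r * q ^ (m r + wt m)) / (1 - \<alpha> * x r))
     * (\<Prod>r=1..n. qpoch q (\<alpha> * x r) (wt m))
     * q powi (int (\<Sum>r=1..n. (r - 1) * m r) - int (n * wt m))) *
     inner_weight M k * (\<Prod>s=1..n. poly (node_poly m) (x s * q ^ k s)) *
      ((\<Prod>r=1..n. qpoch q (\<alpha> * x r * q ^ D) (k r)) * (1 / (\<Prod>r=1..n. qpoch q (\<alpha> * x r * q ^ Suc (k r)) (wt m)) *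
         (1 / (\<Prod>r=1..n. qpoch q (\<alpha> * q * x r) (k r)))))"
      unfolding inner_kernel_def outer_term_def prod_qpoch_hom_qshift D_def prod_dividef[of "\<lambda>r. qpoch q (\<alpha> * x r) (wt m)"]
      by (simp only: divide_inverse mult_ac inverse_mult_distrib mult_1_left mult_1_right)
    also have "\<dots> = C * (inner_weight M k * (\<Prod>s=1..n. poly p (x s * q ^ k s)))"
      unfolding R by (simp add: C_def p_def prod.distrib)
    finally show ?thesis .
  qed
  have r0: "1 \<in> {1..n}"
    using n by simp
  define \<Phi> where "\<Phi> = (\<lambda>y :: nat \<Rightarrow> complex. \<Prod>s=1..n. poly p (y s))"
  have "(\<Sum>k\<in>box M. inner_weight M k * \<Phi> (\<lambda>r. x r * q ^ k r)) =
    dW M (x 1) / vdm n x *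
    (\<Sum>k\<in>(\<Pi>\<^sub>E r\<in>{1..n} - {1}. {0..M r}).
       (\<Prod>r\<in>{1..n} - {1}. dW M (x r) / dW M (x r * q ^ k r)) *
       divdiff (nodes M) (\<lambda>w. vdm n ((\<lambda>r. x r * q ^ k r)(1 := w)) * \<Phi> ((\<lambda>r. x r * q ^ k r)(1 := w))))"
  proof (rule inner_sum_eq[OF r0])
    fix y s assume s: "s \<in> {1..n}"
    have "bij_betw (Transposition.transpose 1 s) {1..n} {1..n}"
      using s r0 by simp
    then have "(\<Prod>i\<in>{1..n}. poly p (y (Transposition.transpose 1 s i))) = (\<Prod>i\<in>{1..n}. poly p (y i))"
      by (rule prod.reindex_bij_betw)
    then show "\<Phi> (y \<circ> Transposition.transpose 1 s) = \<Phi> y"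
      by (simp add: \<Phi>_def)
  qed (auto simp: \<Phi>_def)
  also have "\<dots> = 0"
  proof -
    have "divdiff (nodes M) (\<lambda>w. vdm n (y(1 := w)) * \<Phi> (y(1 := w))) = 0" for y
    proof -
      obtain v where v: "degree v \<le> n - 1" "\<And>w. vdm n (y(1 := w)) = poly v w"
        using vdm_fun_upd_poly[OF r0] by blast
      define c where "c = (\<Prod>s\<in>{1..n} - {1}. poly p (y s))"
      have "\<Phi> (y(1 := w)) = poly p w * c" for w
        unfolding \<Phi>_def c_def using r0 by (subst prod.remove[of _ 1]) auto
      then have "(\<lambda>w. vdm n (y(1 := w)) * \<Phi> (y(1 := w))) = poly (smult c (v * p))"
        by (intro ext) (simp only: v(2) poly_smult poly_mult mult_ac)
      \<comment> \<open>The Vandermonde product adds at most n - 1 to the degree, at most |M| - 1,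
        of p; the total |M| + n - 2 is just below the threshold set by |M| + n nodes.\<close>
      moreover have "Suc (degree (smult c (v * p))) < card (nodes M)"
        using degree_smult_le[of c "v * p"] degree_mult_le[of v p] v(1) degp lt n
        unfolding card_nodes D_def by linarith
      ultimately show ?thesis
        using divdiff_poly_eq_0[of "nodes M"] by (simp only: finite_nodes)
    qed
    then show ?thesis
      by simp
  qed
  finally show ?thesis
    unfolding kern \<Phi>_def sum_distrib_left[symmetric] by simp
qed

text \<open>At a = \<open>qshift M\<close> the numerators (q x_r / (x_s a_s))_(M_r) coincide with
  the (q^(-M_s) x_r / x_s)_(M_r) of the inner weight. So the product is the square of the inner
  weight, apart from a power of q and the factors in \<alpha>; the latter telescope to the
  right-hand side.\<close>

lemma inner_kernel_outer_term_diag: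
  assumes "\<And>r. r \<in> {1..n} \<Longrightarrow> \<alpha> * x r \<noteq> 1"
    and "\<And>r j. r \<in> {1..n} \<Longrightarrow> qpoch q (\<alpha> * x r * q ^ Suc (M r)) j \<noteq> 0"
  shows "inner_kernel \<alpha> M M * outer_term \<alpha> (qshift M) M = (\<Prod>r=1..n. qpoch q (\<alpha> * q * x r) (M r))"
proof -
  define R where "R = (\<Prod>r=1..n. \<Prod>s=1..n. qpoch q (q powi (- int (M s)) * x r / x s) (M r))"
  define Dn where "Dn = (\<Prod>r=1..n. \<Prod>s=1..n. qpoch q (q * x r / x s) (M r))"
  have hom: "(\<Prod>r=1..n. \<Prod>s=1..n. qpoch_hom q (q * x r / x s) (qshift M s) (M r)) =
      q ^ (wt M * wt M + n * wt M) * R"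
  proof -
    have "qpoch_hom q (q * x r / x s) (qshift M s) (M r) =
       q ^ (Suc (M s) * M r) * qpoch q (q powi (- int (M s)) * x r / x s) (M r)" for r s
    proof -
      have "q * x r / x s / qshift M s = q powi (- int (M s)) * x r / x s"
        by (simp add: power_int_minus_of_nat field_simps)
      then show ?thesis
        using qpoch_hom_eq[of "qshift M s" q "q * x r / x s" "M r"]
        by (simp add: power_mult[symmetric] del: power_Suc)
    qed
    then have "(\<Prod>r=1..n. \<Prod>s=1..n. qpoch_hom q (q * x r / x s) (qshift M s) (M r)) =
        q ^ (\<Sum>r=1..n. \<Sum>s=1..n. Suc (M s) * M r) * R"
      by (simp add: R_def prod.distrib power_sum)
    also have "(\<Sum>r=1..n. \<Sum>s=1..n. Suc (M s) * M r) = (\<Sum>r=1..n. (wt M + n) * M r)"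
      unfolding sum_distrib_right[symmetric] by (simp add: sum_Suc)
    also have "\<dots> = (wt M + n) * wt M"
      by (simp add: sum_distrib_left)
    finally show ?thesis
      by (simp add: algebra_simps)
  qed
  define V where "V = vandermonde_quot q n x M"
  define e where "e = (\<Sum>r=1..n. (r - 1) * M r)"
  have iw: "inner_weight M M = V * (R / Dn) * (q ^ e * q ^ wt M)"
  proof -
    have "(\<Sum>r=1..n. r * M r) = e + wt M"
      unfolding e_def sum.distrib[symmetric] by (intro sum.cong refl) (auto simp: algebra_simps)
    then show ?thesis
      by (simp add: inner_weight_def V_def R_def Dn_def prod_dividef power_add)
  qed
  have pw: "q powi (int e - int (n * wt M)) = q ^ e / q ^ (n * wt M)"
    by (rule power_int_diff_of_nat) simp
  have ap: "(\<Prod>r=1..n. qpoch q (\<alpha> * x r * q ^ wt M) (M r)) *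
       ((\<Prod>r=1..n. (1 - \<alpha> * x r * q ^ (M r + wt M)) / (1 - \<alpha> * x r))
     * (\<Prod>r=1..n. qpoch q (\<alpha> * x r) (wt M) / qpoch q (\<alpha> * x r * qshift M r) (wt M))) =
     (\<Prod>r=1..n. qpoch q (\<alpha> * q * x r) (M r))"
    unfolding prod.distrib[symmetric]
  proof (rule prod.cong[OF refl])
    fix r assume r: "r \<in> {1..n}"
    let ?z = "\<alpha> * x r"
    have nz: "1 - ?z \<noteq> 0" "qpoch q (?z * qshift M r) (wt M) \<noteq> 0"
      using assms r by auto
    have "qpoch q ?z (wt M) * qpoch q (?z * q ^ wt M) (M r) * (1 - ?z * q ^ (M r + wt M)) = qpoch q ?z (Suc (wt M + M r))"
      by (subst add.commute[of "M r"], subst qpoch_Suc, subst qpoch_add, rule refl)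
    also have "\<dots> = qpoch q ?z (Suc (M r) + wt M)"
      by (simp add: add.commute)
    also have "\<dots> = (1 - ?z) * qpoch q (?z * q) (M r) * qpoch q (?z * qshift M r) (wt M)"
      unfolding qpoch_add qpoch_Suc' ..
    finally have eq: "qpoch q ?z (wt M) * qpoch q (?z * q ^ wt M) (M r) * (1 - ?z * q ^ (M r + wt M)) =
      (1 - ?z) * qpoch q (?z * q) (M r) * qpoch q (?z * qshift M r) (wt M)" .
    have zc: "\<alpha> * q * x r = ?z * q"
      by (simp add: mult_ac)
    have "qpoch q (?z * q ^ wt M) (M r) * ((1 - ?z * q ^ (M r + wt M)) / (1 - ?z) *
       (qpoch q ?z (wt M) / qpoch q (?z * qshift M r) (wt M))) =
       (qpoch q ?z (wt M) * qpoch q (?z * q ^ wt M) (M r) * (1 - ?z * q ^ (M r + wt M))) /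
       ((1 - ?z) * qpoch q (?z * qshift M r) (wt M))"
      by (simp add: mult_ac)
    also have "\<dots> = qpoch q (\<alpha> * q * x r) (M r)"
      unfolding eq zc using nz by simp
    finally show "qpoch q (?z * q ^ wt M) (M r) * ((1 - ?z * q ^ (M r + wt M)) / (1 - ?z) *
       (qpoch q ?z (wt M) / qpoch q (?z * qshift M r) (wt M))) = qpoch q (\<alpha> * q * x r) (M r)" .
  qed
  have "inner_kernel \<alpha> M M * outer_term \<alpha> (qshift M) M =
     (V * (R / Dn) * (q ^ e * q ^ wt M)) * (V * (q ^ (wt M * wt M + n * wt M) * R / Dn) * (q ^ e / q ^ (n * wt M))) *
     (\<Prod>r=1..n. qpoch q (\<alpha> * q * x r) (M r))"
    unfolding inner_kernel_def outer_term_def iw hom ap[symmetric] V_def[symmetric] Dn_def[symmetric]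
      e_def[symmetric] pw by (simp only: mult_ac)
  also have "(V * (R / Dn) * (q ^ e * q ^ wt M)) * (V * (q ^ (wt M * wt M + n * wt M) * R / Dn) * (q ^ e / q ^ (n * wt M))) =
     (V * (R / Dn) * (q ^ e * q ^ wt M))\<^sup>2 * q ^ (wt M * wt M) / q ^ wt M"
    by (simp add: power2_eq_square power_add mult_ac)
  also have "\<dots> = 1"
    unfolding iw[symmetric] inner_weight_diag by simp
  finally show ?thesis
    by simp
qed

text \<open>The relations proved so far have the inner kernel on the left;
  \<open>right_inverse_triangular\<close> reverses the order. It uses them for all pairs of
  multi-indices and after division by every \<open>d k\<close>, which is why no \<alpha> x_r q^i may
  equal 1.\<close>

lemma inversion_generic:
  assumes n: "n \<ge> 1" and M: "M \<in> multi" and m: "m \<in> multi"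
    and \<alpha>: "\<And>r i. r \<in> {1..n} \<Longrightarrow> \<alpha> * x r * q ^ i \<noteq> 1"
  shows "(\<Sum>k\<in>box M. outer_term \<alpha> (qshift M) k * inner_kernel \<alpha> k m) =
     (if M = m then \<Prod>r=1..n. qpoch q (\<alpha> * q * x r) (M r) else 0)"
proof -
  define d where "d = (\<lambda>k. \<Prod>r=1..n. qpoch q (\<alpha> * q * x r) (k r))"
  \<comment> \<open>The division by \<open>d k\<close> normalises the diagonal of the product to
    1.\<close>
  define G where "G = (\<lambda>k m. outer_term \<alpha> (qshift k) m / d k)"
  have nz: "qpoch q (\<alpha> * x r * q ^ e) j \<noteq> 0" if "r \<in> {1..n}" for r e j
  proof -
    have "(\<alpha> * x r * q ^ e) * q ^ i \<noteq> 1" for i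
      using \<alpha>[OF that, of "e + i"] by (simp add: power_add mult_ac)
    then show ?thesis
      using qpoch_nonzero_iff by blast
  qed
  have d: "d k \<noteq> 0" for k
    using nz[of _ 1] by (auto simp: d_def mult_ac)
  have box_T: "box k \<subseteq> multi" for k
    by (rule PiE_mono) auto
  have G0: "G k m = 0" if out: "m \<in> multi" "m \<notin> box k" for k m
  proof -
    obtain r where "r \<in> {1..n}" "k r < m r"
      using box_outside[OF out] by blast
    then show ?thesis
      unfolding G_def by (subst outer_term_outside) auto
  qed
  have refl: "k \<in> box k" if "k \<in> multi" for k
    using that by (auto simp: PiE_iff)
  have HG: "(\<Sum>k\<in>box j. inner_kernel \<alpha> j k * G k m) = (if j = m then 1 else 0)"
    if j: "j \<in> multi" and m: "m \<in> multi" for j m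
  proof (cases "j = m")
    case True
    have "inner_kernel \<alpha> j k * G k j = 0" if "k \<in> box j - {j}" for k
    proof -
      have "wt k < wt j"
        using that j by (intro wt_box_less) auto
      then have "j \<notin> box k"
        using wt_box[of j k] by auto
      then show ?thesis
        using G0[OF j] by simp
    qed
    then have "(\<Sum>k\<in>box j. inner_kernel \<alpha> j k * G k j) = (\<Sum>k\<in>{j}. inner_kernel \<alpha> j k * G k j)"
      using refl[OF j] by (intro sum.mono_neutral_right) (auto intro!: finite_PiE)
    also have "\<dots> = 1"
    proof -
      have "inner_kernel \<alpha> j j * outer_term \<alpha> (qshift j) j = d j"
        unfolding d_def
      proof (rule inner_kernel_outer_term_diag)
        show "\<alpha> * x r \<noteq> 1" if "r \<in> {1..n}" for r
          using \<alpha>[OF that, of 0] by simp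
      qed (rule nz)
      then show ?thesis
        using d[of j] by (simp add: G_def)
    qed
    finally show ?thesis
      using True by simp
  next
    case False
    show ?thesis
    proof (cases "wt m < wt j")
      case True
      then show ?thesis
        using inner_kernel_outer_term_orthogonal[OF n True, of \<alpha>] \<alpha> False by (simp add: G_def d_def)
    next
      case wt: False
      have "m \<notin> box j"
        using wt_box_less[of m j] j False wt by blast
      then have "G k m = 0" if "k \<in> box j" for k
        using G0[OF m, of k] box_subset[OF that] by blast
      with False show ?thesis
        by simp
    qed
  qed
  have "(\<Sum>k\<in>box M. G M k * inner_kernel \<alpha> k m) = (if M = m then 1 else 0)"
  proof (rule right_inverse_triangular[where T = multi and B = box and w = wt])
    show "\<And>j. j \<in> multi \<Longrightarrow> finite (box j)"
      by (intro finite_PiE) auto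
    show "\<And>j. j \<in> multi \<Longrightarrow> box j \<subseteq> multi"
      by (rule box_T)
    show "\<And>j. j \<in> multi \<Longrightarrow> j \<in> box j"
      by (rule refl)
    show "\<And>j k. j \<in> multi \<Longrightarrow> k \<in> box j \<Longrightarrow> box k \<subseteq> box j"
      by (rule box_subset)
    show "\<And>j k. j \<in> multi \<Longrightarrow> k \<in> box j \<Longrightarrow> k \<noteq> j \<Longrightarrow> wt k < wt j"
      by (rule wt_box_less)
    show "\<And>j m. j \<in> multi \<Longrightarrow> m \<in> multi \<Longrightarrow> m \<notin> box j \<Longrightarrow> inner_kernel \<alpha> j m = 0"
      by (rule inner_kernel_outside)
    show "\<And>j m. j \<in> multi \<Longrightarrow> m \<in> multi \<Longrightarrow> m \<notin> box j \<Longrightarrow> G j m = 0"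
      by (rule G0)
  qed (rule HG M m; assumption?)+
  then have "(\<Sum>k\<in>box M. outer_term \<alpha> (qshift M) k * inner_kernel \<alpha> k m) / d M = (if M = m then 1 else 0)"
    by (simp add: G_def sum_divide_distrib)
  then show ?thesis
    using d[of M] by (auto simp: d_def split: if_splits)
qed

text \<open>The excluded values 1 / (x_r q^i) tend to infinity with i, so only finitely many of them
  lie near \<open>\<alpha>\<^sub>0\<close>.\<close>

lemma eventually_generic:
  "\<forall>\<^sub>F \<alpha> in at \<alpha>\<^sub>0. \<forall>r\<in>{1..n}. \<forall>i. \<alpha> * x r * q ^ i \<noteq> 1"
proof (rule eventually_ball_finite, simp, rule ballI)
  fix r assume r: "r \<in> {1..n}"
  have "(\<lambda>i. (norm \<alpha>\<^sub>0 + 1) * norm (x r) * norm q ^ i) \<longlonglongrightarrow> (norm \<alpha>\<^sub>0 + 1) * norm (x r) * 0"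
    using q_less by (intro tendsto_intros LIMSEQ_power_zero) auto
  then have "\<forall>\<^sub>F i in sequentially. (norm \<alpha>\<^sub>0 + 1) * norm (x r) * norm q ^ i < 1"
    by (rule order_tendstoD) simp
  then obtain i0 where i0: "\<And>i. i \<ge> i0 \<Longrightarrow> (norm \<alpha>\<^sub>0 + 1) * norm (x r) * norm q ^ i < 1"
    by (auto simp: eventually_sequentially)
  have "\<forall>\<^sub>F \<alpha> in at \<alpha>\<^sub>0. \<forall>i\<in>{..<i0}. \<alpha> \<noteq> 1 / (x r * q ^ i)"
    by (intro eventually_ball_finite ballI eventually_neq_at_within) simp
  moreover have "\<forall>\<^sub>F \<alpha> in at \<alpha>\<^sub>0. dist \<alpha> \<alpha>\<^sub>0 < 1"
    by (auto simp: eventually_at intro!: exI[of _ 1])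
  ultimately show "\<forall>\<^sub>F \<alpha> in at \<alpha>\<^sub>0. \<forall>i. \<alpha> * x r * q ^ i \<noteq> 1"
  proof eventually_elim
    case (elim \<alpha>)
    show ?case
    proof
      fix i
      show "\<alpha> * x r * q ^ i \<noteq> 1"
      proof (cases "i < i0")
        case True
        then have "\<alpha> \<noteq> 1 / (x r * q ^ i)"
          using elim by auto
        then show ?thesis
          using x_nonzero[OF r] by (auto simp: field_simps)
      next
        case False
        have "norm \<alpha> \<le> norm \<alpha>\<^sub>0 + 1"
          using elim norm_triangle_ineq2[of \<alpha> \<alpha>\<^sub>0] by (simp add: dist_norm)
        then have "norm \<alpha> * norm (x r) * norm q ^ i \<le> (norm \<alpha>\<^sub>0 + 1) * norm (x r) * norm q ^ i"
          by (intro mult_right_mono) auto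
        also have "\<dots> < 1"
          using i0 False by simp
        finally have "norm (\<alpha> * x r * q ^ i) < 1"
          by (simp add: norm_mult norm_power)
        then show ?thesis
          by (metis norm_one less_irrefl)
      qed
    qed
  qed
qed

lemma tendsto_qpoch [tendsto_intros]:
  "(f \<longlongrightarrow> l) F \<Longrightarrow> ((\<lambda>t. qpoch q (f t) k) \<longlongrightarrow> qpoch q l k) F"
  unfolding qpoch_def by (intro tendsto_intros)

text \<open>Both sides are rational in \<alpha> with denominators that are nonzero under the present
  hypotheses, so the generic identity passes to the limit. This admits values with \<alpha> x_r q^i
  = 1 for some 1 \<le> i \<le> M_r.\<close>

lemma inversion:
  assumes n: "n \<ge> 1" and M: "M \<in> multi" and m: "m \<in> multi"
    and \<alpha>: "\<And>r. r \<in> {1..n} \<Longrightarrow> \<alpha> * x r \<noteq> 1"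
      "\<And>r j. r \<in> {1..n} \<Longrightarrow> qpoch q (\<alpha> * x r * q ^ Suc (M r)) j \<noteq> 0"
  shows "(\<Sum>k\<in>box M. outer_term \<alpha> (qshift M) k * inner_kernel \<alpha> k m) =
     (if M = m then \<Prod>r=1..n. qpoch q (\<alpha> * q * x r) (M r) else 0)"
proof (rule tendsto_unique)
  show "at \<alpha> \<noteq> bot"
    by simp
  show "((\<lambda>\<alpha>. \<Sum>k\<in>box M. outer_term \<alpha> (qshift M) k * inner_kernel \<alpha> k m) \<longlongrightarrow>
     (\<Sum>k\<in>box M. outer_term \<alpha> (qshift M) k * inner_kernel \<alpha> k m)) (at \<alpha>)"
    unfolding outer_term_def inner_kernel_def by (intro tendsto_intros) (use \<alpha> in auto)
  show "((\<lambda>\<alpha>. \<Sum>k\<in>box M. outer_term \<alpha> (qshift M) k * inner_kernel \<alpha> k m) \<longlongrightarrow>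
     (if M = m then \<Prod>r=1..n. qpoch q (\<alpha> * q * x r) (M r) else 0)) (at \<alpha>)"
  proof (rule Lim_transform_eventually)
    show "\<forall>\<^sub>F \<alpha> in at \<alpha>. (if M = m then \<Prod>r=1..n. qpoch q (\<alpha> * q * x r) (M r) else 0) =
      (\<Sum>k\<in>box M. outer_term \<alpha> (qshift M) k * inner_kernel \<alpha> k m)"
      using eventually_generic[of \<alpha>] by eventually_elim (use inversion_generic[OF n M m] in simp)
    show "((\<lambda>\<alpha>. if M = m then \<Prod>r=1..n. qpoch q (\<alpha> * q * x r) (M r) else 0) \<longlongrightarrow>
      (if M = m then \<Prod>r=1..n. qpoch q (\<alpha> * q * x r) (M r) else 0)) (at \<alpha>)"
      by (cases "M = m") (simp_all only: if_True if_False simp_thms, (intro tendsto_intros)+)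
  qed
qed

text \<open>Exchanging the two finite sums leaves a diagonal matrix applied to g. Since g is
  arbitrary, the terminating identity is the case in which g is the appropriate quotient of
  q-factorials.\<close>

lemma terminating_expansion:
  assumes n: "n \<ge> 1" and M: "M \<in> multi"
    and \<alpha>: "\<And>r. r \<in> {1..n} \<Longrightarrow> \<alpha> * x r \<noteq> 1"
      "\<And>r j. r \<in> {1..n} \<Longrightarrow> qpoch q (\<alpha> * x r * q ^ Suc (M r)) j \<noteq> 0"
  shows "(\<Sum>k\<in>box M. outer_term \<alpha> (qshift M) k * (\<Sum>m\<in>box k. inner_kernel \<alpha> k m * g m)) =
     (\<Prod>r=1..n. qpoch q (\<alpha> * q * x r) (M r)) * g M"
proof -
  have fin: "finite (box k)" for k
    by (intro finite_PiE) auto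
  have T: "m \<in> multi" if "m \<in> box k" for m k
    using that by (auto simp: PiE_iff)
  have "(\<Sum>m\<in>box k. inner_kernel \<alpha> k m * g m) = (\<Sum>m\<in>box M. inner_kernel \<alpha> k m * g m)" if "k \<in> box M" for k
  proof (rule sum.mono_neutral_left[OF fin box_subset[OF that]], rule ballI)
    fix m assume "m \<in> box M - box k"
    then have m: "m \<in> box M" "m \<notin> box k"
      by simp_all
    have "inner_kernel \<alpha> k m = 0"
      by (rule inner_kernel_outside[OF T[OF m(1)] m(2)])
    then show "inner_kernel \<alpha> k m * g m = 0"
      by simp
  qed
  then have "(\<Sum>k\<in>box M. outer_term \<alpha> (qshift M) k * (\<Sum>m\<in>box k. inner_kernel \<alpha> k m * g m)) =
     (\<Sum>k\<in>box M. \<Sum>m\<in>box M. outer_term \<alpha> (qshift M) k * inner_kernel \<alpha> k m * g m)"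
    by (simp add: sum_distrib_left mult.assoc)
  also have "\<dots> = (\<Sum>m\<in>box M. (\<Sum>k\<in>box M. outer_term \<alpha> (qshift M) k * inner_kernel \<alpha> k m) * g m)"
    by (subst sum.swap) (simp add: sum_distrib_right)
  also have "\<dots> = (\<Sum>m\<in>box M. (if M = m then \<Prod>r=1..n. qpoch q (\<alpha> * q * x r) (M r) else 0) * g m)"
    by (intro sum.cong refl) (subst inversion[OF n M T \<alpha>], auto)
  also have "\<dots> = (\<Sum>m\<in>box M. if M = m then (\<Prod>r=1..n. qpoch q (\<alpha> * q * x r) (M r)) * g m else 0)"
    by (intro sum.cong refl) auto
  also have "\<dots> = (\<Prod>r=1..n. qpoch q (\<alpha> * q * x r) (M r)) * g M"
    using M fin[of M] by (subst sum.delta') (auto simp: PiE_iff)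
  finally show ?thesis .
qed

end

section \<open>Interpolation by polynomials of controlled growth\<close>

text \<open>The Newton basis for interpolation at 1, q, q^2, ...: the element of index j vanishes at
  q^M for all M < j, so expansions in it terminate at these points.\<close>

definition newton_basis :: "complex \<Rightarrow> nat \<Rightarrow> complex \<Rightarrow> complex" where
  "newton_basis q j z = (\<Prod>i<j. z - q ^ i)"

lemma newton_basis_power_eq_0: "M < j \<Longrightarrow> newton_basis q j (q ^ M) = 0"
  by (auto simp: newton_basis_def)

lemma newton_basis_scale:
  "newton_basis q (Suc j) (q * z) =
    q ^ Suc j * newton_basis q (Suc j) z - q ^ j * (1 - q ^ Suc j) * newton_basis q j z"
proof -
  have "newton_basis q (Suc j) (q * z) = (q * z - 1) * (\<Prod>i<j. q * (z - q ^ i))"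
    unfolding newton_basis_def by (subst prod.lessThan_Suc_shift) (simp add: algebra_simps)
  also have "(\<Prod>i<j. q * (z - q ^ i)) = q ^ j * newton_basis q j z"
    by (simp add: newton_basis_def prod.distrib)
  finally show ?thesis
    by (simp add: newton_basis_def algebra_simps)
qed

text \<open>This is the q-Chu-Vandermonde sum, with u^j (c / u)_j written as a product so that u = 0
  is included. Raising M by one evaluates the basis at q times the old point, and summation by parts
  then leads to the sum for u q and c q. Any L \<ge> M will do, since the terms with j > M
  vanish.\<close>

lemma qpoch_quotient_newton:
  assumes q: "\<And>k. qpoch q q k \<noteq> 0" and c: "\<And>k. qpoch q c k \<noteq> 0" and "M \<le> L"
  shows "(\<Sum>j\<le>L. (\<Prod>i<j. u - c * q ^ i) / (qpoch q c j * qpoch q q j) * newton_basis q j (q ^ M)) =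
    qpoch q u M / qpoch q c M"
  using c \<open>M \<le> L\<close>
proof (induction M arbitrary: u c)
  case 0
  have "(\<Sum>j\<le>L. (\<Prod>i<j. u - c * q ^ i) / (qpoch q c j * qpoch q q j) * newton_basis q j (q ^ 0)) =
    (\<Sum>j\<in>{0}. (\<Prod>i<j. u - c * q ^ i) / (qpoch q c j * qpoch q q j) * newton_basis q j (q ^ 0))"
    using newton_basis_power_eq_0[of 0 _ q] by (intro sum.mono_neutral_right) auto
  then show ?case
    by (simp add: newton_basis_def)
next
  case (Suc M)
  define e where "e = (\<lambda>j. (\<Prod>i<j. u - c * q ^ i) / qpoch q c j)"
  define nb where "nb = (\<lambda>j. newton_basis q j (q ^ M) / qpoch q q j)"
  obtain L' where L: "L = Suc L'" "M \<le> L'"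
    using Suc.prems by (cases L) auto
  have c1: "1 - c \<noteq> 0"
    using Suc.prems(1)[of 1] by (simp add: qpoch_def)
  have cq: "qpoch q (c * q) k \<noteq> 0" for k
    using Suc.prems(1)[of "Suc k"] by (simp add: qpoch_Suc')
  have nbL: "nb L = 0"
    using L by (simp add: nb_def newton_basis_power_eq_0)
  have step: "newton_basis q (Suc j) (q ^ Suc M) / qpoch q q (Suc j) = q ^ Suc j * nb (Suc j) - q ^ j * nb j" for j
  proof -
    have "qpoch q q (Suc j) = qpoch q q j * (1 - q ^ Suc j)"
      by (simp add: qpoch_Suc)
    moreover from this have "1 - q ^ Suc j \<noteq> 0"
      using q[of "Suc j"] by auto
    ultimately show ?thesis
      using q[of j] q[of "Suc j"] newton_basis_scale[of q j "q ^ M"]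
      by (simp add: nb_def diff_divide_distrib)
  qed
  \<comment> \<open>The differences of consecutive coefficients are again coefficients of the same
    type, with u q and c q in place of u and c; this closes the induction.\<close>
  have coeff: "q ^ j * (e j - e (Suc j)) = (1 - u) / (1 - c) *
      ((\<Prod>i<j. u * q - c * q * q ^ i) / qpoch q (c * q) j)" for j
  proof -
    have n1: "1 - c * q ^ j \<noteq> 0"
      using Suc.prems(1)[of "Suc j"] by (simp add: qpoch_Suc)
    have "(\<Prod>i<j. u * q - c * q * q ^ i) = (\<Prod>i<j. q * (u - c * q ^ i))"
      by (intro prod.cong refl) (simp add: algebra_simps)
    also have "\<dots> = q ^ j * (\<Prod>i<j. u - c * q ^ i)"
      by (simp add: prod.distrib)
    finally have p: "(\<Prod>i<j. u * q - c * q * q ^ i) = q ^ j * (\<Prod>i<j. u - c * q ^ i)" .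
    have "(1 - c) * qpoch q (c * q) j = qpoch q c j * (1 - c * q ^ j)"
      by (simp only: qpoch_Suc'[symmetric] qpoch_Suc)
    then have d: "(1 - u) / (1 - c) * (q ^ j * (\<Prod>i<j. u - c * q ^ i) / qpoch q (c * q) j) =
        (1 - u) * (q ^ j * (\<Prod>i<j. u - c * q ^ i)) / (qpoch q c j * (1 - c * q ^ j))"
      by (metis times_divide_times_eq)
    have "e j - e (Suc j) = e j * (1 - (u - c * q ^ j) / (1 - c * q ^ j))"
      by (simp add: e_def qpoch_Suc algebra_simps)
    also have "1 - (u - c * q ^ j) / (1 - c * q ^ j) = (1 - u) / (1 - c * q ^ j)"
      using n1 by (simp add: field_simps)
    finally show ?thesis
      unfolding p d by (simp add: e_def mult_ac)
  qed
  have "(\<Sum>j\<le>L. (\<Prod>i<j. u - c * q ^ i) / (qpoch q c j * qpoch q q j) * newton_basis q j (q ^ Suc M)) =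
    (\<Sum>j\<le>L. e j * (newton_basis q j (q ^ Suc M) / qpoch q q j))"
    by (simp add: e_def)
  also have "\<dots> = 1 + (\<Sum>j\<le>L'. e (Suc j) * (newton_basis q (Suc j) (q ^ Suc M) / qpoch q q (Suc j)))"
    unfolding L by (subst sum.atMost_Suc_shift) (simp add: e_def newton_basis_def)
  also have "\<dots> = 1 + (\<Sum>j\<le>L'. e (Suc j) * (q ^ Suc j * nb (Suc j))) - (\<Sum>j\<le>L'. e (Suc j) * (q ^ j * nb j))"
    unfolding step by (simp only: right_diff_distrib sum_subtractf add_diff_eq)
  also have "1 + (\<Sum>j\<le>L'. e (Suc j) * (q ^ Suc j * nb (Suc j))) = (\<Sum>j\<le>L. e j * (q ^ j * nb j))"
    unfolding L by (subst sum.atMost_Suc_shift) (simp add: e_def nb_def newton_basis_def)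
  also have "\<dots> = (\<Sum>j\<le>L'. e j * (q ^ j * nb j))"
    using nbL unfolding L by simp
  also have "(\<Sum>j\<le>L'. e j * (q ^ j * nb j)) - (\<Sum>j\<le>L'. e (Suc j) * (q ^ j * nb j)) =
     (\<Sum>j\<le>L'. q ^ j * (e j - e (Suc j)) * nb j)"
    unfolding sum_subtractf[symmetric] by (simp add: algebra_simps)
  also have "\<dots> = (\<Sum>j\<le>L. q ^ j * (e j - e (Suc j)) * nb j)"
    using nbL unfolding L by simp
  also have "\<dots> = (1 - u) / (1 - c) * (\<Sum>j\<le>L. (\<Prod>i<j. u * q - c * q * q ^ i) / (qpoch q (c * q) j * qpoch q q j) *
      newton_basis q j (q ^ M))"
    unfolding coeff sum_distrib_left by (intro sum.cong refl) (simp add: nb_def mult_ac)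
  also have "\<dots> = (1 - u) / (1 - c) * (qpoch q (u * q) M / qpoch q (c * q) M)"
    using Suc.IH[OF cq] L by simp
  also have "\<dots> = qpoch q u (Suc M) / qpoch q c (Suc M)"
    by (simp add: qpoch_Suc')
  finally show ?case .
qed

text \<open>After the first i factors, the remaining ones are q^i times the factors at the point
  q^(M - i). For i > M, where M - i is cut off at 0, both sides vanish.\<close>

lemma newton_basis_mult:
  assumes "q \<noteq> 0"
  shows "newton_basis q i (q ^ M) * newton_basis q l (q ^ (M - i)) * q ^ (i * l) = newton_basis q (i + l) (q ^ M)"
proof (cases "i \<le> M")
  case True
  have e: "q ^ i * q ^ (M - i) = q ^ M"
    using True by (simp flip: power_add)
  have "newton_basis q l (q ^ (M - i)) * q ^ (i * l) = (\<Prod>j<l. q ^ i * (q ^ (M - i) - q ^ j))"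
    by (simp add: newton_basis_def prod.distrib power_mult)
  also have "\<dots> = (\<Prod>j<l. q ^ M - q ^ (i + j))"
    by (intro prod.cong refl) (simp only: right_diff_distrib e power_add)
  finally have "newton_basis q l (q ^ (M - i)) * q ^ (i * l) = (\<Prod>j<l. q ^ M - q ^ (i + j))" .
  moreover have "newton_basis q (i + l) z = newton_basis q i z * (\<Prod>j<l. z - q ^ (i + j))" for z
    by (induction l) (auto simp: newton_basis_def mult_ac)
  ultimately show ?thesis
    by (simp only: mult.assoc)
qed (simp add: newton_basis_power_eq_0)

lemma norm_newton_basis_le:
  assumes "norm q < 1" "1 \<le> norm z"
  shows "norm (newton_basis q j z) \<le> exp (1 / (1 - norm q)) * norm z ^ j"
proof -
  have "norm (newton_basis q j z) \<le> norm z ^ j * exp (1 / (norm z * (1 - norm q)))"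
  proof -
    have "0 < norm z"
      using assms by linarith
    then show ?thesis
      using norm_prod_geometric_le[of q "norm z" z 1 1 j] assms by (simp add: newton_basis_def)
  qed
  also have "\<dots> \<le> norm z ^ j * exp (1 / (1 - norm q))"
    using assms by (intro mult_left_mono) (auto simp: divide_simps)
  finally show ?thesis
    by (simp add: mult.commute)
qed

lemma qpoch_q_nonzero: "0 < norm q \<Longrightarrow> norm q < 1 \<Longrightarrow> qpoch q q k \<noteq> 0"
  by (rule qpoch_nonzero[OF _ qpoch_inf_nonzero])

(* A polynomial replaces the analytic continuation in q^M of the right-hand side because the latter
   may have poles at the nodes or inside the circle of integration. *)
lemma qpoch_quotient_interpolation:
  fixes q u v c d :: complex
  assumes q: "0 < norm q" "norm q < 1"
    and c: "\<And>k. qpoch q c k \<noteq> 0" and d: "\<And>k. qpoch q d k \<noteq> 0"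
    and \<sigma>: "norm u < \<sigma>" "norm v < \<sigma>"
  obtains p :: "nat \<Rightarrow> complex \<Rightarrow> complex" and C :: real
  where "\<And>K. p K holomorphic_on UNIV"
    and "\<And>K M. M \<le> K \<Longrightarrow> p K (q ^ M) = qpoch q u M * qpoch q v M / (qpoch q c M * qpoch q d M)"
    and "C \<ge> 0" and "\<And>K z. 1 \<le> norm z \<Longrightarrow> 1 \<le> \<sigma> * norm z \<Longrightarrow> norm (p K z) \<le> C * real (Suc K) ^ 2 * (\<sigma> * norm z) ^ K"
proof -
  have q0: "q \<noteq> 0"
    using q by auto
  have \<sigma>0: "\<sigma> > 0"
    using \<sigma> norm_ge_zero[of u] by linarith
  note qq = qpoch_q_nonzero[OF q]
  obtain C1 where C1: "C1 > 0" "\<And>k. norm (qpoch q c k) \<ge> C1"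
    using qpoch_bounded_below[OF q(2) c] by blast
  obtain C2 where C2: "C2 > 0" "\<And>k. norm (qpoch q d k) \<ge> C2"
    using qpoch_bounded_below[OF q(2) d] by blast
  obtain C3 where C3: "C3 > 0" "\<And>k. norm (qpoch q q k) \<ge> C3"
    using qpoch_bounded_below[OF q(2) qq] by blast
  \<comment> \<open>Coefficients of a twofold expansion: (u)_M / (c)_M with index i, and, after
    (v)_i / (d)_i is split off from (v)_M / (d)_M, the rest (v q^i)_(M - i) / (d q^i)_(M - i) with
    index l. The two basis elements combine to the one of index i + l.\<close>
  define co where "co = (\<lambda>i l. (\<Prod>e<i. u - c * q ^ e) / (qpoch q c i * qpoch q q i) *
    (qpoch q v i * ((\<Prod>e<l. v - d * q ^ e) / (qpoch q d (i + l) * qpoch q q l))))"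
  \<comment> \<open>Cutting at total index K loses nothing at q^M with M \<le> K and keeps the
    growth at (\<sigma> |z|)^K; the number of pairs (i, l) accounts for the factor (K +
    1)^2.\<close>
  define p where "p = (\<lambda>K z. \<Sum>i\<le>K. \<Sum>l\<le>K - i. co i l * newton_basis q (i + l) z)"
  define E where "E = (\<lambda>z :: complex. exp (norm z / (\<sigma> * (1 - norm q))))"
  define C where "C = E c / (C1 * C3) * (exp (norm v / (1 - norm q)) * (E d / (C2 * C3))) * exp (1 / (1 - norm q))"
  have co_le: "norm (co i l) \<le> E c * \<sigma> ^ i / (C1 * C3) * (exp (norm v / (1 - norm q)) * (E d * \<sigma> ^ l / (C2 * C3)))" for i l
  proof -
    have "norm (\<Prod>e<i. u - c * q ^ e) \<le> E c * \<sigma> ^ i" "norm (\<Prod>e<l. v - d * q ^ e) \<le> E d * \<sigma> ^ l"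
      using norm_prod_geometric_le[of q \<sigma> u c "norm c" i] norm_prod_geometric_le[of q \<sigma> v d "norm d" l] q \<sigma> \<sigma>0
      by (auto simp: E_def mult.commute)
    then show ?thesis
      unfolding co_def norm_mult norm_divide using C1 C2 C3 \<sigma>0 q norm_qpoch_le[OF q(2) order_refl, of v i]
      by (intro mult_mono frac_le) (auto simp: E_def intro!: mult_mono)
  qed
  show ?thesis
  proof (rule that[of p C])
    show "p K holomorphic_on UNIV" for K
      unfolding p_def newton_basis_def by (intro holomorphic_intros)
    show "C \<ge> 0"
      using C1 C2 C3 by (simp add: C_def E_def)
    show "norm (p K z) \<le> C * real (Suc K) ^ 2 * (\<sigma> * norm z) ^ K"
      if z: "1 \<le> norm z" "1 \<le> \<sigma> * norm z" for K z
    proof -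
      have t: "norm (co i l * newton_basis q (i + l) z) \<le> C * (\<sigma> * norm z) ^ K" if "i + l \<le> K" for i l
      proof -
        have "norm (co i l * newton_basis q (i + l) z) \<le>
          E c * \<sigma> ^ i / (C1 * C3) * (exp (norm v / (1 - norm q)) * (E d * \<sigma> ^ l / (C2 * C3))) *
          (exp (1 / (1 - norm q)) * norm z ^ (i + l))"
          unfolding norm_mult[of "co i l"]
          by (intro mult_mono co_le norm_newton_basis_le q z)
             (use C1 C2 C3 \<sigma>0 in \<open>auto simp: E_def\<close>)
        also have "\<dots> = C * (\<sigma> * norm z) ^ (i + l)"
          by (simp add: C_def power_mult_distrib power_add)
        also have "\<dots> \<le> C * (\<sigma> * norm z) ^ K"
          using z that \<open>C \<ge> 0\<close> by (intro mult_left_mono power_increasing) auto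
        finally show ?thesis .
      qed
      have "norm (p K z) \<le> (\<Sum>i\<le>K. norm (\<Sum>l\<le>K - i. co i l * newton_basis q (i + l) z))"
        unfolding p_def by (rule norm_sum)
      also have "\<dots> \<le> (\<Sum>i\<le>K. real (Suc K) * (C * (\<sigma> * norm z) ^ K))"
      proof (rule sum_mono)
        fix i assume i: "i \<in> {..K}"
        have "norm (\<Sum>l\<le>K - i. co i l * newton_basis q (i + l) z) \<le>
          (\<Sum>l\<le>K - i. norm (co i l * newton_basis q (i + l) z))"
          by (rule norm_sum)
        also have "\<dots> \<le> (\<Sum>l\<le>K - i. C * (\<sigma> * norm z) ^ K)"
          by (intro sum_mono t) (use i in auto)
        also have "\<dots> = real (Suc (K - i)) * (C * (\<sigma> * norm z) ^ K)"
          by simp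
        also have "\<dots> \<le> real (Suc K) * (C * (\<sigma> * norm z) ^ K)"
          using z \<open>C \<ge> 0\<close> by (intro mult_right_mono) auto
        finally show "norm (\<Sum>l\<le>K - i. co i l * newton_basis q (i + l) z) \<le> real (Suc K) * (C * (\<sigma> * norm z) ^ K)" .
      qed
      also have "\<dots> = C * real (Suc K) ^ 2 * (\<sigma> * norm z) ^ K"
        by (simp add: power2_eq_square)
      finally show ?thesis .
    qed
    show "p K (q ^ M) = qpoch q u M * qpoch q v M / (qpoch q c M * qpoch q d M)" if M: "M \<le> K" for K M
    proof -
      let ?N = "\<lambda>j. newton_basis q j (q ^ M)"
      have inner: "(\<Sum>l\<le>K - i. co i l * ?N (i + l)) =
         (\<Prod>e<i. u - c * q ^ e) / (qpoch q c i * qpoch q q i) * ?N i * (qpoch q v M / qpoch q d M)"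
        if i: "i \<le> K" for i
      proof (cases "i \<le> M")
        case False
        then show ?thesis
          by (simp add: newton_basis_power_eq_0)
      next
        case True
        have dq: "qpoch q (d * q ^ i) k \<noteq> 0" for k
          using d[of "i + k"] by (simp add: qpoch_add)
        have "co i l * ?N (i + l) = (\<Prod>e<i. u - c * q ^ e) / (qpoch q c i * qpoch q q i) * ?N i *
          (qpoch q v i / qpoch q d i) *
          ((\<Prod>e<l. v * q ^ i - d * q ^ i * q ^ e) / (qpoch q (d * q ^ i) l * qpoch q q l) * newton_basis q l (q ^ (M - i)))" for l
        proof -
          have "(\<Prod>e<l. v * q ^ i - d * q ^ i * q ^ e) = (\<Prod>e<l. q ^ i * (v - d * q ^ e))"
            by (intro prod.cong refl) (simp add: algebra_simps)
          also have "\<dots> = q ^ (i * l) * (\<Prod>e<l. v - d * q ^ e)"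
            by (simp add: prod.distrib power_mult)
          finally have pr: "(\<Prod>e<l. v * q ^ i - d * q ^ i * q ^ e) = q ^ (i * l) * (\<Prod>e<l. v - d * q ^ e)" .
          show ?thesis
            unfolding co_def pr newton_basis_mult[OF q0, symmetric] qpoch_add by (simp add: mult_ac)
        qed
        then have "(\<Sum>l\<le>K - i. co i l * ?N (i + l)) =
          (\<Prod>e<i. u - c * q ^ e) / (qpoch q c i * qpoch q q i) * ?N i * (qpoch q v i / qpoch q d i) *
          (\<Sum>l\<le>K - i. (\<Prod>e<l. v * q ^ i - d * q ^ i * q ^ e) / (qpoch q (d * q ^ i) l * qpoch q q l) *
             newton_basis q l (q ^ (M - i)))"
          by (simp only: sum_distrib_left)
        also have "(\<Sum>l\<le>K - i. (\<Prod>e<l. v * q ^ i - d * q ^ i * q ^ e) / (qpoch q (d * q ^ i) l * qpoch q q l) *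
             newton_basis q l (q ^ (M - i))) = qpoch q (v * q ^ i) (M - i) / qpoch q (d * q ^ i) (M - i)"
          by (rule qpoch_quotient_newton[OF qq dq]) (use M in simp)
        also have "(\<Prod>e<i. u - c * q ^ e) / (qpoch q c i * qpoch q q i) * ?N i * (qpoch q v i / qpoch q d i) *
            (qpoch q (v * q ^ i) (M - i) / qpoch q (d * q ^ i) (M - i)) =
           (\<Prod>e<i. u - c * q ^ e) / (qpoch q c i * qpoch q q i) * ?N i * (qpoch q v M / qpoch q d M)"
          using qpoch_add[of q v i "M - i"] qpoch_add[of q d i "M - i"] True by (simp add: mult_ac)
        finally show ?thesis .
      qed
      have "p K (q ^ M) = (\<Sum>i\<le>K. (\<Prod>e<i. u - c * q ^ e) / (qpoch q c i * qpoch q q i) * ?N i) * (qpoch q v M / qpoch q d M)"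
        unfolding p_def sum_distrib_right by (intro sum.cong refl inner) auto
      also have "\<dots> = qpoch q u M / qpoch q c M * (qpoch q v M / qpoch q d M)"
        by (subst qpoch_quotient_newton[OF qq c M]) simp
      finally show ?thesis
        by simp
    qed
  qed
qed

section \<open>Comparison of the exponents of |q|\<close>

lemma sum_min_Suc: "(\<Sum>i<b. min (Suc a) i) = (\<Sum>i<b. min a i) + (b - Suc a :: nat)"
  by (induction b) auto

text \<open>The a b pairs (i, j) with i < a and j < b are counted according to j < i, i < j or i =
  j.\<close>

lemma sum_min_symmetric: "(\<Sum>i<a. min b i) + (\<Sum>i<b. min a i) + min a b = a * (b :: nat)"
proof (induction a)
  case (Suc a)
  then show ?case
    unfolding sum_min_Suc by (auto simp: min_def split: if_splits)
qed auto

(* Exponents of |q|, doubled: the last sum on the left is the surplus that makes the sum over m of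
   the estimates converge. *)
lemma gaussian_exponent_le:
  fixes k m :: "nat \<Rightarrow> nat"
  assumes J: "finite J" "r0 \<notin> J"
    and mk: "\<And>r. r \<in> J \<Longrightarrow> m r \<le> k r" and max: "\<And>r. r \<in> J \<Longrightarrow> k r \<le> k r0"
  defines "M \<equiv> (\<Sum>r\<in>J. m r)" and "I \<equiv> insert r0 J"
  shows "M * (M + 1) + 2 * (\<Sum>r\<in>J. \<Sum>s\<in>I. \<Sum>i<m r. k s - i) + (\<Sum>r\<in>J. m r * (m r - 1))
    \<le> 2 * (M * (\<Sum>s\<in>I. k s)) + card I * M"
proof -
  \<comment> \<open>Truncated subtraction satisfies (a - i) + min a i = a, so the exponents
    \<open>k s - i\<close> can be traded for minima.\<close>
  have split: "(\<Sum>i<j. a - i) + (\<Sum>i<j. min a i) = j * a" for a j :: nat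
    by (induction j) (auto simp: min_def)
  have "(\<Sum>r\<in>J. \<Sum>s\<in>I. \<Sum>i<m r. k s - i) + (\<Sum>r\<in>J. \<Sum>s\<in>I. \<Sum>i<m r. min (k s) i) = M * (\<Sum>s\<in>I. k s)"
  proof -
    have "(\<Sum>r\<in>J. \<Sum>s\<in>I. \<Sum>i<m r. k s - i) + (\<Sum>r\<in>J. \<Sum>s\<in>I. \<Sum>i<m r. min (k s) i) =
      (\<Sum>r\<in>J. \<Sum>s\<in>I. (\<Sum>i<m r. k s - i) + (\<Sum>i<m r. min (k s) i))"
      by (simp only: sum.distrib)
    then show ?thesis
      unfolding split M_def by (simp only: sum_product)
  qed
  moreover have "(\<Sum>r\<in>J. \<Sum>s\<in>I. \<Sum>i<m r. min (k s) i) =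
     (\<Sum>r\<in>J. \<Sum>i<m r. min (k r0) i) + (\<Sum>r\<in>J. \<Sum>s\<in>J. \<Sum>i<m r. min (k s) i)"
    using J unfolding sum.distrib[symmetric] I_def by (intro sum.cong refl) simp
  \<comment> \<open>Slot r0 has the largest k, so the minimum is i throughout, and this part yields
    the surplus m_r (m_r - 1).\<close>
  moreover have "2 * (\<Sum>r\<in>J. \<Sum>i<m r. min (k r0) i) = (\<Sum>r\<in>J. m r * (m r - 1))"
  proof -
    have "2 * (\<Sum>i<m r. min (k r0) i) = m r * (m r - 1)" if "r \<in> J" for r
    proof -
      have "(\<Sum>i<m r. min (k r0) i) = (\<Sum>i<m r. i)"
        using mk[OF that] max[OF that] by (intro sum.cong refl) auto
      then show ?thesis
        using sum_min_symmetric[of "m r" "m r"] by (cases "m r") (auto simp: algebra_simps)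
    qed
    then show ?thesis
      by (simp add: sum_distrib_left)
  qed
  \<comment> \<open>On the other slots k_s is lowered to m_s. The double sum of ?T has the same
    value with r and s exchanged, and \<open>sum_min_symmetric\<close> evaluates the two together,
    at the price of diagonal terms of total size at most card J times M.\<close>
  moreover have "M * M \<le> 2 * (\<Sum>r\<in>J. \<Sum>s\<in>J. \<Sum>i<m r. min (k s) i) + card J * M"
  proof -
    let ?T = "\<lambda>r s. \<Sum>i<m r. min (m s) i"
    have "M * M = (\<Sum>r\<in>J. \<Sum>s\<in>J. ?T r s + ?T s r + min (m r) (m s))"
      unfolding M_def sum_product sum_min_symmetric ..
    also have "\<dots> = (\<Sum>r\<in>J. \<Sum>s\<in>J. ?T r s) + (\<Sum>r\<in>J. \<Sum>s\<in>J. ?T s r) + (\<Sum>r\<in>J. \<Sum>s\<in>J. min (m r) (m s))"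
      by (simp add: sum.distrib)
    also have "(\<Sum>r\<in>J. \<Sum>s\<in>J. ?T s r) = (\<Sum>r\<in>J. \<Sum>s\<in>J. ?T r s)"
      by (rule sum.swap)
    also have "(\<Sum>r\<in>J. \<Sum>s\<in>J. min (m r) (m s)) \<le> (\<Sum>r\<in>J. \<Sum>s\<in>J. m r)"
      by (intro sum_mono) auto
    also have "\<dots> = card J * M"
      by (simp add: M_def sum_distrib_left)
    also have "(\<Sum>r\<in>J. \<Sum>s\<in>J. ?T r s) \<le> (\<Sum>r\<in>J. \<Sum>s\<in>J. \<Sum>i<m r. min (k s) i)"
      by (intro sum_mono min.mono mk order_refl)
    finally show ?thesis
      by linarith
  qed
  moreover have "card I = Suc (card J)"
    using J by (simp add: I_def)
  ultimately show ?thesis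
    by (simp add: algebra_simps)
qed

lemma summable_gaussian:
  fixes \<kappa> D :: real
  assumes "0 < \<kappa>" "\<kappa> < 1" "0 \<le> D"
  shows "summable (\<lambda>m. D ^ m * \<kappa> ^ (m * (m - 1)))"
proof -
  have "(\<lambda>m. D * (\<kappa> ^ 2) ^ m) \<longlonglongrightarrow> D * 0"
    using assms by (intro tendsto_intros LIMSEQ_power_zero) (simp add: power_less_one_iff)
  then have "\<forall>\<^sub>F m in sequentially. D * (\<kappa> ^ 2) ^ m < 1 / 2"
    by (rule order_tendstoD) simp
  then obtain N where N: "\<And>m. m \<ge> N \<Longrightarrow> D * (\<kappa> ^ 2) ^ m < 1 / 2"
    by (auto simp: eventually_sequentially)
  show ?thesis
  proof (rule summable_ratio_test[where c = "1 / 2" and N = N])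
    fix m assume "N \<le> m"
    have e: "Suc m * (Suc m - 1) = 2 * m + m * (m - 1)"
      by (cases m) (auto simp: algebra_simps)
    have "D ^ Suc m * \<kappa> ^ (Suc m * (Suc m - 1)) = D * (\<kappa> ^ 2) ^ m * (D ^ m * \<kappa> ^ (m * (m - 1)))"
      unfolding e power_add power_mult by simp
    also have "\<dots> \<le> 1 / 2 * (D ^ m * \<kappa> ^ (m * (m - 1)))"
      using assms N[OF \<open>N \<le> m\<close>] by (intro mult_right_mono) auto
    finally show "norm (D ^ Suc m * \<kappa> ^ (Suc m * (Suc m - 1))) \<le> 1 / 2 * norm (D ^ m * \<kappa> ^ (m * (m - 1)))"
      using assms by simp
  qed simp
qed

section \<open>Bounds for the inner sum\<close>

lemma finite_uniform_lower_bound: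
  fixes f :: "'a \<Rightarrow> 'b \<Rightarrow> real"
  assumes "finite S" "\<And>i. i \<in> S \<Longrightarrow> \<exists>c>0. \<forall>k. c \<le> f i k"
  shows "\<exists>c>0. \<forall>i\<in>S. \<forall>k. c \<le> f i k"
  using assms
proof (induction S rule: finite_induct)
  case (insert i S)
  obtain c1 where c1: "c1 > 0" "\<And>k. c1 \<le> f i k"
    using insert.prems by blast
  obtain c2 where c2: "c2 > 0" "\<And>j k. j \<in> S \<Longrightarrow> c2 \<le> f j k"
    using insert by blast
  show ?case
    by (rule exI[of _ "min c1 c2"]) (use c1 c2 in \<open>auto simp: min_le_iff_disj\<close>)
qed (auto intro: exI[of _ 1])

text \<open>A factor with i < k is bounded by (1 + |z|) / |q|^(k - i), and one with i \<ge> k by 1 +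
  |z|; the truncated difference k - i covers both cases.\<close>

lemma norm_qpoch_neg_le:
  assumes "0 < norm q" "norm q < 1"
  shows "norm (qpoch q (q powi (- int k) * z) m) \<le> (1 + norm z) ^ m / norm q ^ (\<Sum>i<m. k - i)"
proof -
  have "norm (1 - q powi (- int k) * z * q ^ i) \<le> (1 + norm z) / norm q ^ (k - i)" for i
  proof -
    have le1: "norm q ^ j \<le> 1" for j
      using assms by (simp add: power_le_one)
    have "norm (q powi (- int k) * z * q ^ i) \<le> norm z / norm q ^ (k - i)"
    proof (cases "i \<le> k")
      case True
      have "norm q ^ k = norm q ^ (k - i) * norm q ^ i"
        using True by (simp flip: power_add)
      then show ?thesis
        using assms by (simp add: power_int_minus_of_nat norm_mult norm_divide norm_power)
    next
      case False
      have "norm q ^ i = norm q ^ (i - k) * norm q ^ k"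
        using False by (simp flip: power_add)
      then have "norm (q powi (- int k) * z * q ^ i) = norm z * norm q ^ (i - k)"
        using assms by (simp add: power_int_minus_of_nat norm_mult norm_divide norm_power)
      also have "\<dots> \<le> norm z * 1"
        by (intro mult_left_mono le1) auto
      finally show ?thesis
        using False by simp
    qed
    moreover have "1 \<le> 1 / norm q ^ (k - i)"
      using le1[of "k - i"] assms by simp
    moreover have "norm (1 - q powi (- int k) * z * q ^ i) \<le> 1 + norm (q powi (- int k) * z * q ^ i)"
      using norm_triangle_ineq4[of 1 "q powi (- int k) * z * q ^ i"] by simp
    ultimately show ?thesis
      by (simp add: add_divide_distrib)
  qed
  then have "norm (qpoch q (q powi (- int k) * z) m) \<le> (\<Prod>i<m. (1 + norm z) / norm q ^ (k - i))"
    unfolding qpoch_def prod_norm[symmetric] by (intro prod_mono) auto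
  also have "\<dots> = (1 + norm z) ^ m / norm q ^ (\<Sum>i<m. k - i)"
    by (simp add: prod_dividef power_sum)
  finally show ?thesis .
qed

text \<open>Only the first M factors can be large when |z| is of order |q|^(-M), which is the
  situation on the circle of integration. The exponent of 1 / |q| is 1 + ... + M = M (M + 1) /
  2.\<close>

lemma norm_qpoch_inf_growth:
  assumes "0 < norm q" "norm q < 1" "norm z * norm q ^ M \<le> B"
  shows "norm (qpoch_inf q z) \<le> (1 + B) ^ M / norm q ^ (\<Sum>i<M. M - i) * exp (B / (1 - norm q))"
proof -
  define z' where "z' = z * q ^ M"
  have z: "z = q powi (- int M) * z'"
    using assms by (auto simp: z'_def power_int_minus_of_nat)
  have z': "norm z' \<le> B"
    using assms by (simp add: z'_def norm_mult norm_power)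
  have B: "0 \<le> B"
    using z' norm_ge_zero order_trans by blast
  have "norm (qpoch q z M) \<le> (1 + norm z') ^ M / norm q ^ (\<Sum>i<M. M - i)"
    unfolding z by (rule norm_qpoch_neg_le[OF assms(1,2)])
  also have "\<dots> \<le> (1 + B) ^ M / norm q ^ (\<Sum>i<M. M - i)"
    using z' by (intro divide_right_mono power_mono) auto
  finally have "norm (qpoch q z M) \<le> (1 + B) ^ M / norm q ^ (\<Sum>i<M. M - i)" .
  moreover have "norm (qpoch_inf q (z * q ^ M)) \<le> exp (B / (1 - norm q))"
    using norm_qpoch_inf_le[OF assms(2), of z' B] z' by (simp add: z'_def)
  moreover have "0 \<le> (1 + B) ^ M / norm q ^ (\<Sum>i<M. M - i)"
    using B by simp
  ultimately show ?thesis
    unfolding qpoch_inf_split[OF assms(2), of z M] norm_mult by (intro mult_mono) auto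
qed

lemma norm_vdm_fun_upd_le:
  assumes r0: "r0 \<in> {1..n}" and y: "\<And>c. c \<in> {1..n} - {r0} \<Longrightarrow> norm (y c) \<le> X" and w: "X \<le> norm w" and X: "0 \<le> X"
  shows "norm (vdm n (y(r0 := w))) \<le> (2 * norm w) ^ (n - 1) * (2 * X + 1) ^ ((n - 1) * (n - 1))"
proof -
  let ?J = "{1..n} - {r0}"
  have card: "card ?J = n - 1"
    using r0 by simp
  have "norm (\<Prod>c\<in>?J. if r0 < c then y c - w else w - y c) \<le> (\<Prod>c\<in>?J. 2 * norm w)"
    unfolding prod_norm[symmetric]
  proof (intro prod_mono conjI norm_ge_zero)
    fix c assume "c \<in> ?J"
    then show "norm (if r0 < c then y c - w else w - y c) \<le> 2 * norm w"
      using y[of c] w norm_triangle_ineq4[of "y c" w] norm_triangle_ineq4[of w "y c"] by auto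
  qed
  moreover have "norm (\<Prod>r\<in>?J. \<Prod>s\<in>?J. if r < s then y s - y r else 1) \<le> (\<Prod>r\<in>?J. \<Prod>s\<in>?J. 2 * X + 1)"
    unfolding prod_norm[symmetric]
  proof (intro prod_mono conjI norm_ge_zero prod_nonneg)
    fix r s assume "r \<in> ?J" "s \<in> ?J"
    then show "norm (if r < s then y s - y r else 1) \<le> 2 * X + 1"
      using y[of r] y[of s] X norm_triangle_ineq4[of "y s" "y r"] by auto
  qed
  moreover have "(\<Prod>c\<in>?J. 2 * norm w) = (2 * norm w) ^ (n - 1)"
      "(\<Prod>r\<in>?J. \<Prod>s\<in>?J. 2 * X + 1) = (2 * X + 1) ^ ((n - 1) * (n - 1))"
    by (simp_all only: prod_constant card power_mult)
  ultimately show ?thesis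
    unfolding vdm_fun_upd[OF r0] norm_mult using X
    by (intro mult_mono) (simp_all only: norm_ge_zero zero_le_power mult_nonneg_nonneg zero_le_numeral)
qed

lemma sum_PiE_prod_le_suminf_power:
  fixes h :: "nat \<Rightarrow> real"
  assumes h: "summable h" "\<And>m. 0 \<le> h m" and J: "finite J"
  shows "(\<Sum>m\<in>(\<Pi>\<^sub>E r\<in>J. {0..k r}). \<Prod>r\<in>J. h (m r)) \<le> (\<Sum>m. h m) ^ card J"
proof -
  have "(\<Sum>m\<in>(\<Pi>\<^sub>E r\<in>J. {0..k r}). \<Prod>r\<in>J. h (m r)) = (\<Prod>r\<in>J. \<Sum>m=0..k r. h m)"
    using J by (simp add: prod_sum_PiE)
  also have "\<dots> \<le> (\<Prod>r\<in>J. \<Sum>m. h m)"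
    by (intro prod_mono conjI sum_nonneg sum_le_suminf h) (auto simp: h)
  finally show ?thesis
    by simp
qed

section \<open>The divided difference and the inner sum, uniformly in k\<close>

context An_params
begin

lemma x_sum_bound: "r \<in> {1..n} \<Longrightarrow> norm (x r) \<le> (\<Sum>r=1..n. norm (x r))"
  by (rule member_le_sum) auto

lemma x_sum_pos: "n \<ge> 1 \<Longrightarrow> (\<Sum>r=1..n. norm (x r)) > 0"
  using x_sum_bound[of 1] x_nonzero[of 1] by (simp add: order_less_le_trans[of 0 "norm (x 1)"])

lemma q_ratio_bounded_below:
  obtains \<delta> where "\<delta> > 0" "\<And>r s k. r \<in> {1..n} \<Longrightarrow> s \<in> {1..n} \<Longrightarrow> \<delta> \<le> norm (qpoch q (q * x r / x s) k)"
proof -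
  have "\<exists>c>0. \<forall>i\<in>{1..n} \<times> {1..n}. \<forall>k. c \<le> norm (qpoch q (q * x (fst i) / x (snd i)) k)"
  proof (rule finite_uniform_lower_bound)
    fix i assume i: "i \<in> {1..n} \<times> {1..n}"
    then have "\<And>k. qpoch q (q * x (fst i) / x (snd i)) k \<noteq> 0"
      using x_generic by auto
    from qpoch_bounded_below[OF q_less this]
    show "\<exists>c>0. \<forall>k. c \<le> norm (qpoch q (q * x (fst i) / x (snd i)) k)"
      by metis
  qed simp
  then show ?thesis
    using that by fastforce
qed

text \<open>The numerators (q^(-k_s) x_r / x_s)_m carry the whole growth in k. It is recorded as an
  exact exponent, because it has to be balanced against other quadratic exponents; the rest is C D^m
  with constants independent of k.\<close>

lemma dW_ratio_bound:
  obtains C D where "C \<ge> 1" "D \<ge> 1"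
    "\<And>k r m. r \<in> {1..n} \<Longrightarrow> m \<le> k r \<Longrightarrow>
      norm (dW k (x r) / dW k (x r * q ^ m)) \<le> C * D ^ m / norm q ^ (\<Sum>s=1..n. \<Sum>i<m. k s - i)"
proof -
  obtain \<delta> where \<delta>: "\<delta> > 0"
    "\<And>r s k. r \<in> {1..n} \<Longrightarrow> s \<in> {1..n} \<Longrightarrow> \<delta> \<le> norm (qpoch q (q * x r / x s) k)"
    using q_ratio_bounded_below by blast
  define R where "R = 1 + (\<Sum>r=1..n. \<Sum>s=1..n. norm (x r / x s))"
  have R: "1 + norm (x r / x s) \<le> R" if "r \<in> {1..n}" "s \<in> {1..n}" for r s
  proof -
    have "norm (x r / x s) \<le> (\<Sum>s=1..n. norm (x r / x s))"
      using that by (intro member_le_sum) auto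
    also have "\<dots> \<le> (\<Sum>r=1..n. \<Sum>s=1..n. norm (x r / x s))"
      using that by (intro member_le_sum[of r] sum_nonneg) auto
    finally show ?thesis
      by (simp add: R_def)
  qed
  have R1: "R \<ge> 1"
    unfolding R_def by (simp add: sum_nonneg)
  show ?thesis
  proof (rule that[of "max 1 (1 / \<delta> ^ n)" "R ^ n"])
    fix k :: "nat \<Rightarrow> nat" and r m assume r: "r \<in> {1..n}" and m: "m \<le> k r"
    have "norm (dW k (x r) / dW k (x r * q ^ m)) =
      norm q ^ m * (\<Prod>s=1..n. norm (qpoch q (q powi (- int (k s)) * x r / x s) m) / norm (qpoch q (q * x r / x s) m))"
      unfolding dW_ratio[of r m k, OF r m] by (simp add: norm_mult norm_power prod_norm[symmetric] norm_divide)
    also have "\<dots> \<le> 1 * (\<Prod>s=1..n. (R ^ m / norm q ^ (\<Sum>i<m. k s - i)) / \<delta>)"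
    proof (intro mult_mono prod_mono conjI frac_le prod_nonneg)
      show "norm q ^ m \<le> 1"
        using q_less by (simp add: power_le_one)
      fix s assume s: "s \<in> {1..n}"
      have "norm (qpoch q (q powi (- int (k s)) * x r / x s) m) \<le> (1 + norm (x r / x s)) ^ m / norm q ^ (\<Sum>i<m. k s - i)"
        using norm_qpoch_neg_le[OF q_pos q_less, of "k s" "x r / x s" m] by simp
      also have "\<dots> \<le> R ^ m / norm q ^ (\<Sum>i<m. k s - i)"
        using R[OF r s] by (intro divide_right_mono power_mono) auto
      finally show "norm (qpoch q (q powi (- int (k s)) * x r / x s) m) \<le> R ^ m / norm q ^ (\<Sum>i<m. k s - i)" .
      show "\<delta> \<le> norm (qpoch q (q * x r / x s) m)"
        using \<delta> r s by blast
    qed (use \<delta> R1 in auto)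
    also have "\<dots> = 1 / \<delta> ^ n * (R ^ n) ^ m / norm q ^ (\<Sum>s=1..n. \<Sum>i<m. k s - i)"
      by (simp add: prod_dividef prod.distrib power_sum power_mult[symmetric] mult.commute)
    also have "\<dots> \<le> max 1 (1 / \<delta> ^ n) * (R ^ n) ^ m / norm q ^ (\<Sum>s=1..n. \<Sum>i<m. k s - i)"
      using R1 by (intro divide_right_mono mult_right_mono) auto
    finally show "norm (dW k (x r) / dW k (x r * q ^ m)) \<le>
      max 1 (1 / \<delta> ^ n) * (R ^ n) ^ m / norm q ^ (\<Sum>s=1..n. \<Sum>i<m. k s - i)" .
  qed (use R1 in auto)
qed

text \<open>At x_r almost all of the |k| + n - 1 factors x_r - x_s q^i are close to x_r, so the
  product behaves like a power of x_r with that exponent.\<close>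

lemma dW_bound:
  obtains C where "C \<ge> 0" "\<And>k r. r \<in> {1..n} \<Longrightarrow> norm (dW k (x r)) \<le> C * norm (x r) ^ wt k"
proof -
  define A where "A = (\<lambda>r s. (norm (x r) + 1) * exp ((norm (x s) + norm (x r * q)) / (norm (x r) * (1 - norm q))))"
  have A0: "A r s \<ge> 0" for r s
    by (simp add: A_def)
  define C where "C = (\<Sum>r=1..n. \<Prod>s=1..n. A r s)"
  have main: "norm (dW k (x r)) \<le> C * norm (x r) ^ wt k" if r: "r \<in> {1..n}" for k r
  proof -
    have xr: "norm (x r) > 0"
      using x_nonzero[OF r] by simp
    have "norm (\<Prod>i\<in>{..k s} - (if s = r then {0} else {}). x r - x s * q ^ i) \<le> A r s * norm (x r) ^ k s"
      if "s \<in> {1..n}" for s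
    proof (cases "s = r")
      case True
      have "{..k r} - {0} = Suc ` {..<k r}"
        by (auto simp: image_iff) (metis Suc_le_lessD lessThan_iff old.nat.exhaust)
      then have "norm (\<Prod>i\<in>{..k s} - (if s = r then {0} else {}). x r - x s * q ^ i) =
         norm (\<Prod>i<k r. x r - x r * q * q ^ i)"
        using True by (simp add: prod.reindex mult_ac)
      also have "\<dots> \<le> norm (x r) ^ k r * exp ((norm (x s) + norm (x r * q)) / (norm (x r) * (1 - norm q)))"
        using xr q_less by (intro norm_prod_geometric_le) auto
      also have "\<dots> \<le> A r s * norm (x r) ^ k s"
        using True by (simp add: A_def algebra_simps)
      finally show ?thesis .
    next
      case False
      have "norm (\<Prod>i\<in>{..k s} - (if s = r then {0} else {}). x r - x s * q ^ i) =
         norm (\<Prod>i<Suc (k s). x r - x s * q ^ i)"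
        using False by (simp add: lessThan_Suc_atMost del: prod.lessThan_Suc)
      also have "\<dots> \<le> norm (x r) ^ Suc (k s) * exp ((norm (x s) + norm (x r * q)) / (norm (x r) * (1 - norm q)))"
        using xr q_less by (intro norm_prod_geometric_le) auto
      also have "\<dots> \<le> A r s * norm (x r) ^ k s"
        by (simp add: A_def algebra_simps)
      finally show ?thesis .
    qed
    then have "norm (dW k (x r)) \<le> (\<Prod>s=1..n. A r s * norm (x r) ^ k s)"
      using dW_eq[OF r, of 0 k] by (auto simp: prod_norm[symmetric] intro!: prod_mono prod_nonneg)
    also have "\<dots> = (\<Prod>s=1..n. A r s) * norm (x r) ^ wt k"
      by (simp add: prod.distrib power_sum)
    also have "\<dots> \<le> C * norm (x r) ^ wt k"
      unfolding C_def using r A0 by (intro mult_right_mono member_le_sum[of r] prod_nonneg) auto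
    finally show ?thesis .
  qed
  show ?thesis
    by (rule that[OF _ main]) (auto simp: C_def intro!: sum_nonneg prod_nonneg A0)
qed

text \<open>On chain s the product of the w - x_s q^i is w^(k_s + 1) times a q-factorial of x_s / w,
  whose argument lies in the disc of radius 1/2, where q-factorials are uniformly bounded
  below.\<close>

lemma norm_prod_nodes_ge:
  assumes \<delta>: "\<delta> > 0" "\<And>z k. norm z \<le> 1 / 2 \<Longrightarrow> \<delta> \<le> norm (qpoch q z k)"
    and w: "w \<noteq> 0" "\<And>s. s \<in> {1..n} \<Longrightarrow> 2 * norm (x s) \<le> norm w"
  shows "norm w ^ (wt k + n) * \<delta> ^ n \<le> norm (\<Prod>z\<in>nodes k. w - z)"
proof -
  have "(\<Prod>s=1..n. norm w ^ Suc (k s) * \<delta>) \<le> (\<Prod>s=1..n. norm (\<Prod>i=0..k s. w - x s * q ^ i))"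
  proof (intro prod_mono conjI)
    fix s assume s: "s \<in> {1..n}"
    have "(\<Prod>i=0..k s. w - x s * q ^ i) = (\<Prod>i<Suc (k s). w * (1 - x s / w * q ^ i))"
      using w by (intro prod.cong) (auto simp: field_simps)
    also have "\<dots> = w ^ Suc (k s) * qpoch q (x s / w) (Suc (k s))"
      by (simp only: prod.distrib qpoch_def prod_constant card_lessThan)
    finally have "norm (\<Prod>i=0..k s. w - x s * q ^ i) = norm w ^ Suc (k s) * norm (qpoch q (x s / w) (Suc (k s)))"
      by (simp add: norm_mult norm_power)
    moreover have "norm (x s / w) \<le> 1 / 2"
      using w(2)[OF s] w(1) by (simp add: norm_divide divide_simps)
    ultimately show "norm w ^ Suc (k s) * \<delta> \<le> norm (\<Prod>i=0..k s. w - x s * q ^ i)"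
      using \<delta>(2) by (simp add: mult_left_mono)
  qed (use \<delta> in auto)
  also have "(\<Prod>s=1..n. norm w ^ Suc (k s) * \<delta>) = norm w ^ (\<Sum>s=1..n. Suc (k s)) * \<delta> ^ n"
    by (simp add: prod.distrib power_sum del: power_Suc)
  also have "(\<Sum>s=1..n. Suc (k s)) = wt k + n"
    by (simp add: sum_Suc)
  finally show ?thesis
    by (simp add: prod_nodes prod_norm)
qed

text \<open>At y_r = x_r q^(m_r) the argument of \<open>p K\<close> is q^|m|. In this way the
  factors that depend on |m| become a function of the product of the y_r, and the whole is symmetric
  in the y_r.\<close>

definition sym_fun :: "(nat \<Rightarrow> complex \<Rightarrow> complex) \<Rightarrow> (complex \<Rightarrow> complex) \<Rightarrow> nat \<Rightarrow> (nat \<Rightarrow> complex) \<Rightarrow> complex" where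
  "sym_fun p G K y = (\<Prod>r=1..n. G (y r)) * p K ((\<Prod>r=1..n. y r) / (\<Prod>r=1..n. x r))"

text \<open>On the circle |w| = R the product over the nodes puts R^(K + n) into the denominator;
  the numerator receives R^(n - 1) from the Vandermonde product, R from the length of the contour
  and (\<sigma> R0 / |x_r0|)^K from \<open>p K\<close>. With R = R0 / |q|^M all powers of R cancel
  and |q|^(M K) remains as the gain. Its price is the growth of the numerator of G, which appears as
  the last denominator of the bound.\<close>

lemma divdiff_sym_fun_bound:
  fixes \<alpha> b :: complex and p :: "nat \<Rightarrow> complex \<Rightarrow> complex" and \<sigma> Cp :: real
  defines "G \<equiv> \<lambda>K y. qpoch_inf q (\<alpha> * b * y) / qpoch_inf q (\<alpha> * q ^ K * y)"
  assumes n: "n \<ge> 1" and \<sigma>: "\<sigma> > 0"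
    and p: "\<And>K. p K holomorphic_on UNIV" and Cp: "Cp \<ge> 0"
      "\<And>K z. 1 \<le> norm z \<Longrightarrow> 1 \<le> \<sigma> * norm z \<Longrightarrow> norm (p K z) \<le> Cp * real (Suc K) ^ 2 * (\<sigma> * norm z) ^ K"
  obtains C B j0 where "C \<ge> 0" "B \<ge> 0"
    "\<And>r j. r \<in> {1..n} \<Longrightarrow> j \<ge> j0 \<Longrightarrow> norm (\<alpha> * x r * q ^ j) \<le> 1 / 2"
    "\<And>k r0 m. r0 \<in> {1..n} \<Longrightarrow> j0 \<le> k r0 \<Longrightarrow> (\<And>r. r \<in> {1..n} - {r0} \<Longrightarrow> m r \<le> k r) \<Longrightarrow>
      norm (slot_divdiff k r0 m (sym_fun p (G (wt k)) (wt k))) \<le>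
      C * real (Suc (wt k)) ^ 2 * (1 + B) ^ (\<Sum>r\<in>{1..n} - {r0}. m r) * (\<sigma> / norm (x r0)) ^ wt k *
        (norm q ^ ((\<Sum>r\<in>{1..n} - {r0}. m r) * wt k) /
         norm q ^ (\<Sum>i<(\<Sum>r\<in>{1..n} - {r0}. m r). (\<Sum>r\<in>{1..n} - {r0}. m r) - i))"
proof -
  define X where "X = (\<Sum>r=1..n. norm (x r))"
  have X: "X > 0" "\<And>r. r \<in> {1..n} \<Longrightarrow> norm (x r) \<le> X"
    using x_sum_pos[OF n] x_sum_bound by (auto simp: X_def)
  \<comment> \<open>The term 2 X keeps every node within half the radius, and X / \<sigma> ensures
    \<sigma> R0 / |x_r0| \<ge> 1, as the growth bound on p requires.\<close>
  define R0 where "R0 = 2 * X + X / \<sigma>"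
  have R0: "R0 > 0" "2 * X \<le> R0" "X / \<sigma> \<le> R0"
    using X(1) \<sigma> by (auto simp: R0_def add_pos_pos)
  define B where "B = norm (\<alpha> * b) * R0"
  have B: "B \<ge> 0"
    using R0 by (simp add: B_def)
  have "(\<lambda>j. norm \<alpha> * R0 * norm q ^ j) \<longlonglongrightarrow> norm \<alpha> * R0 * 0"
    using q_less by (intro tendsto_intros LIMSEQ_power_zero) auto
  then have "\<forall>\<^sub>F j in sequentially. norm \<alpha> * R0 * norm q ^ j < 1 / 2"
    by (rule order_tendstoD) simp
  \<comment> \<open>For |w| \<le> R one has |\<alpha> q^K w| \<le> |\<alpha>| R0 |q|^(K - M), and K
    - M \<ge> k_r0. So k_r0 \<ge> j0 keeps the zeros of the denominator of G outside the
    disc.\<close>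
  then obtain j0 where j0: "\<And>j. j \<ge> j0 \<Longrightarrow> norm \<alpha> * R0 * norm q ^ j < 1 / 2"
    by (auto simp: eventually_sequentially)
  obtain \<delta>1 where \<delta>1: "\<delta>1 > 0" "\<And>z k. norm z \<le> 1 / 2 \<Longrightarrow> \<delta>1 \<le> norm (qpoch q z k)"
    using qpoch_bounded_below_uniform[OF q_less, of "1 / 2"] by auto
  obtain \<delta> where \<delta>: "\<delta> > 0" "\<And>z. norm z \<le> 1 / 2 \<Longrightarrow> \<delta> \<le> norm (qpoch_inf q z)"
    using qpoch_inf_bounded_below_uniform[OF q_less, of "1 / 2"] by auto
  define CG where "CG = exp (norm (\<alpha> * b) * X / (1 - norm q)) / \<delta>"
  define EB where "EB = exp (B / (1 - norm q)) / \<delta>"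
  define V where "V = (2 * X + 1) ^ ((n - 1) * (n - 1))"
  define C where "C = 2 ^ (n - 1) * V * CG ^ (n - 1) * EB * Cp / \<delta>1 ^ n"
  have small: "norm (\<alpha> * x r * q ^ j) \<le> 1 / 2" if "r \<in> {1..n}" "j \<ge> j0" for r j
  proof -
    have "norm (\<alpha> * x r * q ^ j) = norm \<alpha> * norm (x r) * norm q ^ j"
      by (simp add: norm_mult norm_power)
    also have "\<dots> \<le> norm \<alpha> * R0 * norm q ^ j"
      using X(2)[OF that(1)] R0 X(1) by (intro mult_right_mono mult_left_mono) auto
    finally show ?thesis
      using j0[OF that(2)] by simp
  qed
  have main: "norm (slot_divdiff k r0 m (sym_fun p (G (wt k)) (wt k))) \<le>
      C * real (Suc (wt k)) ^ 2 * (1 + B) ^ M * (\<sigma> / norm (x r0)) ^ wt k *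
        (norm q ^ (M * wt k) / norm q ^ (\<Sum>i<M. M - i))"
    if r0: "r0 \<in> {1..n}" and kj: "j0 \<le> k r0" and mk: "\<And>r. r \<in> {1..n} - {r0} \<Longrightarrow> m r \<le> k r"
      and M: "M = (\<Sum>r\<in>{1..n} - {r0}. m r)" for k r0 m M
  proof -
    define K where "K = wt k"
    define y where "y = (\<lambda>r. x r * q ^ m r)"
    define R where "R = R0 / norm q ^ M"
    have xr0: "x r0 \<noteq> 0"
      by (rule x_nonzero[OF r0])
    have qM: "norm q ^ M \<le> 1" "norm q ^ M > 0"
      using q_less q_pos by (auto intro: power_le_one)
    have R: "R0 \<le> R" "R > 0" "R * norm q ^ M = R0"
      using qM R0 by (auto simp: R_def divide_simps mult_left_le)
    have KM: "k r0 + M \<le> K"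
    proof -
      have "M \<le> (\<Sum>r\<in>{1..n} - {r0}. k r)"
        unfolding M by (rule sum_mono) (rule mk)
      then show ?thesis
        unfolding K_def using r0 by (simp add: sum.remove)
    qed
    have small_w: "norm (\<alpha> * q ^ K * w) \<le> 1 / 2" if "norm w \<le> R" for w
    proof -
      have "norm (\<alpha> * q ^ K * w) \<le> norm \<alpha> * norm q ^ K * R"
        using that by (simp add: norm_mult norm_power mult_left_mono)
      also have "norm q ^ K = norm q ^ (K - M) * norm q ^ M"
        using KM by (simp flip: power_add)
      also have "norm \<alpha> * (norm q ^ (K - M) * norm q ^ M) * R = norm \<alpha> * R0 * norm q ^ (K - M)"
        unfolding R(3)[symmetric] by (simp add: mult_ac)
      also have "\<dots> < 1 / 2"
        by (rule j0) (use KM kj in linarith)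
      finally show ?thesis
        by simp
    qed
    have y_le: "norm (y r) \<le> X" if "r \<in> {1..n}" for r
    proof -
      have "norm (y r) \<le> norm (x r) * 1"
        unfolding y_def norm_mult norm_power using q_less by (intro mult_left_mono power_le_one) auto
      then show ?thesis
        using X(2)[OF that] by simp
    qed
    have G_le: "norm (G K (y r)) \<le> CG" if "r \<in> {1..n}" for r
    proof -
      have "norm (y r) \<le> R"
        using y_le[OF that] R(1) R0(2) X(1) by linarith
      then have "\<delta> \<le> norm (qpoch_inf q (\<alpha> * q ^ K * y r))"
        by (intro \<delta> small_w)
      moreover have "norm (\<alpha> * b * y r) \<le> norm (\<alpha> * b) * X"
        using y_le[OF that] by (simp add: norm_mult mult_left_mono)
      then have "norm (qpoch_inf q (\<alpha> * b * y r)) \<le> exp (norm (\<alpha> * b) * X / (1 - norm q))"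
        by (rule norm_qpoch_inf_le[OF q_less])
      ultimately show ?thesis
        unfolding G_def CG_def norm_divide using \<delta>(1) by (intro frac_le) auto
    qed
    have Gw: "norm (G K w) \<le> (1 + B) ^ M / norm q ^ (\<Sum>i<M. M - i) * EB" if "norm w = R" for w
    proof -
      have "norm (\<alpha> * b * w) * norm q ^ M \<le> B"
        unfolding B_def R(3)[symmetric] using that by (simp add: norm_mult mult_ac)
      then have "norm (qpoch_inf q (\<alpha> * b * w)) \<le> (1 + B) ^ M / norm q ^ (\<Sum>i<M. M - i) * exp (B / (1 - norm q))"
        by (rule norm_qpoch_inf_growth[OF q_pos q_less])
      moreover have "\<delta> \<le> norm (qpoch_inf q (\<alpha> * q ^ K * w))"
        using that by (intro \<delta> small_w) simp
      ultimately have "norm (G K w) \<le> ((1 + B) ^ M / norm q ^ (\<Sum>i<M. M - i) * exp (B / (1 - norm q))) / \<delta>"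
        unfolding G_def norm_divide using \<delta>(1) B by (intro frac_le) auto
      then show ?thesis
        by (simp add: EB_def)
    qed
    \<comment> \<open>When slot r0 holds w, the product of the y_r divided by that of the x_r is q^M
      w / x_r0; its modulus on |w| = R is R0 / |x_r0|, independent of M.\<close>
    define f where "f = (\<lambda>w. vdm n (y(r0 := w)) * ((\<Prod>r\<in>{1..n} - {r0}. G K (y r)) * (G K w * p K (q ^ M / x r0 * w))))"
    have f_eq: "vdm n (y(r0 := w)) * sym_fun p (G K) K (y(r0 := w)) = f w" for w
    proof -
      have 1: "(\<Prod>r=1..n. (y(r0 := w)) r) = w * (\<Prod>r\<in>{1..n} - {r0}. y r)"
        using r0 by (simp add: prod.remove[of _ r0])
      have 2: "(\<Prod>r\<in>{1..n} - {r0}. y r) = (\<Prod>r\<in>{1..n} - {r0}. x r) * q ^ M"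
        by (simp add: y_def prod.distrib M power_sum)
      have 3: "(\<Prod>r=1..n. x r) = x r0 * (\<Prod>r\<in>{1..n} - {r0}. x r)"
        using r0 by (simp add: prod.remove[of _ r0])
      have "(\<Prod>r\<in>{1..n} - {r0}. x r) \<noteq> 0"
        using x_nonzero by (simp add: prod_zero_iff)
      then have "(\<Prod>r=1..n. (y(r0 := w)) r) / (\<Prod>r=1..n. x r) = q ^ M / x r0 * w"
        unfolding 1 2 3 using xr0 by simp
      moreover have "(\<Prod>r=1..n. G K ((y(r0 := w)) r)) = G K w * (\<Prod>r\<in>{1..n} - {r0}. G K (y r))"
        using r0 by (simp add: prod.remove[of _ r0])
      ultimately show ?thesis
        by (simp add: sym_fun_def f_def mult_ac)
    qed
    obtain v where v: "\<And>w. vdm n (y(r0 := w)) = poly v w"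
      using vdm_fun_upd_poly[OF r0, of y] by metis
    have hol: "f holomorphic_on cball 0 R"
      unfolding f_def v G_def
    proof (intro holomorphic_intros q_less)
      show "qpoch_inf q (\<alpha> * q ^ K * w) \<noteq> 0" if "w \<in> cball 0 R" for w
        using \<delta>(2)[OF small_w[of w]] \<delta>(1) that by auto
      have "(p K \<circ> (\<lambda>w. q ^ M / x r0 * w)) holomorphic_on cball 0 R"
        by (rule holomorphic_on_compose_gen[OF _ p]) (auto intro!: holomorphic_intros)
      then show "(\<lambda>w. p K (q ^ M / x r0 * w)) holomorphic_on cball 0 R"
        by (simp add: o_def)
    qed
    define Bf where "Bf = (2 * R) ^ (n - 1) * V * (CG ^ (n - 1) * ((1 + B) ^ M / norm q ^ (\<Sum>i<M. M - i) * EB *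
       (Cp * real (Suc K) ^ 2 * (\<sigma> * (R0 / norm (x r0))) ^ K)))"
    have "norm (divdiff (nodes k) f) \<le> R * Bf / (R ^ (K + n) * \<delta>1 ^ n)"
    proof (rule divdiff_bound[OF finite_nodes _ _ hol])
      show "nodes k \<noteq> {}"
        using card_nodes[of k] n by auto
      show "norm z < R" if "z \<in> nodes k" for z
      proof -
        obtain s i where s: "s \<in> {1..n}" "z = x s * q ^ i"
          using \<open>z \<in> nodes k\<close> unfolding nodes_def chain_def by blast
        have "norm z \<le> norm (x s) * 1"
          unfolding s norm_mult norm_power using q_less by (intro mult_left_mono power_le_one) auto
        then show ?thesis
          using X(2)[OF s(1)] X(1) R(1) R0(2) by linarith
      qed
      show "norm (f w) \<le> Bf" if w: "norm w = R" for w
      proof -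
        have "norm (vdm n (y(r0 := w))) \<le> (2 * R) ^ (n - 1) * V"
          unfolding V_def w[symmetric] using y_le w R(1) R0(2) X(1) by (intro norm_vdm_fun_upd_le[OF r0]) auto
        moreover have "norm (\<Prod>r\<in>{1..n} - {r0}. G K (y r)) \<le> CG ^ (n - 1)"
        proof -
          have "norm (\<Prod>r\<in>{1..n} - {r0}. G K (y r)) \<le> (\<Prod>r\<in>{1..n} - {r0}. CG)"
            unfolding prod_norm[symmetric] using G_le by (intro prod_mono) auto
          then show ?thesis
            using r0 by simp
        qed
        moreover have "norm (p K (q ^ M / x r0 * w)) \<le> Cp * real (Suc K) ^ 2 * (\<sigma> * (R0 / norm (x r0))) ^ K"
        proof -
          have z: "norm (q ^ M / x r0 * w) = R0 / norm (x r0)"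
            unfolding R(3)[symmetric] using w by (simp add: norm_mult norm_divide norm_power)
          have "norm (x r0) \<le> R0" "norm (x r0) / \<sigma> \<le> R0"
            using X(2)[OF r0] X(1) R0 \<sigma> divide_right_mono[of "norm (x r0)" X \<sigma>] by linarith+
          then have "1 \<le> R0 / norm (x r0)" "1 \<le> \<sigma> * (R0 / norm (x r0))"
            using xr0 \<sigma> by (auto simp: field_simps)
          then show ?thesis
            using Cp(2)[of "q ^ M / x r0 * w" K] unfolding z by blast
        qed
        ultimately show ?thesis
          unfolding f_def Bf_def norm_mult
          using Gw[OF w] X(1) R(2) B \<delta>(1) Cp(1) \<sigma> R0(1)
          by (intro mult_mono) (auto simp: V_def CG_def EB_def)
      qed
      show "R ^ (K + n) * \<delta>1 ^ n \<le> norm (\<Prod>z\<in>nodes k. w - z)" if w: "norm w = R" for w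
        unfolding K_def w[symmetric]
      proof (rule norm_prod_nodes_ge[OF \<delta>1])
        show "w \<noteq> 0"
          using w R(2) by auto
        show "2 * norm (x s) \<le> norm w" if "s \<in> {1..n}" for s
          using X(2)[OF that] R(1) R0(2) w by linarith
      qed
      show "R ^ (K + n) * \<delta>1 ^ n > 0" "R > 0"
        using R(2) \<delta>1(1) by auto
    qed
    also have "R * Bf / (R ^ (K + n) * \<delta>1 ^ n) =
       C * real (Suc K) ^ 2 * (1 + B) ^ M * (\<sigma> / norm (x r0)) ^ K * (norm q ^ (M * K) / norm q ^ (\<Sum>i<M. M - i))"
    proof -
      have Rn: "R * R ^ (n - 1) = R ^ n"
        using n by (simp flip: power_Suc)
      have "R0 ^ K = R ^ K * norm q ^ (M * K)"
        unfolding R(3)[symmetric] by (simp add: power_mult_distrib power_mult)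
      then have e: "(\<sigma> * (R0 / norm (x r0))) ^ K = R ^ K * norm q ^ (M * K) * (\<sigma> / norm (x r0)) ^ K"
        by (simp add: power_mult_distrib power_divide)
      have "R * Bf = R * R ^ (n - 1) * R ^ K * (2 ^ (n - 1) * V * CG ^ (n - 1) * EB * Cp) * (real (Suc K) ^ 2 * (1 + B) ^ M *
         (\<sigma> / norm (x r0)) ^ K * (norm q ^ (M * K) / norm q ^ (\<Sum>i<M. M - i)))"
        unfolding Bf_def e power_mult_distrib[of 2 R] by (simp add: mult_ac)
      also have "\<dots> = R ^ (K + n) * (2 ^ (n - 1) * V * CG ^ (n - 1) * EB * Cp) * (real (Suc K) ^ 2 * (1 + B) ^ M *
         (\<sigma> / norm (x r0)) ^ K * (norm q ^ (M * K) / norm q ^ (\<Sum>i<M. M - i)))"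
        unfolding Rn by (simp add: power_add mult_ac)
      finally show ?thesis
        using R(2) by (simp add: C_def mult_ac)
    qed
    finally show ?thesis
      unfolding f_eq[symmetric] y_def K_def .
  qed
  have C: "C \<ge> 0"
    using X(1) \<delta>(1) \<delta>1(1) Cp(1) by (simp add: C_def V_def CG_def EB_def)
  show ?thesis
    by (rule that[OF C B small]) (use main in blast)+
qed

text \<open>The sequence put for g in the terminating expansion. Here u and v stand for
  \<alpha>\<beta> and \<alpha>\<gamma>, and b, c, d for \<alpha> times the parameters of these
  names.\<close>

definition inner_coeff :: "complex \<Rightarrow> complex \<Rightarrow> complex \<Rightarrow> complex \<Rightarrow> complex \<Rightarrow> (nat \<Rightarrow> nat) \<Rightarrow> complex" where
  "inner_coeff b u v c d m = (\<Prod>r=1..n. 1 / qpoch q (b * x r) (m r)) *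
     (qpoch q u (wt m) * qpoch q v (wt m) / (qpoch q c (wt m) * qpoch q d (wt m)))"

abbreviation inner_sum :: "complex \<Rightarrow> complex \<Rightarrow> complex \<Rightarrow> complex \<Rightarrow> complex \<Rightarrow> complex \<Rightarrow> (nat \<Rightarrow> nat) \<Rightarrow> complex" where
  "inner_sum \<alpha> b u v c d k \<equiv> \<Sum>m\<in>box k. inner_kernel \<alpha> k m * inner_coeff (\<alpha> * b) u v c d m"

text \<open>The free slot r0 is the one with the largest k_r. The powers of |q| from the weights,
  the circle and G then combine, by \<open>gaussian_exponent_le\<close>, to a quantity summable over
  the other m_r uniformly in k. The factor |x_r0|^K from the bound of W'(x_r0) cancels against
  (\<sigma> / |x_r0|)^K, so that \<sigma>^K remains.\<close>

lemma inner_sum_bound_large: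
  assumes n: "n \<ge> 1" and \<sigma>: "norm u < \<sigma>" "norm v < \<sigma>"
    and c: "\<And>k. qpoch q c k \<noteq> 0" and d: "\<And>k. qpoch q d k \<noteq> 0"
    and b: "\<And>r k. r \<in> {1..n} \<Longrightarrow> qpoch q (\<alpha> * b * x r) k \<noteq> 0"
  obtains C j0 where "C \<ge> 0"
    "\<And>k. n * j0 \<le> wt k \<Longrightarrow> norm (inner_sum \<alpha> b u v c d k)
       \<le> C * real (Suc (wt k)) ^ 2 * \<sigma> ^ wt k"
proof -
  have \<sigma>0: "\<sigma> > 0"
    using \<sigma> norm_ge_zero[of u] by linarith
  obtain p Cp where p: "\<And>K. p K holomorphic_on UNIV"
      "\<And>K M. M \<le> K \<Longrightarrow> p K (q ^ M) = qpoch q u M * qpoch q v M / (qpoch q c M * qpoch q d M)"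
    and Cp: "Cp \<ge> 0"
      "\<And>K z. 1 \<le> norm z \<Longrightarrow> 1 \<le> \<sigma> * norm z \<Longrightarrow> norm (p K z) \<le> Cp * real (Suc K) ^ 2 * (\<sigma> * norm z) ^ K"
    using qpoch_quotient_interpolation[OF q_pos q_less c d \<sigma>] by blast
  define G where "G = (\<lambda>K y. qpoch_inf q (\<alpha> * b * y) / qpoch_inf q (\<alpha> * q ^ K * y))"
  obtain C1 B j0 where C1: "C1 \<ge> 0" and B: "B \<ge> 0"
    and small: "\<And>r j. r \<in> {1..n} \<Longrightarrow> j \<ge> j0 \<Longrightarrow> norm (\<alpha> * x r * q ^ j) \<le> 1 / 2"
    and dd: "\<And>k r0 m. r0 \<in> {1..n} \<Longrightarrow> j0 \<le> k r0 \<Longrightarrow> (\<And>r. r \<in> {1..n} - {r0} \<Longrightarrow> m r \<le> k r) \<Longrightarrow>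
      norm (slot_divdiff k r0 m (sym_fun p (G (wt k)) (wt k))) \<le>
      C1 * real (Suc (wt k)) ^ 2 * (1 + B) ^ (\<Sum>r\<in>{1..n} - {r0}. m r) * (\<sigma> / norm (x r0)) ^ wt k *
        (norm q ^ ((\<Sum>r\<in>{1..n} - {r0}. m r) * wt k) /
         norm q ^ (\<Sum>i<(\<Sum>r\<in>{1..n} - {r0}. m r). (\<Sum>r\<in>{1..n} - {r0}. m r) - i))"
    using divdiff_sym_fun_bound[of \<sigma> p Cp \<alpha> b, OF n \<sigma>0 p(1) Cp] unfolding G_def by blast
  obtain C2 D where C2: "C2 \<ge> 1" and D: "D \<ge> 1" and ratio:
    "\<And>k r m. r \<in> {1..n} \<Longrightarrow> m \<le> k r \<Longrightarrow>
      norm (dW k (x r) / dW k (x r * q ^ m)) \<le> C2 * D ^ m / norm q ^ (\<Sum>s=1..n. \<Sum>i<m. k s - i)"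
    using dW_ratio_bound by blast
  obtain C3 where C3: "C3 \<ge> 0" "\<And>k r. r \<in> {1..n} \<Longrightarrow> norm (dW k (x r)) \<le> C3 * norm (x r) ^ wt k"
    using dW_bound by blast
  \<comment> \<open>A square root, because \<open>gaussian_exponent_le\<close> compares doubled
    exponents.\<close>
  define \<kappa> where "\<kappa> = sqrt (norm q)"
  have \<kappa>: "0 < \<kappa>" "\<kappa> < 1" "\<kappa> ^ 2 = norm q"
    using q_pos q_less by (auto simp: \<kappa>_def)
  have q\<kappa>: "norm q ^ e = \<kappa> ^ (2 * e)" for e
    unfolding power_mult \<kappa>(3) ..
  \<comment> \<open>The share of one slot: the denominator \<kappa>^n stems from the linear term of
    the exponent inequality, D from the ratio of the weights and 1 + B from the growth of G.\<close>
  define h where "h = (\<lambda>m. (D * (1 + B) / \<kappa> ^ n) ^ m * \<kappa> ^ (m * (m - 1)))"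
  have h0: "0 \<le> h m" for m
    using D B \<kappa> by (simp add: h_def)
  have hs: "summable h"
    unfolding h_def by (rule summable_gaussian) (use D B \<kappa> in auto)
  define E where "E = (\<Prod>r=1..n. exp (1 / (1 - norm q)) / norm (qpoch_inf q (\<alpha> * b * x r)))"
  have b_inf: "qpoch_inf q (\<alpha> * b * x r) \<noteq> 0" if "r \<in> {1..n}" for r
    using b[OF that] qpoch_inf_nonzero_iff[OF q_less] by blast
  define C where "C = E * (C3 / norm (vdm n x)) * (C2 ^ (n - 1) * C1) * (\<Sum>m. h m) ^ (n - 1)"
  have E0: "E \<ge> 0"
    unfolding E_def by (intro prod_nonneg) auto
  have "C \<ge> 0"
    using E0 C1 C2 C3 h0 by (simp add: C_def suminf_nonneg hs)
  moreover have "norm (inner_sum \<alpha> b u v c d k)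
       \<le> C * real (Suc (wt k)) ^ 2 * \<sigma> ^ wt k" if large: "n * j0 \<le> wt k" for k
  proof -
    define K where "K = wt k"
    obtain r0 where r0: "r0 \<in> {1..n}" and max: "\<And>r. r \<in> {1..n} \<Longrightarrow> k r \<le> k r0"
    proof -
      have "Max (k ` {1..n}) \<in> k ` {1..n}"
        using n by (intro Max_in) auto
      then obtain r where "r \<in> {1..n}" "k r = Max (k ` {1..n})"
        by (metis imageE)
      then show ?thesis
        by (intro that[of r]) auto
    qed
    \<comment> \<open>The largest entry is at least the mean, so |k| \<ge> n j0 forces k_r0 \<ge>
      j0.\<close>
    have kj: "j0 \<le> k r0"
    proof -
      have "wt k \<le> n * k r0"
        using sum_bounded_above[of "{1..n}" k "k r0"] max by simp
      with large have "n * j0 \<le> n * k r0"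
        by linarith
      then show ?thesis
        using n by simp
    qed
    have jK: "j0 \<le> K"
      using kj member_le_sum[of r0 "{1..n}" k] r0 by (simp add: K_def)
    let ?J = "{1..n} - {r0}"
    let ?y = "\<lambda>m r. x r * q ^ m r"
    have Gx: "norm (1 / G K (x r)) \<le> exp (1 / (1 - norm q)) / norm (qpoch_inf q (\<alpha> * b * x r))"
      and Gx0: "qpoch_inf q (\<alpha> * q ^ K * x r) \<noteq> 0" if r: "r \<in> {1..n}" for r
    proof -
      have le: "norm (\<alpha> * q ^ K * x r) \<le> 1 / 2"
        using small[OF r jK] by (simp add: mult_ac)
      then show "qpoch_inf q (\<alpha> * q ^ K * x r) \<noteq> 0"
        by (intro qpoch_inf_nonzero[OF q_less]) simp
      have "norm (qpoch_inf q (\<alpha> * q ^ K * x r)) \<le> exp (1 / (1 - norm q))"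
        using le by (intro norm_qpoch_inf_le[OF q_less]) simp
      then show "norm (1 / G K (x r)) \<le> exp (1 / (1 - norm q)) / norm (qpoch_inf q (\<alpha> * b * x r))"
        by (simp add: G_def norm_divide divide_right_mono)
    qed
    \<comment> \<open>Quotients of q-factorials of length m_r become quotients of infinite products
      at y_r = x_r q^(m_r), normalised by their values at x_r. Thus the factors beside the weight
      become the symmetric function of the nodes, times a constant free of m.\<close>
    have summand: "inner_kernel \<alpha> k m * inner_coeff (\<alpha> * b) u v c d m =
        (\<Prod>r=1..n. 1 / G K (x r)) * (inner_weight k m * sym_fun p (G K) K (?y m))" if m: "m \<in> box k" for m
    proof -
      have f: "qpoch q (\<alpha> * x r * q ^ K) (m r) * (1 / qpoch q (\<alpha> * b * x r) (m r)) = 1 / G K (x r) * G K (?y m r)"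
        if r: "r \<in> {1..n}" for r
      proof -
        have 1: "qpoch_inf q (\<alpha> * b * x r) = qpoch q (\<alpha> * b * x r) (m r) * qpoch_inf q (\<alpha> * b * ?y m r)"
          using qpoch_inf_split[OF q_less, of "\<alpha> * b * x r" "m r"] by (simp add: mult_ac)
        have 2: "qpoch_inf q (\<alpha> * q ^ K * x r) = qpoch q (\<alpha> * x r * q ^ K) (m r) * qpoch_inf q (\<alpha> * q ^ K * ?y m r)"
          using qpoch_inf_split[OF q_less, of "\<alpha> * q ^ K * x r" "m r"] by (simp add: mult_ac)
        show ?thesis
          using b_inf[OF r] Gx0[OF r] unfolding G_def 1 2 by simp
      qed
      have "(\<Prod>r=1..n. qpoch q (\<alpha> * x r * q ^ K) (m r)) * (\<Prod>r=1..n. 1 / qpoch q (\<alpha> * b * x r) (m r)) =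
          (\<Prod>r=1..n. 1 / G K (x r)) * (\<Prod>r=1..n. G K (?y m r))"
        unfolding prod.distrib[symmetric] by (intro prod.cong refl f)
      moreover have "qpoch q u (wt m) * qpoch q v (wt m) / (qpoch q c (wt m) * qpoch q d (wt m)) =
          p K ((\<Prod>r=1..n. ?y m r) / (\<Prod>r=1..n. x r))"
      proof -
        have "(\<Prod>r=1..n. ?y m r) / (\<Prod>r=1..n. x r) = q ^ wt m"
          using x_nonzero by (simp add: prod.distrib power_sum prod_zero_iff)
        moreover have "wt m \<le> K"
          unfolding K_def by (rule wt_box[OF m])
        ultimately show ?thesis
          using p(2) by simp
      qed
      ultimately show ?thesis
        unfolding inner_kernel_def inner_coeff_def sym_fun_def K_def[symmetric] by (simp only: mult_ac)
          (simp only: mult.assoc[symmetric])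
    qed
    have M_ineq: "(\<Prod>r\<in>?J. norm (dW k (x r) / dW k (?y m r))) *
        norm (slot_divdiff k r0 m (sym_fun p (G K) K)) \<le>
        C2 ^ (n - 1) * C1 * real (Suc K) ^ 2 * (\<sigma> / norm (x r0)) ^ K * (\<Prod>r\<in>?J. h (m r))"
      if m: "m \<in> (\<Pi>\<^sub>E r\<in>?J. {0..k r})" for m
    proof -
      define M where "M = (\<Sum>r\<in>?J. m r)"
      define S where "S = (\<Sum>r\<in>?J. \<Sum>s=1..n. \<Sum>i<m r. k s - i)"
      define T where "T = (\<Sum>i<M. M - i)"
      define Gs where "Gs = (\<Sum>r\<in>?J. m r * (m r - 1))"
      have mk: "m r \<le> k r" if "r \<in> ?J" for r
        using m that by (auto simp: PiE_iff)
      have T2: "2 * T = M * (M + 1)"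
      proof -
        have "T = (\<Sum>i<M. Suc i)"
          unfolding T_def by (rule sum.nat_diff_reindex[of "\<lambda>i. Suc i", symmetric, THEN trans, symmetric]) (auto intro!: sum.cong)
        moreover have "2 * (\<Sum>i<j. Suc i) = j * (j + 1)" for j
          by (induction j) auto
        ultimately show ?thesis
          by simp
      qed
      have R: "(\<Prod>r\<in>?J. norm (dW k (x r) / dW k (?y m r))) \<le> C2 ^ (n - 1) * D ^ M / norm q ^ S"
      proof -
        have "(\<Prod>r\<in>?J. norm (dW k (x r) / dW k (?y m r))) \<le>
           (\<Prod>r\<in>?J. C2 * D ^ m r / norm q ^ (\<Sum>s=1..n. \<Sum>i<m r. k s - i))"
          using ratio mk by (intro prod_mono) auto
        also have "\<dots> = C2 ^ card ?J * D ^ M / norm q ^ S"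
          by (simp only: prod_dividef prod.distrib prod_constant power_sum M_def S_def)
        finally show ?thesis
          using r0 by simp
      qed
      have insI: "insert r0 ?J = {1..n}"
        using r0 by auto
      have "M * (M + 1) + 2 * S + Gs \<le> 2 * (M * K) + n * M"
        using gaussian_exponent_le[of ?J r0 m k] mk max
        unfolding M_def S_def Gs_def K_def insI by simp
      then have "\<kappa> ^ (2 * (M * K) + n * M) \<le> \<kappa> ^ (M * (M + 1) + 2 * S + Gs)"
        using \<kappa> by (intro power_decreasing) auto
      then have "norm q ^ (M * K) * \<kappa> ^ (n * M) \<le> norm q ^ T * norm q ^ S * \<kappa> ^ Gs"
        unfolding q\<kappa> T2 by (simp add: power_add)
      then have key: "norm q ^ (M * K) / (norm q ^ T * norm q ^ S) \<le> \<kappa> ^ Gs / (\<kappa> ^ n) ^ M"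
        using \<kappa> q_pos by (simp add: divide_simps power_mult[symmetric] mult_ac)
      have hprod: "(\<Prod>r\<in>?J. h (m r)) = (D * (1 + B)) ^ M * (\<kappa> ^ Gs / (\<kappa> ^ n) ^ M)"
        by (simp add: h_def prod.distrib prod_dividef power_sum M_def Gs_def power_divide)
      have "(\<Prod>r\<in>?J. norm (dW k (x r) / dW k (?y m r))) *
        norm (slot_divdiff k r0 m (sym_fun p (G K) K)) \<le>
        (C2 ^ (n - 1) * D ^ M / norm q ^ S) *
        (C1 * real (Suc K) ^ 2 * (1 + B) ^ M * (\<sigma> / norm (x r0)) ^ K * (norm q ^ (M * K) / norm q ^ T))"
        using dd[of r0 k m, OF r0 kj mk] R C2 D
        by (intro mult_mono) (auto simp: K_def M_def T_def intro!: divide_nonneg_nonneg)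
      also have "\<dots> = C2 ^ (n - 1) * C1 * real (Suc K) ^ 2 * (\<sigma> / norm (x r0)) ^ K * ((D * (1 + B)) ^ M *
         (norm q ^ (M * K) / (norm q ^ T * norm q ^ S)))"
        by (simp add: power_mult_distrib mult_ac)
      also have "\<dots> \<le> C2 ^ (n - 1) * C1 * real (Suc K) ^ 2 * (\<sigma> / norm (x r0)) ^ K * ((D * (1 + B)) ^ M *
         (\<kappa> ^ Gs / (\<kappa> ^ n) ^ M))"
        using C1 C2 D B \<sigma>0 by (intro mult_left_mono key) auto
      finally show ?thesis
        unfolding hprod .
    qed
    have symm: "sym_fun p (G K) K (y \<circ> Transposition.transpose r0 s) = sym_fun p (G K) K y"
      if "s \<in> {1..n}" for s y
    proof -
      have bij: "bij_betw (Transposition.transpose r0 s) {1..n} {1..n}"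
        using that r0 by simp
      show ?thesis
        using prod.reindex_bij_betw[OF bij, of "\<lambda>i. G K (y i)"] prod.reindex_bij_betw[OF bij, of y]
        by (simp add: sym_fun_def)
    qed
    have vcong: "sym_fun p (G K) K y = sym_fun p (G K) K y'" if "\<And>r. r \<in> {1..n} \<Longrightarrow> y r = y' r" for y y'
      using that by (simp add: sym_fun_def)
    have "(inner_sum \<alpha> b u v c d k) =
       (\<Prod>r=1..n. 1 / G K (x r)) * (\<Sum>m\<in>box k. inner_weight k m * sym_fun p (G K) K (?y m))"
      unfolding sum_distrib_left by (rule sum.cong[OF refl summand])
    also have "(\<Sum>m\<in>box k. inner_weight k m * sym_fun p (G K) K (?y m)) = dW k (x r0) / vdm n x *
      (\<Sum>m\<in>(\<Pi>\<^sub>E r\<in>?J. {0..k r}). (\<Prod>r\<in>?J. dW k (x r) / dW k (?y m r)) *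
       slot_divdiff k r0 m (sym_fun p (G K) K))"
      by (rule inner_sum_eq[OF r0 symm vcong])
    finally have "norm (inner_sum \<alpha> b u v c d k) =
      (\<Prod>r=1..n. norm (1 / G K (x r))) * (norm (dW k (x r0)) / norm (vdm n x) *
      norm (\<Sum>m\<in>(\<Pi>\<^sub>E r\<in>?J. {0..k r}). (\<Prod>r\<in>?J. dW k (x r) / dW k (?y m r)) *
       slot_divdiff k r0 m (sym_fun p (G K) K)))"
      by (simp only: norm_mult norm_divide prod_norm[symmetric])
    also have "\<dots> \<le> E * (C3 * norm (x r0) ^ K / norm (vdm n x) *
       (C2 ^ (n - 1) * C1 * real (Suc K) ^ 2 * (\<sigma> / norm (x r0)) ^ K * (\<Sum>m. h m) ^ (n - 1)))"
    proof (intro mult_mono divide_right_mono)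
      show "(\<Prod>r=1..n. norm (1 / G K (x r))) \<le> E"
        unfolding E_def by (intro prod_mono conjI Gx) auto
      show "norm (dW k (x r0)) \<le> C3 * norm (x r0) ^ K"
        unfolding K_def by (rule C3(2)[OF r0])
      have "norm (\<Sum>m\<in>(\<Pi>\<^sub>E r\<in>?J. {0..k r}). (\<Prod>r\<in>?J. dW k (x r) / dW k (?y m r)) *
         slot_divdiff k r0 m (sym_fun p (G K) K)) \<le>
        (\<Sum>m\<in>(\<Pi>\<^sub>E r\<in>?J. {0..k r}). norm ((\<Prod>r\<in>?J. dW k (x r) / dW k (?y m r)) *
         slot_divdiff k r0 m (sym_fun p (G K) K)))"
        by (rule norm_sum)
      also have "\<dots> \<le> (\<Sum>m\<in>(\<Pi>\<^sub>E r\<in>?J. {0..k r}).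
          C2 ^ (n - 1) * C1 * real (Suc K) ^ 2 * (\<sigma> / norm (x r0)) ^ K * (\<Prod>r\<in>?J. h (m r)))"
        unfolding norm_mult prod_norm[symmetric] by (rule sum_mono) (rule M_ineq)
      also have "\<dots> \<le> C2 ^ (n - 1) * C1 * real (Suc K) ^ 2 * (\<sigma> / norm (x r0)) ^ K * (\<Sum>m. h m) ^ card ?J"
        unfolding sum_distrib_left[symmetric] using C1 C2 \<sigma>0
        by (intro mult_left_mono sum_PiE_prod_le_suminf_power hs h0) auto
      finally show "norm (\<Sum>m\<in>(\<Pi>\<^sub>E r\<in>?J. {0..k r}). (\<Prod>r\<in>?J. dW k (x r) / dW k (?y m r)) *
         slot_divdiff k r0 m (sym_fun p (G K) K)) \<le>
         C2 ^ (n - 1) * C1 * real (Suc K) ^ 2 * (\<sigma> / norm (x r0)) ^ K * (\<Sum>m. h m) ^ (n - 1)"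
        using r0 by simp
    qed (use E0 C3(1) in auto)
    also have "\<dots> = C * real (Suc K) ^ 2 * \<sigma> ^ K"
    proof -
      have "\<sigma> ^ K = norm (x r0) ^ K * (\<sigma> / norm (x r0)) ^ K"
        using x_nonzero[OF r0] by (simp add: power_divide)
      then show ?thesis
        by (simp only: C_def divide_inverse mult_ac)
    qed
    finally show ?thesis
      by (simp only: K_def)
  qed
  ultimately show ?thesis
    by (rule that)
qed

text \<open>An intermediate \<sigma>1 < \<sigma> absorbs the factor (|k| + 1)^2, and the finitely
  many k with |k| < n j0 are covered by enlarging the constant.\<close>

lemma inner_sum_bound:
  assumes n: "n \<ge> 1" and \<sigma>: "norm u < \<sigma>" "norm v < \<sigma>"
    and c: "\<And>k. qpoch q c k \<noteq> 0" and d: "\<And>k. qpoch q d k \<noteq> 0"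
    and b: "\<And>r k. r \<in> {1..n} \<Longrightarrow> qpoch q (\<alpha> * b * x r) k \<noteq> 0"
  obtains C where "C \<ge> 0"
    "\<And>k. k \<in> multi \<Longrightarrow>
      norm (inner_sum \<alpha> b u v c d k) \<le> C * \<sigma> ^ wt k"
proof -
  define \<sigma>1 where "\<sigma>1 = (max (norm u) (norm v) + \<sigma>) / 2"
  have \<sigma>1: "norm u < \<sigma>1" "norm v < \<sigma>1" "\<sigma>1 < \<sigma>"
    using \<sigma> by (auto simp: \<sigma>1_def)
  have pos: "0 < \<sigma>1" "0 < \<sigma>"
    using \<sigma>1 norm_ge_zero[of u] by linarith+
  let ?S = "\<lambda>k. norm (inner_sum \<alpha> b u v c d k)"
  obtain C1 j0 where C1: "C1 \<ge> 0" "\<And>k. n * j0 \<le> wt k \<Longrightarrow> ?S k \<le> C1 * real (Suc (wt k)) ^ 2 * \<sigma>1 ^ wt k"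
    using inner_sum_bound_large[OF n \<sigma>1(1,2) c d b] by blast
  have "(\<lambda>K. real (Suc K) ^ 2 * (\<sigma>1 / \<sigma>) ^ K) \<longlonglongrightarrow> 0"
    using \<sigma>1 pos by real_asymp
  then have "Bseq (\<lambda>K. real (Suc K) ^ 2 * (\<sigma>1 / \<sigma>) ^ K)"
    by (rule convergentI[THEN convergent_imp_Bseq])
  then obtain C2 where C2: "C2 > 0" "\<And>K. norm (real (Suc K) ^ 2 * (\<sigma>1 / \<sigma>) ^ K) \<le> C2"
    by (auto elim: BseqE)
  define F where "F = {k \<in> multi. wt k < n * j0}"
  have "F \<subseteq> box (\<lambda>_. n * j0)"
  proof
    fix k assume k: "k \<in> F"
    then have "k r \<le> wt k" if "r \<in> {1..n}" for r
      using that by (intro member_le_sum) auto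
    then show "k \<in> box (\<lambda>_. n * j0)"
      using k by (force simp: F_def PiE_iff)
  qed
  then have "finite F"
    by (rule finite_subset) (intro finite_PiE, auto)
  define C where "C = C1 * C2 + (\<Sum>k\<in>F. ?S k / \<sigma> ^ wt k)"
  have sum0: "(\<Sum>k\<in>F. ?S k / \<sigma> ^ wt k) \<ge> 0"
    using pos by (intro sum_nonneg) auto
  show ?thesis
  proof (rule that[of C])
    show "C \<ge> 0"
      using C1 C2 sum0 by (simp add: C_def)
    fix k :: "nat \<Rightarrow> nat" assume k: "k \<in> multi"
    show "?S k \<le> C * \<sigma> ^ wt k"
    proof (cases "wt k < n * j0")
      case True
      then have "k \<in> F"
        using k by (simp add: F_def)
      then have "?S k / \<sigma> ^ wt k \<le> (\<Sum>k\<in>F. ?S k / \<sigma> ^ wt k)"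
        using \<open>finite F\<close> pos by (intro member_le_sum) auto
      also have "\<dots> \<le> C"
        using C1 C2 by (simp add: C_def)
      finally show ?thesis
        using pos by (simp add: divide_le_eq)
    next
      case False
      then have "?S k \<le> C1 * real (Suc (wt k)) ^ 2 * \<sigma>1 ^ wt k"
        by (intro C1) simp
      also have "\<dots> = C1 * (real (Suc (wt k)) ^ 2 * (\<sigma>1 / \<sigma>) ^ wt k) * \<sigma> ^ wt k"
        using pos by (simp add: power_divide)
      also have "\<dots> \<le> C1 * C2 * \<sigma> ^ wt k"
        using C2(2)[of "wt k"] C1 pos by (intro mult_right_mono mult_left_mono) auto
      also have "\<dots> \<le> C * \<sigma> ^ wt k"
        using sum0 pos by (intro mult_right_mono) (auto simp: C_def)
      finally show ?thesis .
    qed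
  qed
qed

end

section \<open>Analytic continuation\<close>

lemma geometric_summable_on_PiE:
  fixes \<theta> :: real and n :: nat
  assumes "0 \<le> \<theta>" "\<theta> < 1"
  shows "(\<lambda>k. \<theta> ^ (\<Sum>i=1..n. k i)) summable_on (PiE {1..n} (\<lambda>_. UNIV))"
proof (rule nonneg_bdd_above_summable_on)
  show "bdd_above (sum (\<lambda>k. \<theta> ^ (\<Sum>i=1..n. k i)) ` {F. F \<subseteq> PiE {1..n} (\<lambda>_. UNIV) \<and> finite F})"
  proof (rule bdd_aboveI2)
    fix F assume "F \<in> {F. F \<subseteq> PiE {1..n} (\<lambda>_. UNIV :: nat set) \<and> finite F}"
    then have F: "F \<subseteq> PiE {1..n} (\<lambda>_. UNIV)" "finite F"
      by auto
    define N where "N = (\<Sum>k\<in>F. \<Sum>i=1..n. k i)"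
    have sub: "F \<subseteq> (\<Pi>\<^sub>E r\<in>{1..n}. {0..N})"
    proof
      fix k assume k: "k \<in> F"
      have "k r \<le> N" if r: "r \<in> {1..n}" for r
      proof -
        have "k r \<le> (\<Sum>i=1..n. k i)"
          using r by (intro member_le_sum) auto
        also have "\<dots> \<le> N"
          unfolding N_def using k F(2) by (intro member_le_sum) auto
        finally show ?thesis .
      qed
      then show "k \<in> (\<Pi>\<^sub>E r\<in>{1..n}. {0..N})"
        using k F(1) by (auto simp: PiE_iff)
    qed
    have "(\<Sum>k\<in>F. \<theta> ^ (\<Sum>i=1..n. k i)) \<le> (\<Sum>k\<in>(\<Pi>\<^sub>E r\<in>{1..n}. {0..N}). \<theta> ^ (\<Sum>i=1..n. k i))"
      by (rule sum_mono2[OF _ sub]) (use assms in \<open>auto intro!: finite_PiE\<close>)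
    also have "\<dots> = (\<Sum>k\<in>(\<Pi>\<^sub>E r\<in>{1..n}. {0..N}). \<Prod>r\<in>{1..n}. \<theta> ^ k r)"
      by (simp add: power_sum)
    also have "\<dots> \<le> (\<Sum>m. \<theta> ^ m) ^ card {1..n}"
      using sum_PiE_prod_le_suminf_power[of "\<lambda>m. \<theta> ^ m" "{1..n}" "\<lambda>_. N"] assms by (simp add: summable_geometric)
    finally show "(\<Sum>k\<in>F. \<theta> ^ (\<Sum>i=1..n. k i)) \<le> (\<Sum>m. \<theta> ^ m) ^ card {1..n}" .
  qed
qed (use assms in auto)

section \<open>Convergence of the series and continuation in the a_r\<close>

context An_params
begin

text \<open>The powers q^((r - 1) k_r) are absorbed in the Vandermonde quotient, which then stays
  bounded. Growth in |k| comes from the numerators, at most \<rho>_s^|k| for each s, and from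
  |q|^(-n |k|). The constant is uniform over the polydisc, as the continuation needs.\<close>

lemma outer_term_bound:
  assumes n: "n \<ge> 1" and \<rho>: "\<And>r. r \<in> {1..n} \<Longrightarrow> 0 < \<rho> r" "\<And>r. r \<in> {1..n} \<Longrightarrow> norm (\<alpha> * x r) * \<rho> r < 1"
  obtains C where "C \<ge> 0" "\<And>a k. (\<And>r. r \<in> {1..n} \<Longrightarrow> norm (a r) \<le> \<rho> r) \<Longrightarrow>
     norm (outer_term \<alpha> a k) \<le> C * ((\<Prod>r=1..n. \<rho> r) / norm q ^ n) ^ wt k"
proof -
  define X where "X = (\<Sum>r=1..n. norm (x r))"
  have X: "X > 0" "\<And>r. r \<in> {1..n} \<Longrightarrow> norm (x r) \<le> X"
    using x_sum_pos[OF n] x_sum_bound by (auto simp: X_def)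
  obtain \<delta> where \<delta>: "\<delta> > 0"
    "\<And>r s k. r \<in> {1..n} \<Longrightarrow> s \<in> {1..n} \<Longrightarrow> \<delta> \<le> norm (qpoch q (q * x r / x s) k)"
    using q_ratio_bounded_below by blast
  have "\<forall>r\<in>{1..n}. \<exists>c>0. \<forall>z k. norm z \<le> norm (\<alpha> * x r) * \<rho> r \<longrightarrow> c \<le> norm (qpoch q z k)"
  proof
    fix r assume r: "r \<in> {1..n}"
    have "0 \<le> norm (\<alpha> * x r) * \<rho> r"
      using \<rho>(1)[OF r] by simp
    from qpoch_bounded_below_uniform[OF q_less this \<rho>(2)[OF r]]
    show "\<exists>c>0. \<forall>z k. norm z \<le> norm (\<alpha> * x r) * \<rho> r \<longrightarrow> c \<le> norm (qpoch q z k)"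
      by metis
  qed
  then obtain \<epsilon> where \<epsilon>: "\<And>r. r \<in> {1..n} \<Longrightarrow> \<epsilon> r > 0"
    "\<And>r z k. r \<in> {1..n} \<Longrightarrow> norm z \<le> norm (\<alpha> * x r) * \<rho> r \<Longrightarrow> \<epsilon> r \<le> norm (qpoch q z k)"
    by metis
  define V where "V = (\<Prod>r=1..n. \<Prod>s\<in>{r<..n}. 2 * X)"
  define E where "E = (\<Prod>r=1..n. \<Prod>s=1..n. exp (norm (q * x r / x s) / (\<rho> s * (1 - norm q))) / \<delta>)"
  define W where "W = (\<Prod>r=1..n. (1 + norm (\<alpha> * x r)) / norm (1 - \<alpha> * x r))"
  define P where "P = (\<Prod>r=1..n. exp (norm (\<alpha> * x r) / (1 - norm q)) / \<epsilon> r)"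
  define C where "C = V / norm (vdm n x) * E * W * P"
  have nn: "V \<ge> 0" "E \<ge> 0" "W \<ge> 0" "P \<ge> 0"
    unfolding V_def E_def W_def P_def
    using X(1) \<delta>(1) \<epsilon>(1) by (auto intro!: prod_nonneg divide_nonneg_nonneg simp: less_imp_le)
  show ?thesis
  proof (rule that[of C])
    show "C \<ge> 0"
      using nn by (simp add: C_def)
    fix a :: "nat \<Rightarrow> complex" and k :: "nat \<Rightarrow> nat"
    assume a: "\<And>r. r \<in> {1..n} \<Longrightarrow> norm (a r) \<le> \<rho> r"
    define K where "K = wt k"
    have le1: "norm q ^ j \<le> 1" for j
      using q_less by (simp add: power_le_one)
    have 1: "norm (vdm n (\<lambda>r. x r * q ^ k r)) \<le> V"
      unfolding V_def vdm_def prod_norm[symmetric]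
    proof (intro prod_mono conjI norm_ge_zero prod_nonneg)
      fix r s assume rs: "r \<in> {1..n}" "s \<in> {r<..n}"
      have le: "norm (x t * q ^ k t) \<le> X" if "t \<in> {1..n}" for t
      proof -
        have "norm (x t * q ^ k t) \<le> norm (x t) * 1"
          unfolding norm_mult norm_power by (intro mult_left_mono le1) auto
        then show ?thesis
          using X(2)[OF that] by simp
      qed
      show "norm (x s * q ^ k s - x r * q ^ k r) \<le> 2 * X"
        using norm_triangle_ineq4[of "x s * q ^ k s" "x r * q ^ k r"] le[of s] le[of r] rs by auto
    qed
    have 2: "(\<Prod>r=1..n. \<Prod>s=1..n. norm (qpoch_hom q (q * x r / x s) (a s) (k r)) / norm (qpoch q (q * x r / x s) (k r))) \<le>
        E * (\<Prod>r=1..n. \<rho> r) ^ K"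
    proof -
      have "(\<Prod>r=1..n. \<Prod>s=1..n. norm (qpoch_hom q (q * x r / x s) (a s) (k r)) / norm (qpoch q (q * x r / x s) (k r))) \<le>
        (\<Prod>r=1..n. \<Prod>s=1..n. \<rho> s ^ k r * (exp (norm (q * x r / x s) / (\<rho> s * (1 - norm q))) / \<delta>))"
      proof (intro prod_mono conjI prod_nonneg)
        fix r s assume rs: "r \<in> {1..n}" "s \<in> {1..n}"
        have "norm (qpoch_hom q (q * x r / x s) (a s) (k r)) \<le>
           \<rho> s ^ k r * exp (norm (q * x r / x s) / (\<rho> s * (1 - norm q)))"
          unfolding qpoch_hom_def by (rule norm_prod_geometric_le[OF q_less \<rho>(1) a order_refl]) (use rs in auto)
        then have "norm (qpoch_hom q (q * x r / x s) (a s) (k r)) / norm (qpoch q (q * x r / x s) (k r)) \<le>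
            \<rho> s ^ k r * exp (norm (q * x r / x s) / (\<rho> s * (1 - norm q))) / \<delta>"
          using \<delta> rs \<rho>(1)[of s] by (intro frac_le) auto
        then show "norm (qpoch_hom q (q * x r / x s) (a s) (k r)) / norm (qpoch q (q * x r / x s) (k r)) \<le>
            \<rho> s ^ k r * (exp (norm (q * x r / x s) / (\<rho> s * (1 - norm q))) / \<delta>)"
          by simp
      qed auto
      also have "\<dots> = E * (\<Prod>r=1..n. \<rho> r) ^ K"
        unfolding E_def K_def prod.distrib power_sum prod_power_distrib by (simp only: mult.commute)
      finally show ?thesis .
    qed
    have 3: "(\<Prod>r=1..n. norm (1 - \<alpha> * x r * q ^ (k r + K)) / norm (1 - \<alpha> * x r)) \<le> W"
      unfolding W_def
    proof (intro prod_mono conjI divide_right_mono)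
      fix r
      have "norm (1 - \<alpha> * x r * q ^ (k r + K)) \<le> 1 + norm (\<alpha> * x r) * norm q ^ (k r + K)"
        using norm_triangle_ineq4[of 1 "\<alpha> * x r * q ^ (k r + K)"] by (simp add: norm_mult norm_power)
      also have "\<dots> \<le> 1 + norm (\<alpha> * x r) * 1"
        by (intro add_left_mono mult_left_mono le1) auto
      finally show "norm (1 - \<alpha> * x r * q ^ (k r + K)) \<le> 1 + norm (\<alpha> * x r)"
        by simp
    qed auto
    have 4: "(\<Prod>r=1..n. norm (qpoch q (\<alpha> * x r) K) / norm (qpoch q (\<alpha> * x r * a r) K)) \<le> P"
      unfolding P_def
    proof (intro prod_mono conjI frac_le)
      fix r assume r: "r \<in> {1..n}"
      show "norm (qpoch q (\<alpha> * x r) K) \<le> exp (norm (\<alpha> * x r) / (1 - norm q))"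
        by (rule norm_qpoch_le[OF q_less order_refl])
      show "\<epsilon> r > 0"
        by (rule \<epsilon>(1)[OF r])
      show "\<epsilon> r \<le> norm (qpoch q (\<alpha> * x r * a r) K)"
        using a[OF r] by (intro \<epsilon>(2)[OF r]) (simp add: norm_mult mult_left_mono)
    qed auto
    define e where "e = (\<Sum>r=1..n. (r - 1) * k r)"
    have pw: "q powi (int e - int (n * K)) = q ^ e / q ^ (n * K)"
      by (rule power_int_diff_of_nat) simp
    have "outer_term \<alpha> a k = (vandermonde_quot q n x k * q ^ e)
     * ((\<Prod>r=1..n. \<Prod>s=1..n. qpoch_hom q (q * x r / x s) (a s) (k r) / qpoch q (q * x r / x s) (k r)))
     * (\<Prod>r=1..n. (1 - \<alpha> * x r * q ^ (k r + K)) / (1 - \<alpha> * x r))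
     * (\<Prod>r=1..n. qpoch q (\<alpha> * x r) K / qpoch q (\<alpha> * x r * a r) K)
     / q ^ (n * K)"
      unfolding outer_term_def e_def[symmetric] K_def[symmetric] pw by (simp add: prod_dividef)
    also have "vandermonde_quot q n x k * q ^ e = vdm n (\<lambda>r. x r * q ^ k r) / vdm n x"
      unfolding e_def by (rule vandermonde_quot_eq)
    finally have "norm (outer_term \<alpha> a k) = norm (vdm n (\<lambda>r. x r * q ^ k r)) / norm (vdm n x)
     * ((\<Prod>r=1..n. \<Prod>s=1..n. norm (qpoch_hom q (q * x r / x s) (a s) (k r)) / norm (qpoch q (q * x r / x s) (k r))))
     * (\<Prod>r=1..n. norm (1 - \<alpha> * x r * q ^ (k r + K)) / norm (1 - \<alpha> * x r))
     * (\<Prod>r=1..n. norm (qpoch q (\<alpha> * x r) K) / norm (qpoch q (\<alpha> * x r * a r) K))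
     / norm q ^ (n * K)"
      by (simp only: norm_mult norm_divide norm_power prod_norm[symmetric])
    also have "\<dots> \<le> V / norm (vdm n x) * (E * (\<Prod>r=1..n. \<rho> r) ^ K) * W * P / norm q ^ (n * K)"
      using nn \<rho>(1)
      by (intro divide_right_mono mult_mono 1 2 3 4)
         (auto intro!: mult_nonneg_nonneg prod_nonneg divide_nonneg_nonneg zero_le_power simp: less_imp_le)
    also have "\<dots> = C * ((\<Prod>r=1..n. \<rho> r) / norm q ^ n) ^ K"
      by (simp add: C_def power_divide power_mult[symmetric])
    finally show "norm (outer_term \<alpha> a k) \<le> C * ((\<Prod>r=1..n. \<rho> r) / norm q ^ n) ^ wt k"
      unfolding K_def .
  qed
qed

text \<open>Here u, v, c, d already contain the factor \<alpha>, whereas b does not.\<close>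

definition summand :: "complex \<Rightarrow> complex \<Rightarrow> complex \<Rightarrow> complex \<Rightarrow> complex \<Rightarrow> complex \<Rightarrow> (nat \<Rightarrow> complex) \<Rightarrow> (nat \<Rightarrow> nat) \<Rightarrow> complex" where
  "summand \<alpha> b u v c d a k =
     outer_term \<alpha> a k * inner_sum \<alpha> b u v c d k"

definition product_side :: "complex \<Rightarrow> complex \<Rightarrow> complex \<Rightarrow> complex \<Rightarrow> complex \<Rightarrow> complex \<Rightarrow> (nat \<Rightarrow> complex) \<Rightarrow> complex" where
  "product_side \<alpha> b u v c d a =
     qpoch_inf q u * qpoch_inf q v * qpoch_inf q (c * (\<Prod>r=1..n. a r) / q ^ n) * qpoch_inf q (d * (\<Prod>r=1..n. a r) / q ^ n)
     / (qpoch_inf q c * qpoch_inf q d * qpoch_inf q (u * (\<Prod>r=1..n. a r) / q ^ n) * qpoch_inf q (v * (\<Prod>r=1..n. a r) / q ^ n))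
     * (\<Prod>r=1..n. qpoch_inf q (\<alpha> * q * x r) * qpoch_inf q (\<alpha> * b * x r * a r / q)
         / (qpoch_inf q (\<alpha> * b * x r) * qpoch_inf q (\<alpha> * x r * a r)))"

lemma summand_cong: "(\<And>r. r \<in> {1..n} \<Longrightarrow> a r = a' r) \<Longrightarrow> summand \<alpha> b u v c d a k = summand \<alpha> b u v c d a' k"
  by (simp add: summand_def outer_term_def)

text \<open>Outside the box of M all outer terms vanish, so the series is a finite sum. Since the
  product of the a_r divided by q^n is q^|M|, the quotients of infinite products collapse to
  q-factorials of length |M|, and of length M_r in the product over r.\<close>

lemma terminating_has_sum:
  assumes n: "n \<ge> 1" and M: "\<And>r. r \<in> {1..n} \<Longrightarrow> a r = q ^ Suc (M r)"
    and \<alpha>: "\<And>r. r \<in> {1..n} \<Longrightarrow> \<alpha> * x r \<noteq> 1"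
    and ax: "\<And>r. r \<in> {1..n} \<Longrightarrow> qpoch_inf q (\<alpha> * x r * a r) \<noteq> 0"
    and bx: "\<And>r. r \<in> {1..n} \<Longrightarrow> qpoch_inf q (\<alpha> * b * x r) \<noteq> 0"
    and cd: "qpoch_inf q c \<noteq> 0" "qpoch_inf q d \<noteq> 0"
    and uv: "qpoch_inf q (u * (\<Prod>r=1..n. a r) / q ^ n) \<noteq> 0" "qpoch_inf q (v * (\<Prod>r=1..n. a r) / q ^ n) \<noteq> 0"
  shows "(summand \<alpha> b u v c d a has_sum product_side \<alpha> b u v c d a) multi"
proof -
  \<comment> \<open>The restriction makes the exponents an element of \<open>multi\<close>.\<close>
  define M' where "M' = restrict M {1..n}"
  have a: "a r = qshift M' r" if "r \<in> {1..n}" for r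
    using M[OF that] that by (simp add: M'_def)
  have M': "M' \<in> multi"
    by (simp add: M'_def)
  have P: "(\<Prod>r=1..n. a r) = q ^ wt M' * q ^ n"
  proof -
    have "(\<Prod>r=1..n. a r) = (\<Prod>r=1..n. q ^ M' r * q)"
      by (intro prod.cong refl) (simp add: a)
    then show ?thesis
      by (simp add: prod.distrib power_sum)
  qed
  have z0: "summand \<alpha> b u v c d a k = 0" if k: "k \<in> multi - box M'" for k
  proof -
    obtain r where r: "r \<in> {1..n}" "M' r < k r"
      using box_outside[of k M'] k by blast
    have "outer_term \<alpha> a k = 0"
      by (rule outer_term_outside[of M' r]) (use r a[OF r(1)] in auto)
    then show ?thesis
      by (simp add: summand_def)
  qed
  have sub: "box M' \<subseteq> multi"
    by (rule PiE_mono) auto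
  have "(summand \<alpha> b u v c d a has_sum (\<Sum>k\<in>box M'. summand \<alpha> b u v c d a k)) (box M')"
    by (intro has_sum_finite finite_PiE) auto
  then have "(summand \<alpha> b u v c d a has_sum (\<Sum>k\<in>box M'. summand \<alpha> b u v c d a k)) multi"
    by (subst has_sum_cong_neutral[where g = "summand \<alpha> b u v c d a" and T = "box M'"]) (use z0 sub in auto)
  also have "(\<Sum>k\<in>box M'. summand \<alpha> b u v c d a k) =
      (\<Sum>k\<in>box M'. outer_term \<alpha> (qshift M') k * inner_sum \<alpha> b u v c d k)"
  proof (rule sum.cong[OF refl])
    fix k
    have "summand \<alpha> b u v c d a k = summand \<alpha> b u v c d (qshift M') k"
      by (rule summand_cong) (rule a)
    then show "summand \<alpha> b u v c d a k =
        outer_term \<alpha> (qshift M') k * inner_sum \<alpha> b u v c d k"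
      by (simp only: summand_def)
  qed
  also have "\<dots> = (\<Prod>r=1..n. qpoch q (\<alpha> * q * x r) (M' r)) * inner_coeff (\<alpha> * b) u v c d M'"
  proof (rule terminating_expansion[OF n M' \<alpha>])
    show "qpoch q (\<alpha> * x r * q ^ Suc (M' r)) j \<noteq> 0" if "r \<in> {1..n}" for r j
      using qpoch_nonzero[OF q_less ax[OF that]] a[OF that] by simp
  qed
  also have "\<dots> = product_side \<alpha> b u v c d a"
  proof -
    let ?W = "wt M'"
    have PW: "t * (\<Prod>r=1..n. a r) / q ^ n = t * q ^ ?W" for t
      unfolding P by simp
    have s: "qpoch_inf q t = qpoch q t ?W * qpoch_inf q (t * q ^ ?W)" for t
      by (rule qpoch_inf_split[OF q_less])
    have nz: "qpoch_inf q (u * q ^ ?W) \<noteq> 0" "qpoch_inf q (v * q ^ ?W) \<noteq> 0"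
      "qpoch_inf q (c * q ^ ?W) \<noteq> 0" "qpoch_inf q (d * q ^ ?W) \<noteq> 0"
      using uv cd s[of c] s[of d] unfolding PW by auto
    have 1: "qpoch_inf q u * qpoch_inf q v * qpoch_inf q (c * q ^ ?W) * qpoch_inf q (d * q ^ ?W) /
       (qpoch_inf q c * qpoch_inf q d * qpoch_inf q (u * q ^ ?W) * qpoch_inf q (v * q ^ ?W)) =
       qpoch q u ?W * qpoch q v ?W / (qpoch q c ?W * qpoch q d ?W)"
      unfolding s[of u] s[of v] s[of c] s[of d] using nz by simp
    have 2: "qpoch_inf q (\<alpha> * q * x r) * qpoch_inf q (\<alpha> * b * x r * a r / q)
         / (qpoch_inf q (\<alpha> * b * x r) * qpoch_inf q (\<alpha> * x r * a r)) =
        qpoch q (\<alpha> * q * x r) (M' r) * (1 / qpoch q (\<alpha> * b * x r) (M' r))" if r: "r \<in> {1..n}" for r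
    proof -
      have e1: "\<alpha> * b * x r * a r / q = \<alpha> * b * x r * q ^ M' r"
        by (simp add: a[OF r])
      have e2: "\<alpha> * x r * a r = \<alpha> * q * x r * q ^ M' r"
        by (simp add: a[OF r])
      have s1: "qpoch_inf q (\<alpha> * q * x r) = qpoch q (\<alpha> * q * x r) (M' r) * qpoch_inf q (\<alpha> * q * x r * q ^ M' r)"
        and s2: "qpoch_inf q (\<alpha> * b * x r) = qpoch q (\<alpha> * b * x r) (M' r) * qpoch_inf q (\<alpha> * b * x r * q ^ M' r)"
        by (rule qpoch_inf_split[OF q_less])+
      have "qpoch_inf q (\<alpha> * q * x r * q ^ M' r) \<noteq> 0" "qpoch_inf q (\<alpha> * b * x r * q ^ M' r) \<noteq> 0"
        using ax[OF r] bx[OF r] s2 unfolding e2 by auto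
      then show ?thesis
        unfolding e1 e2 s1 s2 by simp
    qed
    show ?thesis
      unfolding product_side_def inner_coeff_def PW 1
      by (subst prod.cong[OF refl 2]) (simp_all only: prod.distrib mult_ac)
  qed
  finally show ?thesis .
qed

text \<open>The outer term and the inner sum are bounded by geometric expressions in |k| whose
  ratios multiply to \<theta> < 1. This is how the convergence condition on \<alpha>\<beta> a_1 ...
  a_n / q^n, and its companion with \<gamma>, enters.\<close>

lemma summand_majorant:
  assumes n: "n \<ge> 1" and \<rho>: "\<And>r. r \<in> {1..n} \<Longrightarrow> 0 < \<rho> r" "\<And>r. r \<in> {1..n} \<Longrightarrow> norm (\<alpha> * x r) * \<rho> r < 1"
    and \<sigma>: "norm u < \<sigma>" "norm v < \<sigma>" "\<sigma> * ((\<Prod>r=1..n. \<rho> r) / norm q ^ n) < 1"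
    and bx: "\<And>r. r \<in> {1..n} \<Longrightarrow> qpoch_inf q (\<alpha> * b * x r) \<noteq> 0"
    and cd: "qpoch_inf q c \<noteq> 0" "qpoch_inf q d \<noteq> 0"
  obtains B where "B summable_on multi"
    "\<And>a k. k \<in> multi \<Longrightarrow> (\<And>r. r \<in> {1..n} \<Longrightarrow> norm (a r) \<le> \<rho> r) \<Longrightarrow>
       norm (summand \<alpha> b u v c d a k) \<le> B k"
proof -
  obtain C1 where C1: "C1 \<ge> 0" "\<And>a k. (\<And>r. r \<in> {1..n} \<Longrightarrow> norm (a r) \<le> \<rho> r) \<Longrightarrow>
     norm (outer_term \<alpha> a k) \<le> C1 * ((\<Prod>r=1..n. \<rho> r) / norm q ^ n) ^ wt k"
    using outer_term_bound[OF n \<rho>] by blast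
  obtain C2 where C2: "C2 \<ge> 0"
    "\<And>k. k \<in> multi \<Longrightarrow>
      norm (inner_sum \<alpha> b u v c d k) \<le> C2 * \<sigma> ^ wt k"
    using inner_sum_bound[OF n \<sigma>(1,2) qpoch_nonzero[OF q_less cd(1)] qpoch_nonzero[OF q_less cd(2)]
      qpoch_nonzero[OF q_less bx]] by blast
  define \<theta> where "\<theta> = \<sigma> * ((\<Prod>r=1..n. \<rho> r) / norm q ^ n)"
  have pos: "(\<Prod>r=1..n. \<rho> r) / norm q ^ n \<ge> 0"
    using \<rho>(1) by (intro divide_nonneg_nonneg prod_nonneg) (auto intro: less_imp_le)
  have \<sigma>0: "\<sigma> \<ge> 0"
    using \<sigma>(1) norm_ge_zero[of u] by linarith
  have \<theta>: "0 \<le> \<theta>" "\<theta> < 1"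
    using mult_nonneg_nonneg[OF \<sigma>0 pos] \<sigma>(3) by (simp_all only: \<theta>_def)
  show ?thesis
  proof (rule that[of "\<lambda>k. C1 * C2 * \<theta> ^ wt k"])
    show "(\<lambda>k. C1 * C2 * \<theta> ^ wt k) summable_on multi"
      by (intro summable_on_cmult_right geometric_summable_on_PiE \<theta>)
    fix a :: "nat \<Rightarrow> complex" and k assume k: "k \<in> multi" and a: "\<And>r. r \<in> {1..n} \<Longrightarrow> norm (a r) \<le> \<rho> r"
    have "norm (summand \<alpha> b u v c d a k) \<le>
        (C1 * ((\<Prod>r=1..n. \<rho> r) / norm q ^ n) ^ wt k) * (C2 * \<sigma> ^ wt k)"
      unfolding summand_def norm_mult using C1 C2 a k pos by (intro mult_mono) auto
    also have "\<dots> = C1 * C2 * \<theta> ^ wt k"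
      by (simp only: \<theta>_def power_mult_distrib mult_ac)
    finally show "norm (summand \<alpha> b u v c d a k) \<le> C1 * C2 * \<theta> ^ wt k" .
  qed
qed

text \<open>For \<epsilon> = 0 the inequalities are the hypotheses; being strict, finite in number
  and continuous in \<epsilon>, they survive a small enlargement of all moduli at once.\<close>

lemma radii_exist:
  fixes a :: "nat \<Rightarrow> complex"
  assumes "norm (u * (\<Prod>r=1..n. a r) / q ^ n) < 1" "norm (v * (\<Prod>r=1..n. a r) / q ^ n) < 1"
    and "\<And>r. r \<in> {1..n} \<Longrightarrow> norm (\<alpha> * x r * a r) < 1"
  obtains \<rho> :: "nat \<Rightarrow> real" and \<sigma> where "\<And>r. norm (a r) < \<rho> r" "norm u < \<sigma>" "norm v < \<sigma>"
    "\<sigma> * ((\<Prod>r=1..n. \<rho> r) / norm q ^ n) < 1" "\<And>r. r \<in> {1..n} \<Longrightarrow> norm (\<alpha> * x r) * \<rho> r < 1"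
proof -
  let ?\<rho> = "\<lambda>\<epsilon> r. norm (a r) + \<epsilon>" and ?\<sigma> = "\<lambda>\<epsilon>. max (norm u) (norm v) + \<epsilon>"
  have "((\<lambda>\<epsilon>. ?\<sigma> \<epsilon> * ((\<Prod>r=1..n. ?\<rho> \<epsilon> r) / norm q ^ n)) \<longlongrightarrow> ?\<sigma> 0 * ((\<Prod>r=1..n. ?\<rho> 0 r) / norm q ^ n)) (at_right 0)"
    by (intro tendsto_intros) auto
  moreover have "?\<sigma> 0 * ((\<Prod>r=1..n. ?\<rho> 0 r) / norm q ^ n) < 1"
    using assms(1,2) by (cases "norm u \<le> norm v") (auto simp: max_def norm_mult norm_divide norm_power prod_norm)
  ultimately have 1: "\<forall>\<^sub>F \<epsilon> in at_right 0. ?\<sigma> \<epsilon> * ((\<Prod>r=1..n. ?\<rho> \<epsilon> r) / norm q ^ n) < 1"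
    by (rule order_tendstoD)
  have 2: "\<forall>\<^sub>F \<epsilon> in at_right 0. \<forall>r\<in>{1..n}. norm (\<alpha> * x r) * ?\<rho> \<epsilon> r < 1"
  proof (rule eventually_ball_finite, simp, rule ballI)
    fix r assume r: "r \<in> {1..n}"
    have "((\<lambda>\<epsilon>. norm (\<alpha> * x r) * ?\<rho> \<epsilon> r) \<longlongrightarrow> norm (\<alpha> * x r) * ?\<rho> 0 r) (at_right 0)"
      by (intro tendsto_intros)
    moreover have "norm (\<alpha> * x r) * ?\<rho> 0 r < 1"
      using assms(3)[OF r] by (simp add: norm_mult)
    ultimately show "\<forall>\<^sub>F \<epsilon> in at_right 0. norm (\<alpha> * x r) * ?\<rho> \<epsilon> r < 1"
      by (rule order_tendstoD)
  qed
  have 3: "\<forall>\<^sub>F \<epsilon> in at_right (0 :: real). \<epsilon> > 0"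
    by (rule eventually_at_right_less)
  obtain \<epsilon> where \<epsilon>: "?\<sigma> \<epsilon> * ((\<Prod>r=1..n. ?\<rho> \<epsilon> r) / norm q ^ n) < 1" "\<forall>r\<in>{1..n}. norm (\<alpha> * x r) * ?\<rho> \<epsilon> r < 1" "\<epsilon> > 0"
    using eventually_happens'[OF _ eventually_conj[OF 1 eventually_conj[OF 2 3]]] by auto
  show ?thesis
    by (rule that[of "?\<rho> \<epsilon>" "?\<sigma> \<epsilon>"]) (use \<epsilon> in auto)
qed

lemma holomorphic_fun_upd [holomorphic_intros]: "(\<lambda>z. (a(r := z)) s) holomorphic_on A"
  by (cases "s = r") (auto intro: holomorphic_intros)

text \<open>Induction on the set J of indices at which a_r need not be a power q^N with N \<ge> 1,
  starting from the terminating case. To free r0, the identity is read as one between two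
  holomorphic functions of the single variable a_r0.\<close>

lemma expansion_has_sum:
  assumes n: "n \<ge> 1"
    and \<alpha>: "\<And>r. r \<in> {1..n} \<Longrightarrow> \<alpha> * x r \<noteq> 1"
    and bx: "\<And>r. r \<in> {1..n} \<Longrightarrow> qpoch_inf q (\<alpha> * b * x r) \<noteq> 0"
    and cd: "qpoch_inf q c \<noteq> 0" "qpoch_inf q d \<noteq> 0"
    and uv: "norm (u * (\<Prod>r=1..n. a r) / q ^ n) < 1" "norm (v * (\<Prod>r=1..n. a r) / q ^ n) < 1"
    and ax: "\<And>r. r \<in> {1..n} \<Longrightarrow> norm (\<alpha> * x r * a r) < 1"
  shows "(summand \<alpha> b u v c d a has_sum product_side \<alpha> b u v c d a) multi"
proof -
    have main: "(summand \<alpha> b u v c d a has_sum product_side \<alpha> b u v c d a) multi"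
    if "finite J" and "\<And>r. r \<in> {1..n} - J \<Longrightarrow> \<exists>N. a r = q ^ Suc N"
      and "norm (u * (\<Prod>r=1..n. a r) / q ^ n) < 1" "norm (v * (\<Prod>r=1..n. a r) / q ^ n) < 1"
      and "\<And>r. r \<in> {1..n} \<Longrightarrow> norm (\<alpha> * x r * a r) < 1" for J and a :: "nat \<Rightarrow> complex"
    using that
  proof (induction J arbitrary: a rule: finite_induct)
    case empty
    then have "\<forall>r\<in>{1..n}. \<exists>N. a r = q ^ Suc N"
      by blast
    then obtain M where M: "\<And>r. r \<in> {1..n} \<Longrightarrow> a r = q ^ Suc (M r)"
      by metis
    show ?case
      by (rule terminating_has_sum[OF n M \<alpha> _ bx cd]) (use empty qpoch_inf_nonzero[OF q_less] in auto)
  next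
    case (insert r0 J)
    show ?case
    proof (cases "r0 \<in> {1..n}")
      case False
      have "\<exists>N. a r = q ^ Suc N" if "r \<in> {1..n} - J" for r
        using insert.prems(1)[of r] that False by auto
      then show ?thesis
        using insert.IH[of a] insert.prems by blast
    next
      case r0: True
      obtain \<rho> \<sigma> where \<rho>: "\<And>r. norm (a r) < \<rho> r" and \<sigma>: "norm u < \<sigma>" "norm v < \<sigma>"
        "\<sigma> * ((\<Prod>r=1..n. \<rho> r) / norm q ^ n) < 1" and \<rho>x: "\<And>r. r \<in> {1..n} \<Longrightarrow> norm (\<alpha> * x r) * \<rho> r < 1"
        using radii_exist[OF insert.prems(2-4)] by blast
      have \<rho>0: "\<rho> r > 0" for r
        using \<rho>[of r] norm_ge_zero[of "a r"] by linarith
      obtain B where B: "B summable_on multi" "\<And>a k. k \<in> multi \<Longrightarrow> (\<And>r. r \<in> {1..n} \<Longrightarrow> norm (a r) \<le> \<rho> r) \<Longrightarrow>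
         norm (summand \<alpha> b u v c d a k) \<le> B k"
        using summand_majorant[OF n \<rho>0 \<rho>x \<sigma> bx cd] by blast
      have upd: "norm ((a(r0 := z)) r) \<le> \<rho> r" if "norm z \<le> \<rho> r0" for z r
        using that \<rho>[of r] by auto
      \<comment> \<open>The convergence conditions hold on the whole polydisc, so the induction
        hypothesis remains available after a_r0 is replaced.\<close>
      have good: "norm (u * (\<Prod>r=1..n. a' r) / q ^ n) < 1" "norm (v * (\<Prod>r=1..n. a' r) / q ^ n) < 1"
        "\<And>r. r \<in> {1..n} \<Longrightarrow> norm (\<alpha> * x r * a' r) < 1" if a': "\<And>r. norm (a' r) \<le> \<rho> r" for a'
      proof -
        have "norm (\<Prod>r=1..n. a' r) \<le> (\<Prod>r=1..n. \<rho> r)"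
          unfolding prod_norm[symmetric] using a' by (intro prod_mono) auto
        then have *: "norm (t * (\<Prod>r=1..n. a' r) / q ^ n) \<le> \<sigma> * ((\<Prod>r=1..n. \<rho> r) / norm q ^ n)"
          if "norm t < \<sigma>" for t :: complex
          unfolding times_divide_eq_right[symmetric] norm_mult norm_divide norm_power
          using that by (intro mult_mono divide_right_mono) (auto intro: order_trans[OF norm_ge_zero less_imp_le])
        show "norm (u * (\<Prod>r=1..n. a' r) / q ^ n) < 1" "norm (v * (\<Prod>r=1..n. a' r) / q ^ n) < 1"
          using *[OF \<sigma>(1)] *[OF \<sigma>(2)] \<sigma>(3) by linarith+
        show "norm (\<alpha> * x r * a' r) < 1" if "r \<in> {1..n}" for r
        proof -
          have "norm (\<alpha> * x r * a' r) \<le> norm (\<alpha> * x r) * \<rho> r"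
            unfolding norm_mult[of "\<alpha> * x r"] using a' by (intro mult_left_mono) auto
          then show ?thesis
            using \<rho>x[OF that] by linarith
        qed
      qed
      define f where "f = (\<lambda>z. \<Sum>\<^sub>\<infinity>k\<in>multi. summand \<alpha> b u v c d (a(r0 := z)) k)"
      define g where "g = (\<lambda>z. product_side \<alpha> b u v c d (a(r0 := z)))"
      let ?D = "cball 0 (\<rho> r0) :: complex set"
      have nz: "qpoch_inf q (u * (\<Prod>r=1..n. (a(r0 := z)) r) / q ^ n) \<noteq> 0"
        "qpoch_inf q (v * (\<Prod>r=1..n. (a(r0 := z)) r) / q ^ n) \<noteq> 0"
        "r \<in> {1..n} \<Longrightarrow> qpoch_inf q (\<alpha> * x r * (a(r0 := z)) r) \<noteq> 0" if "z \<in> ?D" for z r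
      proof -
        have "norm z \<le> \<rho> r0"
          using that by simp
        note a' = good[OF upd[OF this]]
        show "qpoch_inf q (u * (\<Prod>r=1..n. (a(r0 := z)) r) / q ^ n) \<noteq> 0"
          "qpoch_inf q (v * (\<Prod>r=1..n. (a(r0 := z)) r) / q ^ n) \<noteq> 0"
          by (intro qpoch_inf_nonzero[OF q_less] a')+
        show "qpoch_inf q (\<alpha> * x r * (a(r0 := z)) r) \<noteq> 0" if "r \<in> {1..n}"
          by (intro qpoch_inf_nonzero[OF q_less] a' that)
      qed
      have hol_summand: "(\<lambda>z. summand \<alpha> b u v c d (a(r0 := z)) k) holomorphic_on ?D" for k
        unfolding summand_def outer_term_def qpoch_hom_def
        by (intro holomorphic_intros) (use \<alpha> x_generic qpoch_nonzero[OF q_less nz(3)] in \<open>simp_all add: prod_zero_iff\<close>)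
      have ulim: "uniform_limit ?D (\<lambda>F z. \<Sum>k\<in>F. summand \<alpha> b u v c d (a(r0 := z)) k) f (finite_subsets_at_top multi)"
        unfolding f_def by (rule Weierstrass_m_test_general[OF _ B(1)]) (use B(2) upd in auto)
      have f: "f holomorphic_on ball 0 (\<rho> r0)"
      proof (rule holomorphic_uniform_limit[OF _ ulim])
        show "\<forall>\<^sub>F F in finite_subsets_at_top multi. continuous_on ?D (\<lambda>z. \<Sum>k\<in>F. summand \<alpha> b u v c d (a(r0 := z)) k) \<and>
           (\<lambda>z. \<Sum>k\<in>F. summand \<alpha> b u v c d (a(r0 := z)) k) holomorphic_on ball 0 (\<rho> r0)"
        proof (intro always_eventually allI conjI)
          fix F
          have "(\<lambda>z. \<Sum>k\<in>F. summand \<alpha> b u v c d (a(r0 := z)) k) holomorphic_on ?D"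
            by (intro holomorphic_intros hol_summand)
          then show "continuous_on ?D (\<lambda>z. \<Sum>k\<in>F. summand \<alpha> b u v c d (a(r0 := z)) k)"
            "(\<lambda>z. \<Sum>k\<in>F. summand \<alpha> b u v c d (a(r0 := z)) k) holomorphic_on ball 0 (\<rho> r0)"
            by (auto intro: holomorphic_on_imp_continuous_on holomorphic_on_subset)
        qed
      qed auto
      have g: "g holomorphic_on ball 0 (\<rho> r0)"
        unfolding g_def product_side_def
        by (intro holomorphic_intros q_less) (use nz bx cd in \<open>auto simp: prod_zero_iff\<close>)
      \<comment> \<open>At these points the parameter of r0 is a power of q as well, so r0 drops out
        of the exceptional set and the induction hypothesis applies. They accumulate at 0, the
        centre of the disc on which f and g are holomorphic.\<close>
      define U where "U = {z \<in> ball 0 (\<rho> r0). \<exists>N. z = q ^ Suc N}"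
      have fg: "f z - g z = 0" if z: "z \<in> U" for z
      proof -
        have le: "norm z \<le> \<rho> r0"
          using z by (auto simp: U_def)
        have "(summand \<alpha> b u v c d (a(r0 := z)) has_sum product_side \<alpha> b u v c d (a(r0 := z))) multi"
        proof (rule insert.IH)
          show "\<exists>N. (a(r0 := z)) r = q ^ Suc N" if "r \<in> {1..n} - J" for r
            using insert.prems(1)[of r] that z by (auto simp: U_def)
        qed (use good[OF upd[OF le]] in auto)
        then show ?thesis
          unfolding f_def g_def by (simp add: infsumI)
      qed
      have lim: "0 islimpt U"
      proof -
        have "(\<lambda>N. q ^ Suc N) \<longlonglongrightarrow> 0"
          using LIMSEQ_power_zero[OF q_less] by (rule LIMSEQ_Suc)
        show ?thesis
          unfolding islimpt_approachable
        proof (intro allI impI)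
          fix e :: real assume "e > 0"
          with \<rho>0[of r0] have "\<forall>\<^sub>F N in sequentially. dist (q ^ Suc N) 0 < min e (\<rho> r0)"
            using \<open>(\<lambda>N. q ^ Suc N) \<longlonglongrightarrow> 0\<close> by (intro tendstoD) auto
          then obtain N where "dist (q ^ Suc N) 0 < min e (\<rho> r0)"
            by (auto simp: eventually_sequentially)
          then show "\<exists>y\<in>U. y \<noteq> 0 \<and> dist y 0 < e"
            by (intro bexI[of _ "q ^ Suc N"]) (auto simp: U_def simp del: power_Suc)
        qed
      qed
      have "f (a r0) - g (a r0) = 0"
      proof (rule analytic_continuation[where f = "\<lambda>z. f z - g z" and S = "ball 0 (\<rho> r0)" and U = U and \<xi> = 0])
        show "(\<lambda>z. f z - g z) holomorphic_on ball 0 (\<rho> r0)"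
          by (intro holomorphic_intros f g)
      qed (use \<rho>[of r0] \<rho>0[of r0] lim fg in \<open>auto simp: U_def\<close>)
      then have "infsum (summand \<alpha> b u v c d a) multi = product_side \<alpha> b u v c d a"
        by (simp add: f_def g_def)
      moreover have "summand \<alpha> b u v c d a summable_on multi"
      proof (rule abs_summable_summable, rule summable_on_comparison_test[OF B(1)])
        show "norm (summand \<alpha> b u v c d a k) \<le> B k" if "k \<in> multi" for k
          using B(2)[OF that] \<rho> less_imp_le by blast
      qed auto
      ultimately show ?thesis
        using has_sum_infsum by metis
    qed
  qed
  show ?thesis
    by (rule main[of "{1..n}"]) (use uv ax in auto)
qed

end

section \<open>The identity in its original parameters\<close>

theorem theorem1p11:
  fixes q \<alpha> \<beta> \<gamma> b c d :: complex
    and a x :: "nat \<Rightarrow> complex"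
    and n :: nat
  assumes "0 < norm q" and "norm q < 1"
    and "n \<ge> 1"
    and "(norm (\<alpha> * c) < 1 \<and> norm (\<alpha> * d) < 1
           \<and> norm (\<alpha> * \<beta> * (\<Prod>r=1..n. a r) / q ^ n) < 1
           \<and> norm (\<alpha> * \<gamma> * (\<Prod>r=1..n. a r) / q ^ n) < 1
           \<and> (\<forall>r\<in>{1..n}. norm (\<alpha> * a r * x r) < 1 \<and> norm (\<alpha> * b * x r) < 1))
         \<or> (\<exists>N :: nat \<Rightarrow> nat. \<forall>r\<in>{1..n}. N r \<ge> 1 \<and> a r = q ^ N r)"
    \<comment> \<open>denominators on the left-hand side\<close>
    and "qpoch_inf q (\<alpha> * c) \<noteq> 0" and "qpoch_inf q (\<alpha> * d) \<noteq> 0"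
    and "qpoch_inf q (\<alpha> * \<beta> * (\<Prod>r=1..n. a r) / q ^ n) \<noteq> 0"
    and "qpoch_inf q (\<alpha> * \<gamma> * (\<Prod>r=1..n. a r) / q ^ n) \<noteq> 0"
    and "\<And>r. r \<in> {1..n} \<Longrightarrow> qpoch_inf q (\<alpha> * b * x r) \<noteq> 0"
    and "\<And>r. r \<in> {1..n} \<Longrightarrow> qpoch_inf q (\<alpha> * a r * x r) \<noteq> 0"
    \<comment> \<open>denominators on the right-hand side\<close>
    and "\<And>r. r \<in> {1..n} \<Longrightarrow> x r \<noteq> 0"
    and "\<And>r s. r \<in> {1..n} \<Longrightarrow> s \<in> {1..n} \<Longrightarrow> r < s \<Longrightarrow> 1 - x r / x s \<noteq> 0"
    and "\<And>r s k. r \<in> {1..n} \<Longrightarrow> s \<in> {1..n} \<Longrightarrow> qpoch q (q * x r / x s) k \<noteq> 0"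
    and "\<And>r. r \<in> {1..n} \<Longrightarrow> 1 - \<alpha> * x r \<noteq> 0"
    and "\<And>r k. r \<in> {1..n} \<Longrightarrow> qpoch q (\<alpha> * x r * a r) k \<noteq> 0"
    and "\<And>r k. r \<in> {1..n} \<Longrightarrow> qpoch q (\<alpha> * b * x r) k \<noteq> 0"
    and "\<And>k. qpoch q (\<alpha> * c) k \<noteq> 0" and "\<And>k. qpoch q (\<alpha> * d) k \<noteq> 0"
  shows
    "((\<lambda>k.
        vandermonde_quot q n x k
        * ((\<Prod>r=1..n. \<Prod>s=1..n. qpoch_hom q (q * x r / x s) (a s) (k r))
           / (\<Prod>r=1..n. \<Prod>s=1..n. qpoch q (q * x r / x s) (k r)))
        * (\<Prod>r=1..n. (1 - \<alpha> * x r * q ^ (k r + (\<Sum>i=1..n. k i))) / (1 - \<alpha> * x r))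
        * (\<Prod>r=1..n. qpoch q (\<alpha> * x r) (\<Sum>i=1..n. k i)
                       / qpoch q (\<alpha> * x r * a r) (\<Sum>i=1..n. k i))
        * q powi (int (\<Sum>r=1..n. (r - 1) * k r) - int (n * (\<Sum>i=1..n. k i)))
        * (\<Sum>m \<in> (\<Pi>\<^sub>E r\<in>{1..n}. {0..k r}).
             vandermonde_quot q n x m
             * (\<Prod>r=1..n. \<Prod>s=1..n. qpoch q (q powi (- int (k s)) * x r / x s) (m r)
                                     / qpoch q (q * x r / x s) (m r))
             * (\<Prod>r=1..n. qpoch q (\<alpha> * x r * q ^ (\<Sum>i=1..n. k i)) (m r)
                            / qpoch q (\<alpha> * b * x r) (m r))
             * (qpoch q (\<alpha> * \<beta>) (\<Sum>i=1..n. m i) * qpoch q (\<alpha> * \<gamma>) (\<Sum>i=1..n. m i)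
                / (qpoch q (\<alpha> * c) (\<Sum>i=1..n. m i) * qpoch q (\<alpha> * d) (\<Sum>i=1..n. m i)))
             * q ^ (\<Sum>r=1..n. r * m r)))
      has_sum
        (qpoch_inf q (\<alpha> * \<beta>) * qpoch_inf q (\<alpha> * \<gamma>)
         * qpoch_inf q (\<alpha> * (\<Prod>r=1..n. a r) * c / q ^ n)
         * qpoch_inf q (\<alpha> * (\<Prod>r=1..n. a r) * d / q ^ n)
         / (qpoch_inf q (\<alpha> * c) * qpoch_inf q (\<alpha> * d)
            * qpoch_inf q (\<alpha> * \<beta> * (\<Prod>r=1..n. a r) / q ^ n)
            * qpoch_inf q (\<alpha> * \<gamma> * (\<Prod>r=1..n. a r) / q ^ n))
         * (\<Prod>r=1..n. qpoch_inf q (\<alpha> * q * x r) * qpoch_inf q (\<alpha> * a r * b * x r / q)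
                        / (qpoch_inf q (\<alpha> * b * x r) * qpoch_inf q (\<alpha> * a r * x r)))))
     ({1..n} \<rightarrow>\<^sub>E (UNIV :: nat set))"
proof -
  interpret An_params q n x
  proof
    show "x r \<noteq> x s" if "r \<in> {1..n}" "s \<in> {1..n}" "r < s" for r s
      using assms(11)[OF that(2)] assms(12)[OF that] by auto
  qed (use assms(1,2,11,13) in auto)
  let ?P = "\<Prod>r=1..n. a r"
  let ?u = "\<alpha> * \<beta>" and ?v = "\<alpha> * \<gamma>"
  have \<alpha>: "\<alpha> * x r \<noteq> 1" if "r \<in> {1..n}" for r
    using assms(14)[OF that] by auto
  have ax: "qpoch_inf q (\<alpha> * x r * a r) \<noteq> 0" if "r \<in> {1..n}" for r
    using assms(10)[OF that] by (simp add: mult_ac)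
  have "(summand \<alpha> b ?u ?v (\<alpha> * c) (\<alpha> * d) a has_sum product_side \<alpha> b ?u ?v (\<alpha> * c) (\<alpha> * d) a)
      ({1..n} \<rightarrow>\<^sub>E UNIV)"
    using assms(4)
  proof
    assume conv: "norm (\<alpha> * c) < 1 \<and> norm (\<alpha> * d) < 1
           \<and> norm (\<alpha> * \<beta> * ?P / q ^ n) < 1 \<and> norm (\<alpha> * \<gamma> * ?P / q ^ n) < 1
           \<and> (\<forall>r\<in>{1..n}. norm (\<alpha> * a r * x r) < 1 \<and> norm (\<alpha> * b * x r) < 1)"
    show ?thesis
    proof (rule expansion_has_sum[OF assms(3) \<alpha> assms(9) assms(5,6)])
      show "norm (\<alpha> * x r * a r) < 1" if "r \<in> {1..n}" for r
        using conv that by (simp add: mult_ac)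
    qed (use conv in auto)
  next
    assume "\<exists>N :: nat \<Rightarrow> nat. \<forall>r\<in>{1..n}. N r \<ge> 1 \<and> a r = q ^ N r"
    then obtain N :: "nat \<Rightarrow> nat" where N: "\<And>r. r \<in> {1..n} \<Longrightarrow> N r \<ge> 1 \<and> a r = q ^ N r"
      by blast
    show ?thesis
    proof (rule terminating_has_sum[OF assms(3) _ \<alpha> ax assms(9) assms(5-8)])
      \<comment> \<open>Termination is formulated with exponents M_r + 1; N r \<ge> 1 makes the
        truncated difference N r - 1 exact.\<close>
      show "a r = q ^ Suc (N r - 1)" if "r \<in> {1..n}" for r
        using N[OF that] by simp
    qed
  qed
  moreover have "inner_kernel \<alpha> k m * inner_coeff (\<alpha> * b) ?u ?v (\<alpha> * c) (\<alpha> * d) m =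
     vandermonde_quot q n x m
       * (\<Prod>r=1..n. \<Prod>s=1..n. qpoch q (q powi (- int (k s)) * x r / x s) (m r)
                               / qpoch q (q * x r / x s) (m r))
       * (\<Prod>r=1..n. qpoch q (\<alpha> * x r * q ^ wt k) (m r) / qpoch q (\<alpha> * b * x r) (m r))
       * (qpoch q ?u (wt m) * qpoch q ?v (wt m) / (qpoch q (\<alpha> * c) (wt m) * qpoch q (\<alpha> * d) (wt m)))
       * q ^ (\<Sum>r=1..n. r * m r)" for k m
  proof -
    have "(\<Prod>r=1..n. qpoch q (\<alpha> * x r * q ^ wt k) (m r) / qpoch q (\<alpha> * b * x r) (m r)) =
      (\<Prod>r=1..n. qpoch q (\<alpha> * x r * q ^ wt k) (m r)) * (\<Prod>r=1..n. 1 / qpoch q (\<alpha> * b * x r) (m r))"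
      unfolding prod.distrib[symmetric] by simp
    then show ?thesis
      unfolding inner_kernel_def inner_coeff_def inner_weight_def by (simp only: mult_ac)
  qed
  moreover have "product_side \<alpha> b ?u ?v (\<alpha> * c) (\<alpha> * d) a =
      qpoch_inf q (\<alpha> * \<beta>) * qpoch_inf q (\<alpha> * \<gamma>)
         * qpoch_inf q (\<alpha> * ?P * c / q ^ n) * qpoch_inf q (\<alpha> * ?P * d / q ^ n)
         / (qpoch_inf q (\<alpha> * c) * qpoch_inf q (\<alpha> * d)
            * qpoch_inf q (\<alpha> * \<beta> * ?P / q ^ n) * qpoch_inf q (\<alpha> * \<gamma> * ?P / q ^ n))
         * (\<Prod>r=1..n. qpoch_inf q (\<alpha> * q * x r) * qpoch_inf q (\<alpha> * a r * b * x r / q)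
                        / (qpoch_inf q (\<alpha> * b * x r) * qpoch_inf q (\<alpha> * a r * x r)))"
    unfolding product_side_def by (simp only: mult_ac)
  ultimately show ?thesis
    by (simp only: summand_def[abs_def] outer_term_def)
qed

end
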